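(* Let $p\ge1$ and $0\le q\le p$ be integers. For every $k>0$ and $h>0$ (i.e. for every mesh $\mathcal T_h$), every $f\in L^2(\Omega)$ and $g\in L^2(\Gamma_R)$, the $hp$-IPDG scheme: find $u_h^q\in V_h^p$ such that $$a_h^q(u_h^q,v_h)-k^2(u_h^q,v_h)+\mathbf i k\langle u_h^q,v_h\rangle_{\Gamma_R}=(f,v_h)+\langle g,v_h\rangle_{\Gamma_R}\qquad\forall v_h\in V_h^p,$$ has a unique solution $u_h^q$, provided that $\gamma_{0,e},\gamma_{1,e},\dots,\gamma_{q,e}>0$ and $\beta_{1,e}\ge0$.
   Context: Domain. $d\in\{2,3\}$; $\Omega_1\subset\mathbb R^d$ is a bounded polygonal/polyhedral domain, $D\subset\Omega_1$ is a bounded Lipschitz domain (the case $D=\emptyset$ is allowed), $\Omega:=\Omega_1\setminus D$, $\Gamma_R:=\partial\Omega_1$, $\Gamma_D:=\partial D$, $n_\Omega$ is the unit outward normal to $\Omega$. A domain $Q$ is star-shaped with respect to $x_Q\in Q$ if there is $c_Q\ge0$ with $(x-x_Q)\cdot n_Q\ge c_Q$ for all $x\in\partial Q$, and strictly star-shaped if $c_Q>0$. Standing assumption: $\Omega_1$ is strictly star-shaped with respect to a point $x_{\Omega_1}$, and $D$, if nonempty, is star-shaped with respect to the same point. All functions are complex-valued; $(u,v)_Q=\int_Q u\bar v$, $\langle u,v\rangle_\Sigma=\int_\Sigma u\bar v$, $(\cdot,\cdot)=(\cdot,\cdot)_\Omega$, $\mathbf i=\sqrt{-1}$. Mesh. $\mathcal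 T_h$ is a partition of $\Omega$ into triangles/tetrahedra (hanging nodes allowed) from a family satisfying the minimal angle condition and locally quasi-uniform (adjacent elements have comparable diameters). $h_e=\mathrm{diam}(e)$. Interior edges/faces are the sets $e=\partial K\cap\partial K'$ of positive $(d-1)$-measure, boundary ones the sets $e=\partial K\cap\partial\Omega$ of positive measure. $\mathcal E_h^I,\mathcal E_h^D$ are the sets of interior edges/faces and those on $\Gamma_D$; $\mathcal E_h^{ID}=\mathcal E_h^I\cup\mathcal E_h^D$. The elements are globally labelled. On $e=\partial K\cap\partial K'\in\mathcal E_h^I$, with $K$ having the larger label, $[v]=v|_K-v|_{K'}$, $\{v\}=\frac12(v|_K+v|_{K'})$, and $n_e$ is the unit outward normal to $K$. On $e\in\mathcal E_h^D$: $n_e=n_\Omega$, $\{v\}=[v]=v$. $\{\tau_e^\ell\}_{\ell=1}^{d-1}$ is an orthogonal (unit) coordinate frame on $e$, $\partial v/\partial\tau_e^\ell=\nabla v\cdot\tau_e^\ell$, and $\partial^jv/\partial n_e^j$ is the $j$th normal derivative. Method. $V_h^p=\prod_{K\in\mathcal T_h}\mathcal P_p(K)$ (piecewise complex polynomials of degree at most $p$, no continuity). $a_h^q(u,v)=b_h(u,v)+\mathbf i\big(L_1(u,v)+\sum_{j=0}^qJ_j(u,v)\big)$ with $b_h(u,v)=\sum_{K}(\nabla u,\nabla v)_K-\sum_{e\in\mathcal E_h^{ID}}\big(\langle\{\frac{\partial u}{\partial n_e}\},[v]\rangle_e+\langle[u],\{\frac{\partial v}{\partial n_e}\}\rangle_e\big)$,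 $L_1(u,v)=\sum_{e\in\mathcal E_h^{ID}}\sum_{\ell=1}^{d-1}\frac{\beta_{1,e}p}{h_e}\langle[\frac{\partial u}{\partial\tau_e^\ell}],[\frac{\partial v}{\partial\tau_e^\ell}]\rangle_e$, $J_0(u,v)=\sum_{e\in\mathcal E_h^{ID}}\frac{\gamma_{0,e}p}{h_e}\langle[u],[v]\rangle_e$, $J_j(u,v)=\sum_{e\in\mathcal E_h^I}\gamma_{j,e}\big(\frac{h_e}{p}\big)^{2j-1}\langle[\frac{\partial^ju}{\partial n_e^j}],[\frac{\partial^jv}{\partial n_e^j}]\rangle_e$, $1\le j\le q$. The real numbers $\beta_{1,e},\gamma_{j,e}$ are the penalty parameters. *)

theory Defs
  imports "HOL-Analysis.Analysis"
begin

section \<open>Domains\<close>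

definition is_domain :: "(real^'n) set \<Rightarrow> bool" where
  "is_domain S \<longleftrightarrow> open S \<and> connected S \<and> S \<noteq> {}"

text \<open>Taking the interior of the closed polyhedron rules out slits: the domain lies locally on one
  side of its boundary.\<close>

definition bounded_polyhedral_domain :: "(real^'n) set \<Rightarrow> bool" where
  "bounded_polyhedral_domain S \<longleftrightarrow> is_domain S \<and> bounded S \<and>
     (\<exists>\<P>. finite \<P> \<and> (\<forall>P\<in>\<P>. polytope P) \<and> S = interior (\<Union>\<P>))"

text \<open>In a neighbourhood of each boundary point the domain is a strict subgraph, in some direction
  \<open>\<nu>\<close>, of a Lipschitz function on the orthogonal complement of \<open>\<nu>\<close>.\<close>

definition bounded_lipschitz_domain :: "(real^'n) set \<Rightarrow> bool" where
  "bounded_lipschitz_domain S \<longleftrightarrow> is_domain S \<and> bounded S \<and>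
     (\<forall>x\<in>frontier S. \<exists>\<nu> r L (\<phi> :: real^'n \<Rightarrow> real).
        norm \<nu> = 1 \<and> r > 0 \<and> L-lipschitz_on {z. \<nu> \<bullet> z = 0} \<phi> \<and>
        (\<forall>y\<in>ball x r. y \<in> S \<longleftrightarrow> \<nu> \<bullet> y < \<phi> (y - (\<nu> \<bullet> y) *\<^sub>R \<nu>)))"

text \<open>\<open>\<nu>\<close> is the unit outward normal to \<open>Q\<close> at \<open>x\<close> if, blown up at \<open>x\<close>, the set \<open>Q\<close> becomes the half
  space \<open>{z. z \<bullet> \<nu> < 0}\<close>.  For Lipschitz and polyhedral domains this holds, with a unique \<open>\<nu>\<close>, at
  almost every boundary point; there is no such \<open>\<nu>\<close> at corners and edges.\<close>

definition is_outward_normal :: "(real^'n) set \<Rightarrow> real^'n \<Rightarrow> real^'n \<Rightarrow> bool" where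
  "is_outward_normal Q x \<nu> \<longleftrightarrow> norm \<nu> = 1 \<and>
     (\<forall>\<epsilon>>0. \<exists>r>0. \<forall>y. 0 < dist y x \<and> dist y x < r \<longrightarrow>
        ((y - x) \<bullet> \<nu> \<le> - \<epsilon> * dist y x \<longrightarrow> y \<in> Q) \<and>
        ((y - x) \<bullet> \<nu> \<ge> \<epsilon> * dist y x \<longrightarrow> y \<notin> Q))"

definition outward_normal :: "(real^'n) set \<Rightarrow> real^'n \<Rightarrow> real^'n" where
  "outward_normal Q x = (THE \<nu>. is_outward_normal Q x \<nu>)"

text \<open>The inequality is required at those boundary points where the normal exists.\<close>

definition star_shaped_const :: "(real^'n) set \<Rightarrow> real^'n \<Rightarrow> real \<Rightarrow> bool" where
  "star_shaped_const Q x\<^sub>Q c \<longleftrightarrow> x\<^sub>Q \<in> Q \<and>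
     (\<forall>x\<in>frontier Q. \<forall>\<nu>. is_outward_normal Q x \<nu> \<longrightarrow> (x - x\<^sub>Q) \<bullet> \<nu> \<ge> c)"

definition star_shaped :: "(real^'n) set \<Rightarrow> real^'n \<Rightarrow> bool" where
  "star_shaped Q x\<^sub>Q \<longleftrightarrow> (\<exists>c\<ge>0. star_shaped_const Q x\<^sub>Q c)"

definition strictly_star_shaped :: "(real^'n) set \<Rightarrow> real^'n \<Rightarrow> bool" where
  "strictly_star_shaped Q x\<^sub>Q \<longleftrightarrow> (\<exists>c>0. star_shaped_const Q x\<^sub>Q c)"

section \<open>Surface measure and square integrable functions\<close>

text \<open>\<open>(d-1)\<close>-dimensional Lebesgue measure on a hyperplane \<open>H\<close> of \<open>\<real>\<^sup>d\<close>, as a measure on \<open>\<real>\<^sup>d\<close>: the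
  Lebesgue measure of the slab of thickness 1 around \<open>H\<close>, projected orthogonally onto \<open>H\<close>.\<close>

definition hyperplane_lborel :: "(real^'n) set \<Rightarrow> (real^'n) measure" where
  "hyperplane_lborel H =
     distr (restrict_space lborel {y. infdist y H \<le> 1/2}) borel (closest_point H)"

text \<open>Surface measure for flat pieces: the sum of the measures of all hyperplanes.  Two distinct
  hyperplanes meet in a null set of either, so on a subset of finitely many hyperplanes this is the
  \<open>(d-1)\<close>-dimensional surface measure.  Curved surfaces get measure 0; all sets over which surface
  integrals are taken below are polyhedral.\<close>

definition surface_measure :: "(real^'n) measure" where
  "surface_measure = measure_of UNIV (sets borel)
     (\<lambda>A. \<integral>\<^sup>+ H. emeasure (hyperplane_lborel H) A
        \<partial>count_space {H :: (real^'n) set. affine H \<and> aff_dim H = int CARD('n) - 1})"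

definition L2_space :: "'a measure \<Rightarrow> 'a set \<Rightarrow> ('a \<Rightarrow> complex) set" where
  "L2_space M S = {f. set_borel_measurable M S f \<and> set_integrable M S (\<lambda>x. (cmod (f x))\<^sup>2)}"

definition L2_inner :: "'a measure \<Rightarrow> 'a set \<Rightarrow> ('a \<Rightarrow> complex) \<Rightarrow> ('a \<Rightarrow> complex) \<Rightarrow> complex" where
  "L2_inner M S u v = (LINT x:S|M. u x * cnj (v x))"

section \<open>Meshes\<close>

definition simplicial_mesh :: "(real^'n) set \<Rightarrow> (real^'n) set set \<Rightarrow> bool" where
  "simplicial_mesh \<Omega> T \<longleftrightarrow> finite T \<and> (\<forall>K\<in>T. int CARD('n) simplex K) \<and>
     \<Union>T = closure \<Omega> \<and> pairwise (\<lambda>K K'. interior K \<inter> interior K' = {}) T"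

definition interior_faces :: "(real^'n) set set \<Rightarrow> (real^'n) set set" where
  "interior_faces T = {frontier K \<inter> frontier K' | K K'. K \<in> T \<and> K' \<in> T \<and> K \<noteq> K' \<and>
     emeasure surface_measure (frontier K \<inter> frontier K') > 0}"

text \<open>The part of a facet of an element that lies on the boundary part \<open>\<Gamma>\<close>.  Using single facets
  keeps faces flat when an element has several facets on the boundary.\<close>

definition boundary_faces :: "(real^'n) set set \<Rightarrow> (real^'n) set \<Rightarrow> (real^'n) set set" where
  "boundary_faces T \<Gamma> = {F \<inter> \<Gamma> | F K. K \<in> T \<and> F facet_of K \<and>
     emeasure surface_measure (F \<inter> \<Gamma>) > 0}"

definition vec_angle :: "real^'n \<Rightarrow> real^'n \<Rightarrow> real" where
  "vec_angle u v = arccos ((u \<bullet> v) / (norm u * norm v))"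

definition orth_part :: "real^'n \<Rightarrow> real^'n \<Rightarrow> real^'n" where
  "orth_part w u = u - ((u \<bullet> w) / (w \<bullet> w)) *\<^sub>R w"

text \<open>Angles of the triangular faces, and (vacuous for triangles) the dihedral angles at the edges.\<close>

definition angles_at_least :: "real \<Rightarrow> (real^'n) set \<Rightarrow> bool" where
  "angles_at_least \<theta> K \<longleftrightarrow>
     (\<forall>a b c. {a, b, c} \<subseteq> {v. v extreme_point_of K} \<and> distinct [a, b, c] \<longrightarrow>
        \<theta> \<le> vec_angle (b - a) (c - a)) \<and>
     (\<forall>a b c d. {a, b, c, d} \<subseteq> {v. v extreme_point_of K} \<and> distinct [a, b, c, d] \<longrightarrow>
        \<theta> \<le> vec_angle (orth_part (b - a) (c - a)) (orth_part (b - a) (d - a)))"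

definition minimal_angle_condition :: "(real^'n) set set set \<Rightarrow> bool" where
  "minimal_angle_condition \<T> \<longleftrightarrow> (\<exists>\<theta>>0. \<forall>T\<in>\<T>. \<forall>K\<in>T. angles_at_least \<theta> K)"

definition locally_quasi_uniform :: "(real^'n) set set set \<Rightarrow> bool" where
  "locally_quasi_uniform \<T> \<longleftrightarrow> (\<exists>C. \<forall>T\<in>\<T>. \<forall>K\<in>T. \<forall>K'\<in>T.
     K \<noteq> K' \<and> frontier K \<inter> frontier K' \<in> interior_faces T \<longrightarrow> diameter K \<le> C * diameter K')"

definition admissible_mesh_family :: "(real^'n) set \<Rightarrow> (real^'n) set set set \<Rightarrow> bool" where
  "admissible_mesh_family \<Omega> \<T> \<longleftrightarrow> (\<forall>T\<in>\<T>. simplicial_mesh \<Omega> T) \<and>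
     minimal_angle_condition \<T> \<and> locally_quasi_uniform \<T>"

text \<open>\<open>\<tau> 1, \<dots>, \<tau> (d-1)\<close> are orthonormal vectors in the direction space of the flat face \<open>e\<close>.\<close>

definition tangent_frame :: "(real^'n) set \<Rightarrow> (nat \<Rightarrow> real^'n) \<Rightarrow> bool" where
  "tangent_frame e \<tau> \<longleftrightarrow>
     (\<forall>l\<in>{1..CARD('n) - 1}. \<tau> l \<in> span {x - y | x y. x \<in> e \<and> y \<in> e} \<and> norm (\<tau> l) = 1) \<and>
     (\<forall>l\<in>{1..CARD('n) - 1}. \<forall>m\<in>{1..CARD('n) - 1}. l \<noteq> m \<longrightarrow> \<tau> l \<bullet> \<tau> m = 0)"

section \<open>Broken polynomial spaces\<close>

text \<open>The sum ranges over the multi-indices of total degree at most \<open>p\<close>.\<close>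

definition poly_space :: "nat \<Rightarrow> (real^'n \<Rightarrow> complex) set" where
  "poly_space p = {f. \<exists>c. f = (\<lambda>x. \<Sum>\<alpha> | sum \<alpha> UNIV \<le> p.
     c \<alpha> * (\<Prod>i\<in>UNIV. complex_of_real (x $ i) ^ \<alpha> i))}"

text \<open>Broken functions have one component per element.  A polynomial on the element \<open>K\<close> is represented
  by its unique polynomial extension to the whole space, so \<open>v K x\<close> for \<open>x\<close> on the boundary of \<open>K\<close> is
  the trace of \<open>v|\<^sub>K\<close>.\<close>

type_synonym 'n broken = "(real^'n) set \<Rightarrow> real^'n \<Rightarrow> complex"

definition dg_space :: "(real^'n) set set \<Rightarrow> nat \<Rightarrow> 'n broken set" where
  "dg_space T p = (T \<rightarrow>\<^sub>E poly_space p)"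

text \<open>The function given by a broken function.  Almost every point of the meshed domain, and (with
  respect to surface measure) of its boundary, lies in exactly one element.\<close>

definition glue :: "(real^'n) set set \<Rightarrow> 'n broken \<Rightarrow> real^'n \<Rightarrow> complex" where
  "glue T v x = (\<Sum>K\<in>{K\<in>T. x \<in> K}. v K x)"

definition dir_deriv :: "real^'n \<Rightarrow> (real^'n \<Rightarrow> complex) \<Rightarrow> real^'n \<Rightarrow> complex" where
  "dir_deriv \<nu> f x = frechet_derivative f (at x) \<nu>"

section \<open>Jumps, averages and the sesquilinear form\<close>

text \<open>The elements with the largest and the smallest label among those having \<open>e\<close> on their boundary:
  the two neighbours of an interior face; for a boundary face both are its only element.\<close>

definition plus_elem :: "(real^'n) set set \<Rightarrow> ((real^'n) set \<Rightarrow> nat) \<Rightarrow> (real^'n) set \<Rightarrow> (real^'n) set" where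
  "plus_elem T lab e =
     (THE K. K \<in> T \<and> e \<subseteq> frontier K \<and> (\<forall>K'\<in>T. e \<subseteq> frontier K' \<longrightarrow> lab K' \<le> lab K))"

definition minus_elem :: "(real^'n) set set \<Rightarrow> ((real^'n) set \<Rightarrow> nat) \<Rightarrow> (real^'n) set \<Rightarrow> (real^'n) set" where
  "minus_elem T lab e =
     (THE K. K \<in> T \<and> e \<subseteq> frontier K \<and> (\<forall>K'\<in>T. e \<subseteq> frontier K' \<longrightarrow> lab K \<le> lab K'))"

definition jump :: "(real^'n) set set \<Rightarrow> ((real^'n) set \<Rightarrow> nat) \<Rightarrow> (real^'n) set \<Rightarrow> 'n broken \<Rightarrow>
    real^'n \<Rightarrow> complex" where
  "jump T lab e w x =
     (if e \<in> interior_faces T then w (plus_elem T lab e) x - w (minus_elem T lab e) x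
      else w (plus_elem T lab e) x)"

definition average :: "(real^'n) set set \<Rightarrow> ((real^'n) set \<Rightarrow> nat) \<Rightarrow> (real^'n) set \<Rightarrow> 'n broken \<Rightarrow>
    real^'n \<Rightarrow> complex" where
  "average T lab e w x =
     (if e \<in> interior_faces T then (w (plus_elem T lab e) x + w (minus_elem T lab e) x) / 2
      else w (plus_elem T lab e) x)"

definition face_normal :: "(real^'n) set \<Rightarrow> (real^'n) set set \<Rightarrow> ((real^'n) set \<Rightarrow> nat) \<Rightarrow>
    (real^'n) set \<Rightarrow> real^'n \<Rightarrow> real^'n" where
  "face_normal \<Omega> T lab e x =
     (if e \<in> interior_faces T then outward_normal (plus_elem T lab e) x else outward_normal \<Omega> x)"

text \<open>The \<open>j\<close>-th normal derivative; the direction is frozen at the evaluation point \<open>x\<close>.\<close>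

definition normal_deriv :: "(real^'n) set \<Rightarrow> (real^'n) set set \<Rightarrow> ((real^'n) set \<Rightarrow> nat) \<Rightarrow>
    (real^'n) set \<Rightarrow> nat \<Rightarrow> 'n broken \<Rightarrow> 'n broken" where
  "normal_deriv \<Omega> T lab e j v K x = (dir_deriv (face_normal \<Omega> T lab e x) ^^ j) (v K) x"

definition tang_deriv :: "real^'n \<Rightarrow> 'n broken \<Rightarrow> 'n broken" where
  "tang_deriv \<tau> v K x = dir_deriv \<tau> (v K) x"

definition grad_inner :: "(real^'n) set \<Rightarrow> (real^'n \<Rightarrow> complex) \<Rightarrow> (real^'n \<Rightarrow> complex) \<Rightarrow> complex" where
  "grad_inner K u v =
     (LINT x:K|lebesgue. \<Sum>i\<in>UNIV. dir_deriv (axis i 1) u x * cnj (dir_deriv (axis i 1) v x))"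

text \<open>In the forms below \<open>\<Gamma>\<close> is the Dirichlet part of the boundary of \<open>\<Omega>\<close>.\<close>

definition form_b :: "(real^'n) set \<Rightarrow> (real^'n) set \<Rightarrow> (real^'n) set set \<Rightarrow> ((real^'n) set \<Rightarrow> nat) \<Rightarrow>
    'n broken \<Rightarrow> 'n broken \<Rightarrow> complex" where
  "form_b \<Omega> \<Gamma> T lab u v =
     (\<Sum>K\<in>T. grad_inner K (u K) (v K)) -
     (\<Sum>e\<in>interior_faces T \<union> boundary_faces T \<Gamma>.
        L2_inner surface_measure e
          (average T lab e (normal_deriv \<Omega> T lab e 1 u)) (jump T lab e v) +
        L2_inner surface_measure e
          (jump T lab e u) (average T lab e (normal_deriv \<Omega> T lab e 1 v)))"

definition form_L1 :: "(real^'n) set \<Rightarrow> (real^'n) set set \<Rightarrow> ((real^'n) set \<Rightarrow> nat) \<Rightarrow>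
    ((real^'n) set \<Rightarrow> nat \<Rightarrow> real^'n) \<Rightarrow> nat \<Rightarrow> ((real^'n) set \<Rightarrow> real) \<Rightarrow>
    'n broken \<Rightarrow> 'n broken \<Rightarrow> complex" where
  "form_L1 \<Gamma> T lab \<tau> p \<beta>\<^sub>1 u v =
     (\<Sum>e\<in>interior_faces T \<union> boundary_faces T \<Gamma>. \<Sum>l=1..CARD('n) - 1.
        complex_of_real (\<beta>\<^sub>1 e * real p / diameter e) *
        L2_inner surface_measure e
          (jump T lab e (tang_deriv (\<tau> e l) u)) (jump T lab e (tang_deriv (\<tau> e l) v)))"

definition form_J0 :: "(real^'n) set \<Rightarrow> (real^'n) set set \<Rightarrow> ((real^'n) set \<Rightarrow> nat) \<Rightarrow>
    nat \<Rightarrow> ((real^'n) set \<Rightarrow> real) \<Rightarrow> 'n broken \<Rightarrow> 'n broken \<Rightarrow> complex" where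
  "form_J0 \<Gamma> T lab p \<gamma>\<^sub>0 u v =
     (\<Sum>e\<in>interior_faces T \<union> boundary_faces T \<Gamma>.
        complex_of_real (\<gamma>\<^sub>0 e * real p / diameter e) *
        L2_inner surface_measure e (jump T lab e u) (jump T lab e v))"

text \<open>Only used for \<open>j \<ge> 1\<close>, where the natural-number exponent does not truncate.\<close>

definition form_J :: "(real^'n) set \<Rightarrow> (real^'n) set set \<Rightarrow> ((real^'n) set \<Rightarrow> nat) \<Rightarrow>
    nat \<Rightarrow> nat \<Rightarrow> ((real^'n) set \<Rightarrow> real) \<Rightarrow> 'n broken \<Rightarrow> 'n broken \<Rightarrow> complex" where
  "form_J \<Omega> T lab p j \<gamma>\<^sub>j u v =
     (\<Sum>e\<in>interior_faces T.
        complex_of_real (\<gamma>\<^sub>j e * (diameter e / real p) ^ (2 * j - 1)) *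
        L2_inner surface_measure e
          (jump T lab e (normal_deriv \<Omega> T lab e j u)) (jump T lab e (normal_deriv \<Omega> T lab e j v)))"

definition form_a :: "(real^'n) set \<Rightarrow> (real^'n) set \<Rightarrow> (real^'n) set set \<Rightarrow> ((real^'n) set \<Rightarrow> nat) \<Rightarrow>
    ((real^'n) set \<Rightarrow> nat \<Rightarrow> real^'n) \<Rightarrow> nat \<Rightarrow> nat \<Rightarrow>
    ((real^'n) set \<Rightarrow> real) \<Rightarrow> (nat \<Rightarrow> (real^'n) set \<Rightarrow> real) \<Rightarrow>
    'n broken \<Rightarrow> 'n broken \<Rightarrow> complex" where
  "form_a \<Omega> \<Gamma> T lab \<tau> p q \<beta>\<^sub>1 \<gamma> u v =
     form_b \<Omega> \<Gamma> T lab u v +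
     \<i> * (form_L1 \<Gamma> T lab \<tau> p \<beta>\<^sub>1 u v + form_J0 \<Gamma> T lab p (\<gamma> 0) u v +
          (\<Sum>j=1..q. form_J \<Omega> T lab p j (\<gamma> j) u v))"

end

theory Submission
  imports Defs
begin

text \<open>The left-hand side of the scheme is \<open>b(u,v) - k\<^sup>2 (u,v) + \<i> P(u,v)\<close>, where \<open>b\<close> is hermitian and \<open>P\<close>, the sum
of all penalty terms and of \<open>k\<close> times the inner product on the outer boundary, is hermitian and
positive semidefinite.  On a finite-dimensional space it suffices to show that the adjoint form,
which has \<open>- \<i>\<close> in place of \<open>\<i>\<close>, and the form itself have trivial kernels; one argument covers both
signs (\<open>scheme_kernel_trivial\<close>), and \<open>solvable_if_adjoint_injective\<close> gives existence.

Let \<open>u\<close> be in the kernel.  The imaginary part of the equation tested with \<open>v = u\<close> is \<open>P(u,u) = 0\<close>.  Hence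
\<open>P(u,v) = 0\<close> for all \<open>v\<close>, \<open>u\<close> does not jump across interior faces (this is where \<open>\<gamma> 0 > 0\<close> enters), and
\<open>u = 0\<close> on the inner and on the outer boundary.  What remains is \<open>b(u,v) = k\<^sup>2 (u,v)\<close> for all \<open>v\<close>, and it
forces \<open>u = 0\<close> (\<open>form_b_kernel_trivial\<close>) by a discrete Rellich argument.  Let \<open>z\<close> be the common star centre
and \<open>d\<close> the dimension.  Testing with \<open>u\<close> gives \<open>\<parallel>\<nabla>u\<parallel>\<^sup>2 = k\<^sup>2 \<parallel>u\<parallel>\<^sup>2\<close>.  The function \<open>(x - z) \<bullet> \<nabla>u\<close>, formed element by
element, is again a broken polynomial of degree at most \<open>p\<close>, so it may be used as a test function.
By the divergence theorem on each element, the volume terms of the resulting identity add up to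
\<open>(2 - d) \<parallel>\<nabla>u\<parallel>\<^sup>2 + d k\<^sup>2 \<parallel>u\<parallel>\<^sup>2 = 2 k\<^sup>2 \<parallel>u\<parallel>\<^sup>2\<close>.  In the surface terms, the two sides of an interior face
cancel exactly against the consistency term \<open>2 Re ({\<partial>u/\<partial>n}, [v])\<close>, because a continuous \<open>u\<close> has only a
normal gradient jump; on the inner and outer boundary there remain \<open>- (x - z) \<bullet> n |\<partial>u/\<partial>n|\<^sup>2\<close> and
\<open>(x - z) \<bullet> n |\<partial>u/\<partial>n|\<^sup>2\<close>, which are nonnegative because \<open>D\<close> and \<open>\<Omega>\<^sub>1\<close> are star-shaped with respect to \<open>z\<close>.
So \<open>2 k\<^sup>2 \<parallel>u\<parallel>\<^sup>2 \<le> 0\<close>.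

Two tools make this rigorous for the geometry at hand.  The first is the divergence theorem for
polytopes with respect to \<open>surface_measure\<close> (\<open>divergence_polytope\<close>), obtained from Fubini's theorem along
lines and the fundamental theorem of calculus.  The second is a finite hyperplane arrangement that
contains the facets of all elements and the boundary of \<open>\<Omega>\<^sub>1\<close>.  Almost every boundary point lies in
only one of its hyperplanes, and there each of the sets involved looks like a half ball, a ball or
the empty set.  This leaves three types of points (\<open>frontier_point_cases\<close>), identifies the faces and
normals occurring in the forms, hanging nodes included, and reduces the cancellation of the surface
terms to a pointwise computation (\<open>total_flux_nonneg\<close>).\<close>

section \<open>Lebesgue measure on hyperplanes\<close>

lemma closest_point_hyperplane:
  fixes n x :: "real^'n"
  assumes "norm n = 1"
  shows "closest_point {y. n \<bullet> y = b} x = x - (n \<bullet> x - b) *\<^sub>R n"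
    and "infdist x {y. n \<bullet> y = b} = \<bar>n \<bullet> x - b\<bar>"
proof -
  let ?H = "{y. n \<bullet> y = b}" and ?p = "x - (n \<bullet> x - b) *\<^sub>R n"
  have nn: "n \<bullet> n = 1" using assms by (simp add: dot_square_norm)
  have p: "?p \<in> ?H" by (simp add: inner_diff_right nn)
  have d: "dist x ?p = \<bar>n \<bullet> x - b\<bar>" using assms by (simp add: dist_norm)
  have le: "dist x ?p \<le> dist x z" if "z \<in> ?H" for z
  proof -
    have "\<bar>n \<bullet> (x - z)\<bar> \<le> norm n * norm (x - z)" by (rule Cauchy_Schwarz_ineq2)
    then show ?thesis using that assms d by (simp add: dist_norm inner_diff_right)
  qed
  show "closest_point ?H x = ?p"
    by (rule closest_point_unique[symmetric])
      (use p le in \<open>auto simp: convex_hyperplane closed_hyperplane\<close>)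
  show "infdist x ?H = \<bar>n \<bullet> x - b\<bar>"
  proof (rule antisym)
    show "infdist x ?H \<le> \<bar>n \<bullet> x - b\<bar>" using infdist_le[OF p, of x] unfolding d .
    show "\<bar>n \<bullet> x - b\<bar> \<le> infdist x ?H"
      unfolding d[symmetric] infdist_def using p le by (auto intro!: cINF_greatest)
  qed
qed

lemma space_hyperplane_lborel [simp]: "space (hyperplane_lborel H) = UNIV"
  and sets_hyperplane_lborel [simp, measurable_cong]: "sets (hyperplane_lborel H) = sets borel"
  by (simp_all add: hyperplane_lborel_def)

lemma nn_integral_hyperplane_lborel:
  fixes n :: "real^'n"
  assumes "norm n = 1" and g: "g \<in> borel_measurable borel"
  shows "(\<integral>\<^sup>+y. g y \<partial>hyperplane_lborel {y. n \<bullet> y = b}) =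
    (\<integral>\<^sup>+x. g (x - (n \<bullet> x - b) *\<^sub>R n) * indicator {x. \<bar>n \<bullet> x - b\<bar> \<le> 1/2} x \<partial>lborel)"
proof -
  have [measurable]: "(\<lambda>x. x - (n \<bullet> x - b) *\<^sub>R n) \<in> borel_measurable borel" by measurable
  have S: "{x. \<bar>n \<bullet> x - b\<bar> \<le> 1/2} \<in> sets borel" by measurable
  have eq: "closest_point {y. n \<bullet> y = b} = (\<lambda>x. x - (n \<bullet> x - b) *\<^sub>R n)"
    "{y. infdist y {y. n \<bullet> y = b} \<le> 1/2} = {x. \<bar>n \<bullet> x - b\<bar> \<le> 1/2}"
    using closest_point_hyperplane[OF assms(1)] by (auto simp: fun_eq_iff)
  show ?thesis
    unfolding hyperplane_lborel_def eq
    apply (subst nn_integral_distr)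
      apply (rule measurable_restrict_space1, measurable)
     apply (rule g)
    apply (subst nn_integral_restrict_space)
    using S by auto
qed

lemma inner_unit: "norm (n::real^'n) = 1 \<Longrightarrow> n \<bullet> n = 1"
  by (simp add: dot_square_norm)

lemma nn_integral_lborel_translate:
  fixes m :: "'a::euclidean_space"
  assumes "g \<in> borel_measurable borel"
  shows "(\<integral>\<^sup>+x. g (x + m) \<partial>lborel) = (\<integral>\<^sup>+x. g x \<partial>lborel)"
proof -
  have "(\<integral>\<^sup>+x. g x \<partial>lborel) = (\<integral>\<^sup>+x. g x \<partial>distr lborel borel ((+) m))"
    by (simp add: lborel_distr_plus)
  also have "\<dots> = (\<integral>\<^sup>+x. g (m + x) \<partial>lborel)"
    using assms by (subst nn_integral_distr) auto
  finally show ?thesis by (simp add: add.commute)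
qed

text \<open>Orthogonal projection onto the hyperplane commutes with translations along it, so this is the
translation invariance of Lebesgue measure.\<close>

lemma nn_integral_hyperplane_translate:
  fixes n m :: "real^'n"
  assumes n: "norm n = 1" and m: "n \<bullet> m = 0" and g [measurable]: "g \<in> borel_measurable borel"
  shows "(\<integral>\<^sup>+y. g (y + m) \<partial>hyperplane_lborel {y. n \<bullet> y = b}) =
    (\<integral>\<^sup>+y. g y \<partial>hyperplane_lborel {y. n \<bullet> y = b})"
proof -
  let ?h = "\<lambda>x. g (x - (n \<bullet> x - b) *\<^sub>R n) * indicator {x. \<bar>n \<bullet> x - b\<bar> \<le> 1/2} x"
  have S [measurable]: "{x. \<bar>n \<bullet> x - b\<bar> \<le> 1/2} \<in> sets borel" by measurable
  have "(\<integral>\<^sup>+y. g (y + m) \<partial>hyperplane_lborel {y. n \<bullet> y = b}) = (\<integral>\<^sup>+x. ?h (x + m) \<partial>lborel)"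
    by (subst nn_integral_hyperplane_lborel[OF n])
       (auto intro!: nn_integral_cong simp: inner_add_right m algebra_simps split: split_indicator)
  also have "\<dots> = (\<integral>\<^sup>+x. ?h x \<partial>lborel)"
    by (rule nn_integral_lborel_translate) measurable
  also have "\<dots> = (\<integral>\<^sup>+y. g y \<partial>hyperplane_lborel {y. n \<bullet> y = b})"
    by (rule nn_integral_hyperplane_lborel[OF n g, symmetric])
  finally show ?thesis .
qed

lemma emeasure_hyperplane_bounded:
  fixes n :: "real^'n"
  assumes n: "norm n = 1" and A: "A \<in> sets borel" "bounded A"
  shows "emeasure (hyperplane_lborel {y. n \<bullet> y = b}) A < \<infinity>"
proof -
  obtain r where r: "\<And>x. x \<in> A \<Longrightarrow> norm x \<le> r" using A(2) by (auto simp: bounded_iff)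
  have [measurable]: "A \<in> sets borel" by (rule A)
  have "emeasure (hyperplane_lborel {y. n \<bullet> y = b}) A =
      (\<integral>\<^sup>+y. indicator A y \<partial>hyperplane_lborel {y. n \<bullet> y = b})" using A by simp
  also have "\<dots> = (\<integral>\<^sup>+x. indicator A (x - (n \<bullet> x - b) *\<^sub>R n) *
      indicator {x. \<bar>n \<bullet> x - b\<bar> \<le> 1/2} x \<partial>lborel)"
    by (rule nn_integral_hyperplane_lborel[OF n]) measurable
  also have "\<dots> \<le> (\<integral>\<^sup>+x. indicator (cball (0::real^'n) (r + 1/2)) x \<partial>lborel)"
  proof (intro nn_integral_mono)
    fix x
    have "norm x \<le> r + 1/2" if "x - (n \<bullet> x - b) *\<^sub>R n \<in> A" "\<bar>n \<bullet> x - b\<bar> \<le> 1/2"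
    proof -
      have "norm x \<le> norm (x - (n \<bullet> x - b) *\<^sub>R n) + norm ((n \<bullet> x - b) *\<^sub>R n)"
        by (metis norm_triangle_sub add.commute)
      also have "\<dots> \<le> r + 1/2" using r[OF that(1)] that(2) n by simp
      finally show ?thesis .
    qed
    then show "indicator A (x - (n \<bullet> x - b) *\<^sub>R n) *
      indicator {x. \<bar>n \<bullet> x - b\<bar> \<le> 1/2} x \<le> (indicator (cball 0 (r + 1/2)) x :: ennreal)"
      by (auto split: split_indicator)
  qed
  also have "\<dots> < \<infinity>" using emeasure_bounded_finite[OF bounded_cball, of "0::real^'n" "r + 1/2"] by simp
  finally show ?thesis .
qed

lemma sigma_finite_hyperplane_lborel:
  fixes n :: "real^'n"
  assumes n: "norm n = 1"
  shows "sigma_finite_measure (hyperplane_lborel {y. n \<bullet> y = b})"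
proof
  let ?B = "range (\<lambda>i::nat. cball (0::real^'n) (real i))"
  have "\<Union> ?B = UNIV" by (auto simp: real_arch_simple)
  then show "\<exists>A. countable A \<and> A \<subseteq> sets (hyperplane_lborel {y. n \<bullet> y = b}) \<and>
      \<Union> A = space (hyperplane_lborel {y. n \<bullet> y = b}) \<and>
      (\<forall>a\<in>A. emeasure (hyperplane_lborel {y. n \<bullet> y = b}) a \<noteq> \<infinity>)"
    using emeasure_hyperplane_bounded[OF n, of "cball 0 (real _)" b]
    by (intro exI[of _ ?B]) (auto simp: less_top)
qed

text \<open>For \<open>w = n\<close>, a translation in \<open>s\<close> removes the projection onto the hyperplane, and after exchanging the
integrals each \<open>h x\<close> is weighted with the thickness 1 of the slab.  A general \<open>w\<close> is \<open>(n \<bullet> w) n\<close> plus a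
tangential vector: the first part rescales \<open>s\<close>, the second is absorbed by translation invariance.\<close>

lemma nn_integral_hyperplane_lines:
  fixes n w :: "real^'n"
  assumes n: "norm n = 1" and nw: "n \<bullet> w \<noteq> 0" and h [measurable]: "h \<in> borel_measurable borel"
  shows "(\<integral>\<^sup>+x. h x \<partial>lborel) =
    ennreal \<bar>n \<bullet> w\<bar> * (\<integral>\<^sup>+y. (\<integral>\<^sup>+s. h (y + s *\<^sub>R w) \<partial>lborel) \<partial>hyperplane_lborel {y. n \<bullet> y = b})"
proof -
  let ?S = "hyperplane_lborel {y. n \<bullet> y = b}"
  let ?Z = "{x::real^'n. \<bar>n \<bullet> x - b\<bar> \<le> 1/2}"
  interpret S: sigma_finite_measure ?S by (rule sigma_finite_hyperplane_lborel[OF n])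
  interpret P: pair_sigma_finite ?S "lborel::real measure" ..
  have Z [measurable]: "?Z \<in> sets borel" by measurable
  have nn: "n \<bullet> n = 1" using n by (rule inner_unit)
  have normal: "(\<integral>\<^sup>+y. (\<integral>\<^sup>+s. h (y + s *\<^sub>R n) \<partial>lborel) \<partial>?S) = (\<integral>\<^sup>+x. h x \<partial>lborel)"
  proof -
    have "(\<integral>\<^sup>+y. (\<integral>\<^sup>+s. h (y + s *\<^sub>R n) \<partial>lborel) \<partial>?S) =
      (\<integral>\<^sup>+x. (\<integral>\<^sup>+s. h (x - (n \<bullet> x - b) *\<^sub>R n + s *\<^sub>R n) \<partial>lborel) * indicator ?Z x \<partial>lborel)"
      by (rule nn_integral_hyperplane_lborel[OF n]) measurable
    also have "\<dots> = (\<integral>\<^sup>+x. (\<integral>\<^sup>+s. h (x + s *\<^sub>R n) * indicator ?Z x \<partial>lborel) \<partial>lborel)"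
    proof (rule nn_integral_cong)
      fix x :: "real^'n"
      have "(\<integral>\<^sup>+s. h (x + s *\<^sub>R n) \<partial>lborel) = (\<integral>\<^sup>+s. h (x + (s + (-(n \<bullet> x - b))) *\<^sub>R n) \<partial>lborel)"
        by (rule nn_integral_lborel_translate[symmetric]) measurable
      then show "(\<integral>\<^sup>+s. h (x - (n \<bullet> x - b) *\<^sub>R n + s *\<^sub>R n) \<partial>lborel) * indicator ?Z x =
         (\<integral>\<^sup>+s. h (x + s *\<^sub>R n) * indicator ?Z x \<partial>lborel)"
        by (subst nn_integral_multc) (measurable, simp add: algebra_simps)
    qed
    also have "\<dots> = (\<integral>\<^sup>+s. (\<integral>\<^sup>+x. h (x + s *\<^sub>R n) * indicator ?Z x \<partial>lborel) \<partial>lborel)"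
      by (rule lborel_pair.Fubini') measurable
    also have "\<dots> = (\<integral>\<^sup>+s. (\<integral>\<^sup>+x. h x * indicator ?Z (x - s *\<^sub>R n) \<partial>lborel) \<partial>lborel)"
    proof (rule nn_integral_cong)
      fix s :: real
      have "(\<integral>\<^sup>+x. (\<lambda>x. h x * indicator ?Z (x - s *\<^sub>R n)) (x + s *\<^sub>R n) \<partial>lborel) =
         (\<integral>\<^sup>+x. h x * indicator ?Z (x - s *\<^sub>R n) \<partial>lborel)"
        by (rule nn_integral_lborel_translate) measurable
      then show "(\<integral>\<^sup>+x. h (x + s *\<^sub>R n) * indicator ?Z x \<partial>lborel) =
         (\<integral>\<^sup>+x. h x * indicator ?Z (x - s *\<^sub>R n) \<partial>lborel)" by simp
    qed
    also have "\<dots> = (\<integral>\<^sup>+x. (\<integral>\<^sup>+s. h x * indicator ?Z (x - s *\<^sub>R n) \<partial>lborel) \<partial>lborel)"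
      by (rule lborel_pair.Fubini'[symmetric]) measurable
    also have "\<dots> = (\<integral>\<^sup>+x. h x \<partial>lborel)"
    proof (rule nn_integral_cong)
      fix x :: "real^'n"
      have "(\<integral>\<^sup>+s. h x * indicator ?Z (x - s *\<^sub>R n) \<partial>lborel) =
         (\<integral>\<^sup>+s. h x * indicator {n \<bullet> x - b - 1/2 .. n \<bullet> x - b + 1/2} s \<partial>lborel)"
      proof (rule nn_integral_cong)
        fix s
        have "x - s *\<^sub>R n \<in> ?Z \<longleftrightarrow> s \<in> {n \<bullet> x - b - 1/2 .. n \<bullet> x - b + 1/2}"
          unfolding mem_Collect_eq abs_le_iff by (auto simp: inner_diff_right nn)
        then show "h x * indicator ?Z (x - s *\<^sub>R n) =
            h x * indicator {n \<bullet> x - b - 1/2 .. n \<bullet> x - b + 1/2} s"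
          by (simp only: indicator_def)
      qed
      also have "\<dots> = h x" by (subst nn_integral_cmult) auto
      finally show "(\<integral>\<^sup>+s. h x * indicator ?Z (x - s *\<^sub>R n) \<partial>lborel) = h x" .
    qed
    finally show ?thesis .
  qed
  define c where "c = n \<bullet> w"
  \<comment> \<open>the tangential part of \<open>w\<close>\<close>
  define m where "m = w - c *\<^sub>R n"
  have m: "n \<bullet> m = 0" by (simp add: m_def inner_diff_right nn c_def)
  have "(\<integral>\<^sup>+y. (\<integral>\<^sup>+s. h (y + s *\<^sub>R w) \<partial>lborel) \<partial>?S) = (\<integral>\<^sup>+s. (\<integral>\<^sup>+y. h (y + s *\<^sub>R w) \<partial>?S) \<partial>lborel)"
    by (rule P.Fubini'[symmetric]) measurable
  also have "\<dots> = (\<integral>\<^sup>+s. (\<integral>\<^sup>+y. h (y + (c * s) *\<^sub>R n) \<partial>?S) \<partial>lborel)"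
  proof (rule nn_integral_cong)
    fix s
    have "(\<integral>\<^sup>+y. (\<lambda>y. h (y + (c * s) *\<^sub>R n)) (y + s *\<^sub>R m) \<partial>?S) = (\<integral>\<^sup>+y. h (y + (c * s) *\<^sub>R n) \<partial>?S)"
      by (rule nn_integral_hyperplane_translate[OF n]) (simp_all add: m)
    then show "(\<integral>\<^sup>+y. h (y + s *\<^sub>R w) \<partial>?S) = (\<integral>\<^sup>+y. h (y + (c * s) *\<^sub>R n) \<partial>?S)"
      by (simp add: m_def algebra_simps)
  qed
  finally have 1: "(\<integral>\<^sup>+y. (\<integral>\<^sup>+s. h (y + s *\<^sub>R w) \<partial>lborel) \<partial>?S) =
    (\<integral>\<^sup>+s. (\<integral>\<^sup>+y. h (y + (c * s) *\<^sub>R n) \<partial>?S) \<partial>lborel)" .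
  have "(\<integral>\<^sup>+x. h x \<partial>lborel) = (\<integral>\<^sup>+s. (\<integral>\<^sup>+y. h (y + s *\<^sub>R n) \<partial>?S) \<partial>lborel)"
    unfolding normal[symmetric] by (rule P.Fubini'[symmetric]) measurable
  also have "\<dots> = ennreal \<bar>c\<bar> * (\<integral>\<^sup>+s. (\<integral>\<^sup>+y. h (y + (0 + c * s) *\<^sub>R n) \<partial>?S) \<partial>lborel)"
    by (rule nn_integral_real_affine) (use nw in \<open>measurable, simp add: c_def\<close>)
  finally show ?thesis unfolding 1 by (simp add: c_def)
qed

lemma AE_hyperplane_lborel:
  fixes n :: "real^'n"
  assumes n: "norm n = 1"
  shows "AE y in hyperplane_lborel {y. n \<bullet> y = b}. n \<bullet> y = b"
proof (rule AE_I[OF _ _ ])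
  have nn: "n \<bullet> n = 1" using n by (rule inner_unit)
  have [measurable]: "{y. n \<bullet> y \<noteq> b} \<in> sets borel" by measurable
  have "emeasure (hyperplane_lborel {y. n \<bullet> y = b}) {y. n \<bullet> y \<noteq> b} =
    (\<integral>\<^sup>+y. indicator {y. n \<bullet> y \<noteq> b} y \<partial>hyperplane_lborel {y. n \<bullet> y = b})" by simp
  also have "\<dots> = (\<integral>\<^sup>+x. indicator {y. n \<bullet> y \<noteq> b} (x - (n \<bullet> x - b) *\<^sub>R n) *
      indicator {x. \<bar>n \<bullet> x - b\<bar> \<le> 1/2} x \<partial>lborel)"
    by (rule nn_integral_hyperplane_lborel[OF n]) measurable
  also have "\<dots> = 0" by (simp add: inner_diff_right nn)
  finally show "emeasure (hyperplane_lborel {y. n \<bullet> y = b}) {y. n \<bullet> y \<noteq> b} = 0" .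
qed auto

text \<open>As an identity of measures, Fubini along lines also applies to functions of variable sign.\<close>

lemma hyperplane_lines_measure:
  fixes n w :: "real^'n"
  assumes n: "norm n = 1" and nw: "n \<bullet> w \<noteq> 0"
  shows "lborel = density (distr (hyperplane_lborel {y. n \<bullet> y = b} \<Otimes>\<^sub>M lborel) borel
      (\<lambda>(y, s). y + s *\<^sub>R w)) (\<lambda>_. ennreal \<bar>n \<bullet> w\<bar>)" (is "_ = density (distr (?S \<Otimes>\<^sub>M lborel) borel ?f) _")
proof (rule measure_eqI)
  interpret S: sigma_finite_measure ?S by (rule sigma_finite_hyperplane_lborel[OF n])
  interpret P: pair_sigma_finite ?S "lborel::real measure" ..
  fix A :: "(real^'n) set" assume "A \<in> sets lborel"
  then have [measurable]: "A \<in> sets borel" by simp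
  have f [measurable]: "?f \<in> measurable (?S \<Otimes>\<^sub>M lborel) borel" by measurable
  have "emeasure lborel A = (\<integral>\<^sup>+x. indicator A x \<partial>lborel)" by simp
  also have "\<dots> = ennreal \<bar>n \<bullet> w\<bar> * (\<integral>\<^sup>+y. (\<integral>\<^sup>+s. indicator A (y + s *\<^sub>R w) \<partial>lborel) \<partial>?S)"
    by (rule nn_integral_hyperplane_lines[OF n nw]) measurable
  also have "(\<integral>\<^sup>+y. (\<integral>\<^sup>+s. indicator A (y + s *\<^sub>R w) \<partial>lborel) \<partial>?S) =
      (\<integral>\<^sup>+z. indicator A (?f z) \<partial>(?S \<Otimes>\<^sub>M lborel))"
    using lborel.nn_integral_fst[of "\<lambda>z. indicator A (?f z)" ?S] by simp
  also have "\<dots> = (\<integral>\<^sup>+x. indicator A x \<partial>distr (?S \<Otimes>\<^sub>M lborel) borel ?f)"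
    by (subst nn_integral_distr) measurable
  also have "ennreal \<bar>n \<bullet> w\<bar> * \<dots> = emeasure (density (distr (?S \<Otimes>\<^sub>M lborel) borel ?f) (\<lambda>_. ennreal \<bar>n \<bullet> w\<bar>)) A"
    by (simp add: emeasure_density nn_integral_cmult)
  finally show "emeasure lborel A = \<dots>" .
qed simp

lemma integral_hyperplane_lines:
  fixes n w :: "real^'n" and h :: "real^'n \<Rightarrow> real"
  assumes n: "norm n = 1" and nw: "n \<bullet> w \<noteq> 0" and h: "integrable lborel h"
  shows "(LINT x|lborel. h x) =
      \<bar>n \<bullet> w\<bar> * (LINT y|hyperplane_lborel {y. n \<bullet> y = b}. (LINT s|lborel. h (y + s *\<^sub>R w)))"
    and "integrable (hyperplane_lborel {y. n \<bullet> y = b}) (\<lambda>y. LINT s|lborel. h (y + s *\<^sub>R w))"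
proof -
  let ?S = "hyperplane_lborel {y. n \<bullet> y = b}"
  let ?f = "\<lambda>(y, s). y + s *\<^sub>R w"
  interpret S: sigma_finite_measure ?S by (rule sigma_finite_hyperplane_lborel[OF n])
  interpret P: pair_sigma_finite ?S "lborel::real measure" ..
  have hm [measurable]: "h \<in> borel_measurable borel" using h by (auto dest: borel_measurable_integrable)
  have f [measurable]: "?f \<in> measurable (?S \<Otimes>\<^sub>M lborel) borel" by measurable
  note eq = hyperplane_lines_measure[OF n nw, of b]
  have "integrable (distr (?S \<Otimes>\<^sub>M lborel) borel ?f) (\<lambda>x. \<bar>n \<bullet> w\<bar> *\<^sub>R h x)"
    using h by (subst (asm) eq) (simp add: integrable_density)
  then have i: "integrable (distr (?S \<Otimes>\<^sub>M lborel) borel ?f) h"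
    using nw by simp
  then have ip: "integrable (?S \<Otimes>\<^sub>M lborel) (\<lambda>z. h (?f z))"
    by (subst (asm) integrable_distr_eq) measurable
  have "(LINT x|lborel. h x) = \<bar>n \<bullet> w\<bar> * (LINT x|distr (?S \<Otimes>\<^sub>M lborel) borel (?f). h x)"
    by (subst eq) (simp add: integral_density)
  also have "(LINT x|distr (?S \<Otimes>\<^sub>M lborel) borel (?f). h x) = (LINT z|(?S \<Otimes>\<^sub>M lborel). h (?f z))"
    by (rule integral_distr) measurable
  also have "\<dots> = (LINT y|?S. (LINT s|lborel. h (y + s *\<^sub>R w)))"
    using P.integral_fst'[OF ip] by simp
  finally show "(LINT x|lborel. h x) = \<bar>n \<bullet> w\<bar> * (LINT y|?S. (LINT s|lborel. h (y + s *\<^sub>R w)))" .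
  show "integrable ?S (\<lambda>y. LINT s|lborel. h (y + s *\<^sub>R w))"
    using P.integrable_fst'[OF ip] by simp
qed

text \<open>Projection along \<open>w\<close> changes areas by the ratio of the factors \<open>\<bar>n \<bullet> w\<bar>\<close>: the volume of an oblique cylinder
of height 1 over a part of the first hyperplane can be computed along the lines in direction \<open>w\<close>
starting from either hyperplane.\<close>

lemma nn_integral_hyperplane_transport:
  fixes n1 n2 w :: "real^'n"
  assumes n1: "norm n1 = 1" and w1: "n1 \<bullet> w \<noteq> 0" and n2: "norm n2 = 1" and w2: "n2 \<bullet> w \<noteq> 0"
    and g [measurable]: "g \<in> borel_measurable borel"
  shows "ennreal \<bar>n1 \<bullet> w\<bar> * (\<integral>\<^sup>+y. g y \<partial>hyperplane_lborel {y. n1 \<bullet> y = b1}) =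
    ennreal \<bar>n2 \<bullet> w\<bar> * (\<integral>\<^sup>+y. g (y - ((n1 \<bullet> y - b1) / (n1 \<bullet> w)) *\<^sub>R w) \<partial>hyperplane_lborel {y. n2 \<bullet> y = b2})"
proof -
  define t where "t y = (n1 \<bullet> y - b1) / (n1 \<bullet> w)" for y
  have [measurable]: "t \<in> borel_measurable borel" unfolding t_def by measurable
  have t: "t (y + s *\<^sub>R w) = t y + s" for y s
    using w1 by (simp add: t_def inner_add_right field_simps)
  \<comment> \<open>supported in the cylinder of height 1 along \<open>w\<close> over the first hyperplane\<close>
  define h where "h x = g (x - t x *\<^sub>R w) * indicator {0..<1} (t x)" for x
  have [measurable]: "h \<in> borel_measurable borel" unfolding h_def by measurable
  have inner: "(\<integral>\<^sup>+s. h (y + s *\<^sub>R w) \<partial>lborel) = g (y - t y *\<^sub>R w)" for y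
  proof -
    have "(\<integral>\<^sup>+s. h (y + s *\<^sub>R w) \<partial>lborel) = (\<integral>\<^sup>+s. g (y - t y *\<^sub>R w) * indicator {- t y..<1 - t y} s \<partial>lborel)"
      by (rule nn_integral_cong) (auto simp: h_def t algebra_simps split: split_indicator)
    also have "\<dots> = g (y - t y *\<^sub>R w)" by (subst nn_integral_cmult) auto
    finally show ?thesis .
  qed
  have "ennreal \<bar>n1 \<bullet> w\<bar> * (\<integral>\<^sup>+y. g y \<partial>hyperplane_lborel {y. n1 \<bullet> y = b1}) =
      ennreal \<bar>n1 \<bullet> w\<bar> * (\<integral>\<^sup>+y. g (y - t y *\<^sub>R w) \<partial>hyperplane_lborel {y. n1 \<bullet> y = b1})"
  proof -
    have "AE y in hyperplane_lborel {y. n1 \<bullet> y = b1}. g y = g (y - t y *\<^sub>R w)"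
      using AE_hyperplane_lborel[OF n1, of b1] by eventually_elim (simp add: t_def)
    then show ?thesis by (simp add: nn_integral_cong_AE)
  qed
  also have "\<dots> = (\<integral>\<^sup>+x. h x \<partial>lborel)"
    by (subst nn_integral_hyperplane_lines[OF n1 w1, of h b1]) (simp_all add: inner)
  also have "\<dots> = ennreal \<bar>n2 \<bullet> w\<bar> * (\<integral>\<^sup>+y. g (y - t y *\<^sub>R w) \<partial>hyperplane_lborel {y. n2 \<bullet> y = b2})"
    by (subst nn_integral_hyperplane_lines[OF n2 w2, of h b2]) (simp_all add: inner)
  finally show ?thesis by (simp add: t_def)
qed

lemma integral_hyperplane_transport:
  fixes n1 n2 w :: "real^'n" and g :: "real^'n \<Rightarrow> real"
  assumes n1: "norm n1 = 1" and w1: "n1 \<bullet> w \<noteq> 0" and n2: "norm n2 = 1" and w2: "n2 \<bullet> w \<noteq> 0"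
    and g: "integrable (hyperplane_lborel {y. n1 \<bullet> y = b1}) g"
  shows "\<bar>n1 \<bullet> w\<bar> * (LINT y|hyperplane_lborel {y. n1 \<bullet> y = b1}. g y) =
    \<bar>n2 \<bullet> w\<bar> * (LINT y|hyperplane_lborel {y. n2 \<bullet> y = b2}. g (y - ((n1 \<bullet> y - b1) / (n1 \<bullet> w)) *\<^sub>R w))"
    and "integrable (hyperplane_lborel {y. n2 \<bullet> y = b2}) (\<lambda>y. g (y - ((n1 \<bullet> y - b1) / (n1 \<bullet> w)) *\<^sub>R w))"
proof -
  let ?S1 = "hyperplane_lborel {y. n1 \<bullet> y = b1}" and ?S2 = "hyperplane_lborel {y. n2 \<bullet> y = b2}"
  let ?p = "\<lambda>y. y - ((n1 \<bullet> y - b1) / (n1 \<bullet> w)) *\<^sub>R w"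
  have gm [measurable]: "g \<in> borel_measurable borel" using g by (auto dest: borel_measurable_integrable)
  have p [measurable]: "?p \<in> measurable ?S2 borel" "?p \<in> measurable borel borel" by measurable
  have emeasure_distr_eq_nn: "emeasure (distr ?S2 borel ?p) A = (\<integral>\<^sup>+y. indicator A (?p y) \<partial>?S2)"
    if [measurable]: "A \<in> sets borel" for A
    using nn_integral_distr[OF p(1), of "indicator A"] by simp
  have eq: "density ?S1 (\<lambda>_. ennreal \<bar>n1 \<bullet> w\<bar>) = density (distr ?S2 borel ?p) (\<lambda>_. ennreal \<bar>n2 \<bullet> w\<bar>)"
  proof (rule measure_eqI)
    fix A assume "A \<in> sets (density ?S1 (\<lambda>_. ennreal \<bar>n1 \<bullet> w\<bar>))"
    then have [measurable]: "A \<in> sets borel" by simp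
    show "emeasure (density ?S1 (\<lambda>_. ennreal \<bar>n1 \<bullet> w\<bar>)) A =
       emeasure (density (distr ?S2 borel ?p) (\<lambda>_. ennreal \<bar>n2 \<bullet> w\<bar>)) A"
      using nn_integral_hyperplane_transport[OF n1 w1 n2 w2, of "indicator A" b1 b2]
      by (simp add: emeasure_density nn_integral_cmult emeasure_distr_eq_nn)
  qed simp
  have 1: "integrable (density ?S1 (\<lambda>_. ennreal \<bar>n1 \<bullet> w\<bar>)) g"
    using g by (simp add: integrable_density)
  then show "integrable ?S2 (\<lambda>y. g (?p y))"
    unfolding eq using w2 by (simp add: integrable_density integrable_distr_eq)
  have "\<bar>n1 \<bullet> w\<bar> * (LINT y|?S1. g y) = (LINT y|density ?S1 (\<lambda>_. ennreal \<bar>n1 \<bullet> w\<bar>). g y)"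
    by (simp add: integral_density)
  also have "\<dots> = \<bar>n2 \<bullet> w\<bar> * (LINT y|?S2. g (?p y))"
    unfolding eq by (simp add: integral_density integral_distr)
  finally show "\<bar>n1 \<bullet> w\<bar> * (LINT y|?S1. g y) = \<bar>n2 \<bullet> w\<bar> * (LINT y|?S2. g (?p y))" .
qed

lemma hyperplane_eqI:
  fixes n n' :: "real^'n"
  assumes "norm n = 1" "norm n' = 1" "n' = (n' \<bullet> n) *\<^sub>R n" "n \<bullet> x = b" "n' \<bullet> x = b'"
  shows "{y. n \<bullet> y = b} = {y. n' \<bullet> y = b'}"
proof -
  define c where "c = n' \<bullet> n"
  have n': "n' = c *\<^sub>R n" using assms(3) by (simp add: c_def)
  have "c \<noteq> 0" using assms(1,2) n' by auto
  then show ?thesis using assms(4,5) by (auto simp: n')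
qed

text \<open>The points of the slab that are projected into the other hyperplane lie in a hyperplane whose normal
\<open>m\<close> is the tangential part of \<open>n'\<close>.  If \<open>m = 0\<close>, the two hyperplanes are parallel and disjoint.\<close>

lemma null_hyperplane_meet_eq:
  fixes n n' :: "real^'n"
  assumes n: "norm n = 1" and n': "norm n' = 1" and ne: "{y. n \<bullet> y = b} \<noteq> {y. n' \<bullet> y = b'}"
  shows "{y. n' \<bullet> y = b'} \<in> null_sets (hyperplane_lborel {y. n \<bullet> y = b})"
proof -
  have nn: "n \<bullet> n = 1" using n by (rule inner_unit)
  have [measurable]: "{y. n' \<bullet> y = b'} \<in> sets borel" by measurable
  define m where "m = n' - (n' \<bullet> n) *\<^sub>R n"
  let ?c = "b' - b * (n' \<bullet> n)"
  have "emeasure (hyperplane_lborel {y. n \<bullet> y = b}) {y. n' \<bullet> y = b'} =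
      (\<integral>\<^sup>+y. indicator {y. n' \<bullet> y = b'} y \<partial>hyperplane_lborel {y. n \<bullet> y = b})" by simp
  also have "\<dots> = (\<integral>\<^sup>+x. indicator {y. n' \<bullet> y = b'} (x - (n \<bullet> x - b) *\<^sub>R n) *
      indicator {x. \<bar>n \<bullet> x - b\<bar> \<le> 1/2} x \<partial>lborel)"
    by (rule nn_integral_hyperplane_lborel[OF n]) measurable
  also have "\<dots> \<le> (\<integral>\<^sup>+x. indicator {x. m \<bullet> x = ?c} x \<partial>lborel)"
    by (intro nn_integral_mono)
      (auto simp: m_def inner_diff_left inner_diff_right algebra_simps split: split_indicator)
  also have "\<dots> = 0"
  proof (cases "m = 0")
    case False
    then have "negligible {x. m \<bullet> x = ?c}" by (simp add: negligible_hyperplane)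
    then have "{x. m \<bullet> x = ?c} \<in> null_sets lebesgue" by (simp add: negligible_iff_null_sets)
    then have "emeasure lborel {x. m \<bullet> x = ?c} = 0" by (auto simp: null_sets_def)
    then show ?thesis by simp
  next
    case True
    have "?c \<noteq> 0"
    proof
      assume c0: "?c = 0"
      have n'n: "n' = (n' \<bullet> n) *\<^sub>R n" using True by (simp add: m_def)
      have "n' \<bullet> (b *\<^sub>R n) = b'" using c0 by simp
      moreover have "n \<bullet> (b *\<^sub>R n) = b" by (simp add: nn)
      ultimately show False using hyperplane_eqI[OF n n' n'n] ne by blast
    qed
    then show ?thesis using True by simp
  qed
  finally show ?thesis by (simp add: null_sets_def)
qed

section \<open>Surface measure\<close>

text \<open>The index set of the sum that defines \<open>surface_measure\<close>.\<close>

definition hyperplanes :: "(real^'n) set set" where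
  "hyperplanes = {H. affine H \<and> aff_dim H = int CARD('n) - 1}"

lemma hyperplanesE:
  fixes H :: "(real^'n) set"
  assumes "H \<in> hyperplanes"
  obtains n b where "norm n = 1" "H = {y. n \<bullet> y = b}"
proof -
  have "aff_dim H = int DIM(real^'n) - 1" using assms by (simp add: hyperplanes_def)
  then obtain a c where a: "a \<noteq> 0" and "affine hull H = {x. a \<bullet> x = c}"
    using aff_dim_eq_hyperplane[of H] by auto
  moreover have "affine hull H = H" using assms by (simp add: hyperplanes_def)
  ultimately have H: "H = {x. a \<bullet> x = c}" by simp
  show thesis
    by (rule that[of "a /\<^sub>R norm a" "c / norm a"]) (use a in \<open>auto simp: H field_simps\<close>)
qed

lemma hyperplane_in_hyperplanes:
  fixes n :: "real^'n"
  assumes "n \<noteq> 0"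
  shows "{y. n \<bullet> y = b} \<in> hyperplanes"
  using assms by (simp add: hyperplanes_def affine_hyperplane aff_dim_hyperplane)

lemma hyperplane_borel: "H \<in> hyperplanes \<Longrightarrow> H \<in> sets borel"
  by (auto elim!: hyperplanesE intro: borel_closed closed_hyperplane)

lemma sets_surface_measure [simp, measurable_cong]: "sets (surface_measure :: (real^'n) measure) = sets borel"
  and space_surface_measure [simp]: "space (surface_measure :: (real^'n) measure) = UNIV"
proof -
  show "sets (surface_measure :: (real^'n) measure) = sets borel"
    unfolding surface_measure_def using sets.sigma_sets_eq[of borel] by (subst sets_measure_of) auto
  show "space (surface_measure :: (real^'n) measure) = UNIV"
    unfolding surface_measure_def by (subst space_measure_of) auto
qed

lemma emeasure_surface_measure:
  fixes A :: "(real^'n) set"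
  assumes A: "A \<in> sets borel"
  shows "emeasure surface_measure A = (\<integral>\<^sup>+H. emeasure (hyperplane_lborel H) A \<partial>count_space hyperplanes)"
  unfolding hyperplanes_def
proof (rule emeasure_measure_of[OF surface_measure_def])
  show "A \<in> sets (surface_measure :: (real^'n) measure)" using A by simp
  show "countably_additive (sets (surface_measure :: (real^'n) measure))
    (\<lambda>A. \<integral>\<^sup>+H. emeasure (hyperplane_lborel H) A \<partial>count_space {H :: (real^'n) set. affine H \<and> aff_dim H = int CARD('n) - 1})"
  proof (rule countably_additiveI)
    fix B :: "nat \<Rightarrow> (real^'n) set"
    assume B: "range B \<subseteq> sets surface_measure" "disjoint_family B"
    have "(\<Sum>i. emeasure (hyperplane_lborel H) (B i)) = emeasure (hyperplane_lborel H) (\<Union>i. B i)" for H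
      by (rule suminf_emeasure) (use B in auto)
    then show "(\<Sum>i. \<integral>\<^sup>+H. emeasure (hyperplane_lborel H) (B i) \<partial>count_space {H :: (real^'n) set. affine H \<and> aff_dim H = int CARD('n) - 1}) =
      (\<integral>\<^sup>+H. emeasure (hyperplane_lborel H) (\<Union> (range B)) \<partial>count_space {H :: (real^'n) set. affine H \<and> aff_dim H = int CARD('n) - 1})"
      by (subst nn_integral_suminf[symmetric]) auto
  qed
qed (auto simp: positive_def)

lemma emeasure_hyperplane_Int:
  fixes A :: "(real^'n) set"
  assumes H: "H \<in> hyperplanes" and A: "A \<in> sets borel"
  shows "emeasure (hyperplane_lborel H) (A \<inter> H) = emeasure (hyperplane_lborel H) A"
proof (rule emeasure_eq_AE)
  obtain n b where n: "norm n = 1" and Heq: "H = {y. n \<bullet> y = b}" using hyperplanesE[OF H] .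
  have "AE y in hyperplane_lborel H. y \<in> H" unfolding Heq using AE_hyperplane_lborel[OF n, of b] by simp
  then show "AE x in hyperplane_lborel H. (x \<in> A \<inter> H) = (x \<in> A)" by eventually_elim auto
qed (use A hyperplane_borel[OF H] in auto)

lemma hyperplane_meet_null:
  fixes H H' :: "(real^'n) set"
  assumes "H \<in> hyperplanes" "H' \<in> hyperplanes" "H \<noteq> H'"
  shows "emeasure (hyperplane_lborel H) H' = 0"
proof -
  obtain n b where n: "norm n = 1" "H = {y. n \<bullet> y = b}" using hyperplanesE[OF assms(1)] .
  obtain n' b' where n': "norm n' = 1" "H' = {y. n' \<bullet> y = b'}" using hyperplanesE[OF assms(2)] .
  show ?thesis using null_hyperplane_meet_eq[OF n(1) n'(1)] n n' assms(3) by (auto simp: null_sets_def)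
qed

text \<open>Only the summand of \<open>H\<close> survives, since \<open>H\<close> is a null set for every other hyperplane.\<close>

lemma emeasure_surface_hyperplane:
  fixes A :: "(real^'n) set"
  assumes H: "H \<in> hyperplanes" and A: "A \<in> sets borel"
  shows "emeasure surface_measure (A \<inter> H) = emeasure (hyperplane_lborel H) A"
proof -
  have AH: "A \<inter> H \<in> sets borel" using A hyperplane_borel[OF H] by simp
  have "emeasure surface_measure (A \<inter> H) =
      (\<integral>\<^sup>+H'. emeasure (hyperplane_lborel H') (A \<inter> H) \<partial>count_space hyperplanes)"
    by (rule emeasure_surface_measure[OF AH])
  also have "\<dots> = (\<integral>\<^sup>+H'. emeasure (hyperplane_lborel H) (A \<inter> H) * indicator {H} H' \<partial>count_space hyperplanes)"
  proof (rule nn_integral_cong)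
    fix H' :: "(real^'n) set" assume "H' \<in> space (count_space hyperplanes)"
    then have H': "H' \<in> hyperplanes" by simp
    have "emeasure (hyperplane_lborel H') (A \<inter> H) = 0" if "H' \<noteq> H"
    proof -
      have "emeasure (hyperplane_lborel H') (A \<inter> H) \<le> emeasure (hyperplane_lborel H') H"
        using hyperplane_borel[OF H] by (intro emeasure_mono) auto
      then show ?thesis using hyperplane_meet_null[OF H' H that] by simp
    qed
    then show "emeasure (hyperplane_lborel H') (A \<inter> H) =
      emeasure (hyperplane_lborel H) (A \<inter> H) * indicator {H} H'"
      by (auto split: split_indicator)
  qed
  also have "\<dots> = emeasure (hyperplane_lborel H) (A \<inter> H)"
    using H by (subst nn_integral_cmult) (auto simp: one_ennreal_def[symmetric])
  finally show ?thesis by (simp add: emeasure_hyperplane_Int[OF H A])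
qed

lemma density_surface_hyperplane:
  fixes H :: "(real^'n) set"
  assumes H: "H \<in> hyperplanes"
  shows "density surface_measure (indicator H) = hyperplane_lborel H"
proof (rule measure_eqI)
  fix A assume "A \<in> sets (density surface_measure (indicator H :: _ \<Rightarrow> ennreal))"
  then have A: "A \<in> sets borel" by simp
  have [measurable]: "H \<in> sets borel" "A \<in> sets borel" using hyperplane_borel[OF H] A by auto
  show "emeasure (density surface_measure (indicator H)) A = emeasure (hyperplane_lborel H) A"
    using emeasure_surface_hyperplane[OF H A]
    by (simp add: emeasure_density indicator_inter_arith[symmetric] Int_commute)
qed simp

lemma surface_hyperplane_integral:
  fixes H :: "(real^'n) set" and \<phi> :: "real^'n \<Rightarrow> real"
  assumes H: "H \<in> hyperplanes" and A: "A \<in> sets borel" "A \<subseteq> H" and \<phi> [measurable]: "\<phi> \<in> borel_measurable borel"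
  shows "(LINT x:A|surface_measure. \<phi> x) = (LINT x|hyperplane_lborel H. indicator A x * \<phi> x)"
    and "set_integrable surface_measure A \<phi> \<longleftrightarrow> integrable (hyperplane_lborel H) (\<lambda>x. indicator A x * \<phi> x)"
proof -
  have [measurable]: "H \<in> sets borel" "A \<in> sets borel" using hyperplane_borel[OF H] A by auto
  have eq: "hyperplane_lborel H = density surface_measure (\<lambda>x. ennreal (indicator H x))"
    using density_surface_hyperplane[OF H] by (simp add: ennreal_indicator)
  have i: "indicator H x *\<^sub>R (indicator A x * \<phi> x) = indicator A x *\<^sub>R \<phi> x" for x
    using A(2) by (auto split: split_indicator)
  have i': "indicator H x * (indicator A x * \<phi> x) = indicator A x * \<phi> x" for x
    using A(2) by (auto split: split_indicator)
  show "(LINT x:A|surface_measure. \<phi> x) = (LINT x|hyperplane_lborel H. indicator A x * \<phi> x)"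
    unfolding eq by (subst integral_density) (auto simp: i' set_lebesgue_integral_def)
  show "set_integrable surface_measure A \<phi> \<longleftrightarrow> integrable (hyperplane_lborel H) (\<lambda>x. indicator A x * \<phi> x)"
    unfolding eq by (subst integrable_density) (auto simp: i' set_integrable_def)
qed

lemma null_surface_hyperplane_meet:
  fixes H H' :: "(real^'n) set"
  assumes "H \<in> hyperplanes" "H' \<in> hyperplanes" "H \<noteq> H'"
  shows "H \<inter> H' \<in> null_sets surface_measure"
  using emeasure_surface_hyperplane[OF assms(1) hyperplane_borel[OF assms(2)]]
    hyperplane_meet_null[OF assms] hyperplane_borel[OF assms(2)] hyperplane_borel[OF assms(1)]
  by (auto simp: null_sets_def Int_commute)

lemma AE_surface_generic:
  fixes \<H> :: "(real^'n) set set"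
  assumes fin: "finite \<H>" and H: "\<H> \<subseteq> hyperplanes"
  shows "AE x in surface_measure. \<forall>H\<in>\<H>. \<forall>H'\<in>\<H>. x \<in> H \<longrightarrow> x \<in> H' \<longrightarrow> H = H'"
proof -
  have "AE x in surface_measure. x \<in> H \<longrightarrow> x \<in> H' \<longrightarrow> H = H'" if "H \<in> \<H>" "H' \<in> \<H>" for H H'
  proof (cases "H = H'")
    case False
    then have "AE x in surface_measure. x \<notin> H \<inter> H'"
      using null_surface_hyperplane_meet[of H H'] that H by (intro AE_not_in) auto
    then show ?thesis by eventually_elim auto
  qed auto
  then show ?thesis by (intro AE_finite_allI fin)
qed

lemma emeasure_surface_bounded:
  fixes A :: "(real^'n) set"
  assumes fin: "finite \<H>" and H: "\<H> \<subseteq> hyperplanes" and A: "A \<in> sets borel" "bounded A" "A \<subseteq> \<Union>\<H>"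
  shows "emeasure surface_measure A < \<infinity>"
proof -
  have "emeasure surface_measure A = emeasure surface_measure (\<Union>H\<in>\<H>. A \<inter> H)"
    using A(3) by (intro arg_cong2[where f = emeasure]) auto
  also have "\<dots> \<le> (\<Sum>H\<in>\<H>. emeasure surface_measure (A \<inter> H))"
    using A hyperplane_borel H by (intro emeasure_subadditive_finite fin) auto
  also have "\<dots> < \<infinity>"
  proof -
    have "emeasure surface_measure (A \<inter> H) < \<infinity>" if HH: "H \<in> \<H>" for H
    proof -
      have Hh: "H \<in> hyperplanes" using that H by auto
      obtain n b where n: "norm n = 1" "H = {y. n \<bullet> y = b}" using hyperplanesE[OF Hh] .
      show ?thesis
        using emeasure_hyperplane_bounded[OF n(1) A(1,2), of b] n emeasure_surface_hyperplane[OF Hh A(1)]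
        by simp
    qed
    then show ?thesis by (simp add: fin)
  qed
  finally show ?thesis .
qed

text \<open>Projecting onto the hyperplane does not increase the distance to \<open>x\<close>, so the points of the slab that
are projected into the disc contain a ball.\<close>

lemma emeasure_surface_ball:
  fixes n x :: "real^'n"
  assumes n: "norm n = 1" and x: "n \<bullet> x = b" and r: "r > 0"
  shows "emeasure surface_measure (ball x r \<inter> {y. n \<bullet> y = b}) > 0"
proof -
  have n0: "n \<noteq> 0" using n by auto
  have nn: "n \<bullet> n = 1" using n by (rule inner_unit)
  let ?p = "\<lambda>z. z - (n \<bullet> z - b) *\<^sub>R n"
  have "0 < emeasure lborel (ball x (min r (1/2)))"
  proof -
    have "emeasure lborel (ball x (min r (1/2))) \<noteq> 0"
    proof
      assume "emeasure lborel (ball x (min r (1/2))) = 0"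
      then have "negligible (ball x (min r (1/2)))"
        by (simp add: negligible_iff_null_sets null_sets_def)
      then show False using r by (simp add: open_not_negligible)
    qed
    then show ?thesis by (simp add: zero_less_iff_neq_zero)
  qed
  also have "\<dots> = (\<integral>\<^sup>+z. indicator (ball x (min r (1/2))) z \<partial>lborel)" by simp
  also have "\<dots> \<le> (\<integral>\<^sup>+z. indicator (ball x r) (?p z) * indicator {z. \<bar>n \<bullet> z - b\<bar> \<le> 1/2} z \<partial>lborel)"
  proof (intro nn_integral_mono)
    fix z
    have "dist x (?p z) < r \<and> \<bar>n \<bullet> z - b\<bar> \<le> 1/2" if z: "dist x z < min r (1/2)"
    proof
      have "\<bar>n \<bullet> (z - x)\<bar> \<le> norm n * norm (z - x)" by (rule Cauchy_Schwarz_ineq2)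
      then show "\<bar>n \<bullet> z - b\<bar> \<le> 1/2" using z n x by (simp add: inner_diff_right dist_norm norm_minus_commute)
      have "(norm (?p z - x))\<^sup>2 + (n \<bullet> z - b)\<^sup>2 = (norm (z - x))\<^sup>2"
        using x by (simp add: power2_norm_eq_inner inner_diff_left inner_diff_right nn inner_commute)
          (simp add: algebra_simps power2_eq_square inner_commute)
      then have "(norm (?p z - x))\<^sup>2 \<le> (norm (z - x))\<^sup>2" by (smt (verit) zero_le_power2)
      then have "norm (?p z - x) \<le> norm (z - x)" by (rule power2_le_imp_le) simp
      then show "dist x (?p z) < r" using z by (simp add: dist_norm norm_minus_commute)
    qed
    then show "indicator (ball x (min r (1/2))) z \<le>
      (indicator (ball x r) (?p z) * indicator {z. \<bar>n \<bullet> z - b\<bar> \<le> 1/2} z :: ennreal)"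
      by (auto split: split_indicator)
  qed
  also have "\<dots> = (\<integral>\<^sup>+y. indicator (ball x r) y \<partial>hyperplane_lborel {y. n \<bullet> y = b})"
    by (rule nn_integral_hyperplane_lborel[OF n, symmetric])
      (intro borel_measurable_indicator borel_open open_ball)
  also have "\<dots> = emeasure surface_measure (ball x r \<inter> {y. n \<bullet> y = b})"
    using emeasure_surface_hyperplane[OF hyperplane_in_hyperplanes[OF n0], of "ball x r" b] by simp
  finally show ?thesis .
qed

text \<open>Discs have positive surface measure.  This turns vanishing almost everywhere on a face into
vanishing near a given point, so that tangential derivatives can be taken.\<close>

lemma surface_AE_zero_imp_zero:
  fixes n x y :: "real^'n" and \<phi> :: "real^'n \<Rightarrow> complex"
  assumes n: "norm n = 1" and sub: "ball x r \<inter> {y. n \<bullet> y = b} \<subseteq> e"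
    and AE: "AE y in surface_measure. y \<in> e \<longrightarrow> \<phi> y = 0" and c: "continuous_on UNIV \<phi>"
    and y: "dist x y < r" "n \<bullet> y = b"
  shows "\<phi> y = 0"
proof (rule ccontr)
  assume ne: "\<phi> y \<noteq> 0"
  have "open (\<phi> -` (- {0}))" using c by (intro open_vimage) auto
  then have "open (\<phi> -` (- {0}) \<inter> ball x r)" by auto
  then obtain d where d: "d > 0" "ball y d \<subseteq> \<phi> -` (- {0}) \<inter> ball x r"
    using ne y by (metis (no_types, lifting) IntI mem_ball openE vimage_eq Compl_iff singletonD)
  have "AE z in surface_measure. z \<notin> ball y d \<inter> {y. n \<bullet> y = b}"
    using AE by eventually_elim (use d sub in auto)
  moreover have "ball y d \<inter> {y. n \<bullet> y = b} \<in> sets borel"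
    by (intro sets.Int borel_open borel_closed closed_hyperplane) auto
  ultimately have "ball y d \<inter> {y. n \<bullet> y = b} \<in> null_sets surface_measure"
    by (subst AE_iff_null_sets) auto
  then have "emeasure surface_measure (ball y d \<inter> {y. n \<bullet> y = b}) = 0" by auto
  then show False using emeasure_surface_ball[OF n y(2) d(1)] by simp
qed

section \<open>Half balls and outward normals\<close>

text \<open>The opposite half ball is \<open>half_ball (- n) (- b) x r\<close>: changing sides is changing signs, and each
statement about one side covers the other.\<close>

definition half_ball :: "real^'n \<Rightarrow> real \<Rightarrow> real^'n \<Rightarrow> real \<Rightarrow> (real^'n) set" where
  "half_ball n b x r = {y \<in> ball x r. n \<bullet> y < b}"

lemma half_ball_eq_Int: "half_ball n b x r = ball x r \<inter> {y. n \<bullet> y < b}"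
  by (auto simp: half_ball_def)

lemma open_half_ball: "open (half_ball n b x r)"
  unfolding half_ball_eq_Int by (intro open_Int open_ball open_halfspace_lt)

lemma convex_half_ball: "convex (half_ball n b x r)"
  unfolding half_ball_eq_Int by (intro convex_Int convex_ball convex_halfspace_lt)

lemma half_ball_upper: "half_ball (- n) (- b) x r = {y \<in> ball x r. n \<bullet> y > b}"
  by (auto simp: half_ball_def)

lemma half_ball_nonempty:
  assumes n: "norm n = 1" and x: "n \<bullet> x = b" and r: "r > 0"
  shows "x - (r/2) *\<^sub>R n \<in> half_ball n b x r"
  using assms inner_unit[OF n] by (auto simp: half_ball_def dist_norm inner_diff_right)

lemma ball_in_closure_half_balls:
  fixes n :: "real^'n"
  assumes n: "norm n = 1" and y: "y \<in> ball x r" "n \<bullet> y \<le> b"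
  shows "y \<in> closure (half_ball n b x r)"
proof (rule closure_approachable[THEN iffD2], intro allI impI)
  fix e :: real assume e: "e > 0"
  define d where "d = min (e/2) ((r - dist x y)/2)"
  have d: "d > 0" "d < e" "d < r - dist x y" using e y by (auto simp: d_def min_def)
  have "dist x (y - d *\<^sub>R n) \<le> dist x y + dist y (y - d *\<^sub>R n)" by (rule dist_triangle)
  also have "dist y (y - d *\<^sub>R n) = d" using n d by (simp add: dist_norm)
  finally have "dist x (y - d *\<^sub>R n) < r" using d by simp
  moreover have "n \<bullet> (y - d *\<^sub>R n) < b" using y d inner_unit[OF n] by (simp add: inner_diff_right)
  ultimately have "y - d *\<^sub>R n \<in> half_ball n b x r" by (simp add: half_ball_def)
  moreover have "dist (y - d *\<^sub>R n) y < e" using n d by (simp add: dist_norm)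
  ultimately show "\<exists>z\<in>half_ball n b x r. dist z y < e" by blast
qed

text \<open>If \<open>K\<close> had a point \<open>y\<close> strictly beyond the hyperplane, the segment from \<open>y\<close> to a point of the lower half
ball very close to \<open>x\<close> would pass through the upper half ball.\<close>

lemma supporting_if_half_ball:
  fixes n :: "real^'n"
  assumes K: "convex K" and n: "norm n = 1" and x: "n \<bullet> x = b" and r: "r > 0"
    and low: "half_ball n b x r \<subseteq> K" and up: "half_ball (- n) (- b) x r \<inter> K = {}"
  shows "K \<subseteq> {y. n \<bullet> y \<le> b}"
proof (rule ccontr)
  assume "\<not> K \<subseteq> {y. n \<bullet> y \<le> b}"
  then obtain y where y: "y \<in> K" and "\<not> n \<bullet> y \<le> b" by blast
  then have "n \<bullet> y > b" by simp
  define \<delta> where "\<delta> = n \<bullet> y - b"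
  have \<delta>: "\<delta> > 0" using \<open>n \<bullet> y > b\<close> by (simp add: \<delta>_def)
  \<comment> \<open>\<open>t\<close> keeps the point \<open>w\<close> below inside the ball, and \<open>\<epsilon>\<close> keeps it above the hyperplane\<close>
  define t where "t = min (1/2) (r / (4 * (norm (y - x) + 1)))"
  have "4 * (norm (y - x) + 1) > 0" by (simp add: add_nonneg_pos)
  then have t: "0 < t" "t \<le> 1/2" using r unfolding t_def
    by (auto intro!: divide_pos_pos simp del: distrib_left_numeral)
  have "t * norm (y - x) \<le> r / (4 * (norm (y - x) + 1)) * (norm (y - x) + 1)"
    using r by (intro mult_mono) (auto simp: t_def)
  also have "\<dots> = r/4" by (simp add: field_simps add_nonneg_eq_0_iff)
  finally have tr: "t * norm (y - x) \<le> r/4" .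
  define \<epsilon> where "\<epsilon> = min (r/4) (t * \<delta> / 2)"
  have \<epsilon>: "\<epsilon> > 0" "\<epsilon> \<le> r/4" "\<epsilon> \<le> t * \<delta> / 2" using r t \<delta> by (auto simp: \<epsilon>_def)
  define z where "z = x - \<epsilon> *\<^sub>R n"
  have nn: "n \<bullet> n = 1" using n by (rule inner_unit)
  have "z \<in> half_ball n b x r"
    using \<epsilon> r n x nn by (simp add: z_def half_ball_def dist_norm inner_diff_right)
  then have zK: "z \<in> K" using low by auto
  define w where "w = (1 - t) *\<^sub>R z + t *\<^sub>R y"
  have wK: "w \<in> K" unfolding w_def using K zK y t by (intro convexD) auto
  have "w - x = t *\<^sub>R (y - x) - ((1 - t) * \<epsilon>) *\<^sub>R n"
    by (simp add: w_def z_def algebra_simps)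
  then have "norm (w - x) \<le> t * norm (y - x) + (1 - t) * \<epsilon>"
    using norm_triangle_ineq4[of "t *\<^sub>R (y - x)" "((1 - t) * \<epsilon>) *\<^sub>R n"] t \<epsilon> n by (simp add: abs_mult)
  also have "(1 - t) * \<epsilon> \<le> \<epsilon>" using t \<epsilon> by (simp add: mult_le_cancel_right2 field_simps)
  finally have "norm (w - x) < r" using tr \<epsilon> r by linarith
  moreover have "n \<bullet> w - b = t * \<delta> - (1 - t) * \<epsilon>"
    using x nn by (simp add: w_def z_def \<delta>_def inner_add_right inner_diff_right algebra_simps)
  moreover have "(1 - t) * \<epsilon> \<le> t * \<delta> / 2" using \<open>(1 - t) * \<epsilon> \<le> \<epsilon>\<close> \<epsilon> by linarith
  moreover have "t * \<delta> > 0" using t \<delta> by simp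
  ultimately have "w \<in> half_ball (- n) (- b) x r"
    by (simp add: half_ball_upper dist_norm norm_minus_commute)
  then show False using up wK by auto
qed

text \<open>Moving from \<open>x\<close> in direction \<open>\<nu>' - \<nu>\<close> enters \<open>Q\<close> according to \<open>\<nu>\<close> and leaves it according to \<open>\<nu>'\<close>.\<close>

lemma is_outward_normal_unique:
  fixes \<nu> \<nu>' :: "real^'n"
  assumes 1: "is_outward_normal Q x \<nu>" and 2: "is_outward_normal Q x \<nu>'"
  shows "\<nu> = \<nu>'"
proof (rule ccontr)
  assume ne: "\<nu> \<noteq> \<nu>'"
  have n: "norm \<nu> = 1" "norm \<nu>' = 1" using 1 2 by (auto simp: is_outward_normal_def)
  define d where "d = \<nu>' - \<nu>"
  have d0: "norm d > 0" using ne by (simp add: d_def)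
  have dd: "d \<bullet> d = 2 * (1 - \<nu> \<bullet> \<nu>')"
    using inner_unit[OF n(1)] inner_unit[OF n(2)]
    by (simp add: d_def inner_diff_left inner_diff_right inner_commute)
  have d1: "d \<bullet> \<nu> = - (1 - \<nu> \<bullet> \<nu>')" "d \<bullet> \<nu>' = 1 - \<nu> \<bullet> \<nu>'"
    using inner_unit[OF n(1)] inner_unit[OF n(2)] by (simp_all add: d_def inner_diff_left inner_diff_right inner_commute)
  define \<epsilon> where "\<epsilon> = (1 - \<nu> \<bullet> \<nu>') / norm d"
  have "d \<bullet> d > 0" using d0 by simp
  then have \<epsilon>: "\<epsilon> > 0" using dd d0 by (simp add: \<epsilon>_def)
  have \<epsilon>d: "\<epsilon> * norm d = 1 - \<nu> \<bullet> \<nu>'" using d0 by (simp add: \<epsilon>_def)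
  obtain r1 where r1: "r1 > 0" "\<And>y. 0 < dist y x \<Longrightarrow> dist y x < r1 \<Longrightarrow> (y - x) \<bullet> \<nu> \<le> - \<epsilon> * dist y x \<Longrightarrow> y \<in> Q"
    using 1 \<epsilon> unfolding is_outward_normal_def by blast
  obtain r2 where r2: "r2 > 0" "\<And>y. 0 < dist y x \<Longrightarrow> dist y x < r2 \<Longrightarrow> (y - x) \<bullet> \<nu>' \<ge> \<epsilon> * dist y x \<Longrightarrow> y \<notin> Q"
    using 2 \<epsilon> unfolding is_outward_normal_def by blast
  define t where "t = min r1 r2 / (2 * norm d)"
  have t: "t > 0" using r1 r2 d0 by (simp add: t_def)
  define y where "y = x + t *\<^sub>R d"
  have dist: "dist y x = t * norm d" using t by (simp add: y_def dist_norm)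
  then have "dist y x = min r1 r2 / 2" using d0 by (simp add: t_def)
  then have "0 < dist y x" "dist y x < r1" "dist y x < r2" using r1 r2 by auto
  moreover have "(y - x) \<bullet> \<nu> \<le> - \<epsilon> * dist y x"
  proof -
    have "- \<epsilon> * dist y x = - (t * (\<epsilon> * norm d))" by (simp add: dist)
    then show ?thesis unfolding \<epsilon>d by (simp add: y_def d1 algebra_simps)
  qed
  moreover have "(y - x) \<bullet> \<nu>' \<ge> \<epsilon> * dist y x"
  proof -
    have "\<epsilon> * dist y x = t * (\<epsilon> * norm d)" by (simp add: dist)
    then show ?thesis unfolding \<epsilon>d by (simp add: y_def d1)
  qed
  ultimately show False using r1(2) r2(2) by blast
qed

lemma outward_normal_eqI: "is_outward_normal Q x \<nu> \<Longrightarrow> outward_normal Q x = \<nu>"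
  unfolding outward_normal_def by (rule the_equality) (auto intro: is_outward_normal_unique)

lemma is_outward_normal_half_ball:
  assumes n: "norm n = 1" and x: "n \<bullet> x = b" and r: "r > 0"
    and low: "half_ball n b x r \<subseteq> Q" and up: "half_ball (- n) (- b) x r \<inter> Q = {}"
  shows "is_outward_normal Q x n"
  unfolding is_outward_normal_def
proof (intro conjI allI impI n, intro exI[of _ r] conjI allI impI r)
  fix \<epsilon> :: real and y assume \<epsilon>: "\<epsilon> > 0" and y: "0 < dist y x \<and> dist y x < r"
  then have p: "\<epsilon> * dist y x > 0" by simp
  { assume "(y - x) \<bullet> n \<le> - \<epsilon> * dist y x"
    then have "y \<in> half_ball n b x r"
      using p y x by (simp add: half_ball_def inner_diff_left inner_diff_right inner_commute dist_commute)
    then show "y \<in> Q" using low by auto }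
  { assume "(y - x) \<bullet> n \<ge> \<epsilon> * dist y x"
    then have "y \<in> half_ball (- n) (- b) x r"
      using p y x by (simp add: half_ball_upper inner_diff_left inner_diff_right inner_commute dist_commute)
    then show "y \<notin> Q" using up by auto }
qed

section \<open>Generic points of a hyperplane arrangement\<close>

text \<open>Within the ball, a set whose frontier is covered by \<open>\<H>\<close> can change only across \<open>H\<close>.\<close>

definition generic_at :: "(real^'n) set set \<Rightarrow> (real^'n) set \<Rightarrow> real^'n \<Rightarrow> real \<Rightarrow> bool" where
  "generic_at \<H> H x r \<longleftrightarrow> r > 0 \<and> x \<in> H \<and> (\<forall>H'\<in>\<H>. H' \<noteq> H \<longrightarrow> ball x r \<inter> H' = {})"

lemma generic_at_exists:
  assumes fin: "finite \<H>" and hyp: "\<H> \<subseteq> hyperplanes" and x: "x \<in> H"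
    and only: "\<And>H'. H' \<in> \<H> \<Longrightarrow> x \<in> H' \<Longrightarrow> H' = H"
  shows "\<exists>r. generic_at \<H> H x r"
proof -
  have "closed (\<Union>(\<H> - {H}))"
    using fin hyp by (intro closed_Union) (auto elim!: hyperplanesE simp: closed_hyperplane)
  moreover have "x \<notin> \<Union>(\<H> - {H})" using only by auto
  ultimately obtain r where "r > 0" "ball x r \<subseteq> - \<Union>(\<H> - {H})"
    by (metis Compl_iff open_Compl openE)
  then show ?thesis using x unfolding generic_at_def by (intro exI[of _ r]) auto
qed

text \<open>A half ball is connected and misses the frontier of \<open>Q\<close>.\<close>

lemma half_ball_dichotomy:
  assumes g: "generic_at \<H> {y. n \<bullet> y = b} x r" and Q: "frontier Q \<subseteq> \<Union>\<H>"
  shows "half_ball n b x r \<subseteq> interior Q \<or> half_ball n b x r \<inter> Q = {}"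
proof (rule disjCI)
  assume "half_ball n b x r \<inter> Q \<noteq> {}"
  moreover have "half_ball n b x r \<inter> frontier Q = {}"
    using g Q unfolding generic_at_def half_ball_def by fastforce
  ultimately have "half_ball n b x r \<subseteq> Q"
    using connected_Int_frontier[of "half_ball n b x r" Q] convex_connected[OF convex_half_ball] by blast
  then show "half_ball n b x r \<subseteq> interior Q"
    by (rule interior_maximal[OF _ open_half_ball])
qed

lemma generic_at_minus: "generic_at \<H> {y. n \<bullet> y = b} x r \<Longrightarrow> generic_at \<H> {y. (- n) \<bullet> y = - b} x r"
  by simp

lemma ball_subset_of_half_balls:
  assumes n: "norm (n::real^'n) = 1" and Q: "closed Q"
    and "half_ball n b x r \<subseteq> Q" "half_ball (- n) (- b) x r \<subseteq> Q"
  shows "ball x r \<subseteq> Q"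
proof
  fix y assume y: "y \<in> ball x r"
  show "y \<in> Q"
  proof (cases "n \<bullet> y \<le> b")
    case True
    then show ?thesis using ball_in_closure_half_balls[OF n y True] assms closure_minimal by blast
  next
    case False
    then have "y \<in> half_ball (- n) (- b) x r" using y by (simp add: half_ball_upper)
    then show ?thesis using assms by auto
  qed
qed

text \<open>A convex body is the closure of its interior, and a nonempty open set is not contained in the
separating hyperplane.\<close>

lemma half_ball_of_convex:
  assumes g: "generic_at \<H> {y. n \<bullet> y = b} x r" and n: "norm (n::real^'n) = 1"
    and K: "convex K" "closed K" "interior K \<noteq> {}" "frontier K \<subseteq> \<Union>\<H>" and y: "y \<in> K" "y \<in> ball x r"
  shows "half_ball n b x r \<subseteq> interior K \<or> half_ball (- n) (- b) x r \<subseteq> interior K"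
proof (rule ccontr)
  assume "\<not> ?thesis"
  then have none: "half_ball n b x r \<inter> K = {}" "half_ball (- n) (- b) x r \<inter> K = {}"
    using half_ball_dichotomy[OF g K(4)] half_ball_dichotomy[OF generic_at_minus[OF g] K(4)] by auto
  have "y \<in> closure (interior K)"
    using convex_closure_interior[OF K(1,3)] K(2) y(1) by simp
  then have "ball x r \<inter> interior K \<noteq> {}"
    using y(2) open_Int_closure_eq_empty[of "ball x r" "interior K"] by auto
  moreover have "ball x r \<inter> interior K \<subseteq> {y. n \<bullet> y = b}"
  proof
    fix z assume z: "z \<in> ball x r \<inter> interior K"
    then have "z \<in> K" using interior_subset by auto
    then have "z \<notin> half_ball n b x r" "z \<notin> half_ball (- n) (- b) x r" using none by auto
    then show "z \<in> {y. n \<bullet> y = b}" using z by (auto simp: half_ball_upper half_ball_def)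
  qed
  then have "ball x r \<inter> interior K \<subseteq> interior {y. n \<bullet> y = b}" by (intro interior_maximal) auto
  moreover have "interior {y. n \<bullet> y = b} = {}" using n by (intro interior_hyperplane) auto
  ultimately show False by auto
qed

text \<open>If both half balls belonged to \<open>K\<close>, then \<open>x\<close> would be an interior point; so exactly one of them does, and the
sign of \<open>n\<close> is chosen accordingly.\<close>

lemma convex_generic_frontier_point:
  assumes g: "generic_at \<H> H x r" and H: "H \<in> hyperplanes"
    and K: "convex K" "closed K" "interior K \<noteq> {}" "frontier K \<subseteq> \<Union>\<H>" and x: "x \<in> frontier K"
  obtains n b where "norm n = 1" "H = {y. n \<bullet> y = b}" "half_ball n b x r \<subseteq> interior K"
    "K \<subseteq> {y. n \<bullet> y \<le> b}"
proof -
  obtain n b where n: "norm n = 1" and Heq: "H = {y. n \<bullet> y = b}" using hyperplanesE[OF H] .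
  have r: "r > 0" and xb: "n \<bullet> x = b" using g Heq by (auto simp: generic_at_def)
  have g1: "generic_at \<H> {y. n \<bullet> y = b} x r" and g2: "generic_at \<H> {y. (- n) \<bullet> y = - b} x r"
    using g Heq by auto
  note d1 = half_ball_dichotomy[OF g1 K(4)] and d2 = half_ball_dichotomy[OF g2 K(4)]
  have not_both: "\<not> (half_ball n b x r \<subseteq> interior K \<and> half_ball (- n) (- b) x r \<subseteq> interior K)"
  proof
    assume "half_ball n b x r \<subseteq> interior K \<and> half_ball (- n) (- b) x r \<subseteq> interior K"
    then have "ball x r \<subseteq> K"
      using interior_subset by (intro ball_subset_of_half_balls[OF n K(2), where b = b]) auto
    then have "x \<in> interior K" using r by (meson centre_in_ball interiorI open_ball)
    then show False using x by (simp add: frontier_def)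
  qed
  have "x \<in> K" "x \<in> ball x r" using x K(2) r frontier_subset_closed by auto
  from half_ball_of_convex[OF g1 n K this]
  have not_none: "half_ball n b x r \<subseteq> interior K \<or> half_ball (- n) (- b) x r \<subseteq> interior K" .
  show thesis
  proof (cases "half_ball n b x r \<subseteq> interior K")
    case True
    then have "half_ball (- n) (- b) x r \<inter> K = {}" using not_both d2 by auto
    moreover have "half_ball n b x r \<subseteq> K" using True interior_subset by blast
    ultimately have "K \<subseteq> {y. n \<bullet> y \<le> b}" by (intro supporting_if_half_ball[OF K(1) n xb r])
    then show thesis using that[OF n Heq True] by blast
  next
    case False
    then have 1: "half_ball n b x r \<inter> K = {}" using d1 by auto
    have 2: "half_ball (- n) (- b) x r \<subseteq> interior K" using False not_none by auto
    have "half_ball (- n) (- b) x r \<subseteq> K" using 2 interior_subset by blast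
    then have "K \<subseteq> {y. (- n) \<bullet> y \<le> - b}"
      using 1 n xb by (intro supporting_if_half_ball[OF K(1) _ _ r]) auto
    then show thesis using that[of "- n" "- b"] n Heq 2 by auto
  qed
qed

section \<open>Measurability of the outward normal\<close>

text \<open>Near each point \<open>x\<close>, membership depends only on the direction seen from \<open>x\<close>, as for all sets built from
finitely many half spaces.  The property serves to prove that \<open>outward_normal\<close> is Borel measurable.
Since \<open>surface_measure\<close> is not complete, knowing the normal almost everywhere would not suffice for
that: it also has to be controlled at edges and corners.\<close>

definition locally_conic :: "(real^'n) set \<Rightarrow> bool" where
  "locally_conic A \<longleftrightarrow> (\<forall>x. \<exists>r>0. \<forall>y\<in>ball x r. \<forall>t. 0 < t \<and> t \<le> 1 \<longrightarrow> (x + t *\<^sub>R (y - x) \<in> A \<longleftrightarrow> y \<in> A))"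

lemma locally_conicI:
  assumes "\<And>x. \<exists>r>0. \<forall>y\<in>ball x r. \<forall>t. 0 < t \<and> t \<le> 1 \<longrightarrow> (x + t *\<^sub>R (y - x) \<in> A \<longleftrightarrow> y \<in> A)"
  shows "locally_conic A"
  using assms by (auto simp: locally_conic_def)

lemma conic_ball: "(y::real^'n) \<in> ball x r \<Longrightarrow> 0 < t \<Longrightarrow> t \<le> 1 \<Longrightarrow> x + t *\<^sub>R (y - x) \<in> ball x r"
proof -
  assume y: "y \<in> ball x r" and t: "0 < t" "t \<le> 1"
  have "dist x (x + t *\<^sub>R (y - x)) = t * dist x y"
    using t by (simp add: dist_norm norm_minus_commute)
  also have "\<dots> \<le> dist x y" using t by (intro mult_left_le_one_le) auto
  finally show ?thesis using y by simp
qed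

lemma locally_conic_halfspace: "locally_conic {y. a \<bullet> y \<le> b}"
proof (rule locally_conicI)
  fix x :: "real^'a"
  consider "a \<bullet> x < b" | "a \<bullet> x > b" | "a \<bullet> x = b" by linarith
  then show "\<exists>r>0. \<forall>y\<in>ball x r. \<forall>t. 0 < t \<and> t \<le> 1 \<longrightarrow>
      (x + t *\<^sub>R (y - x) \<in> {y. a \<bullet> y \<le> b} \<longleftrightarrow> y \<in> {y. a \<bullet> y \<le> b})"
  proof cases
    case 1
    then obtain r where r: "r > 0" "ball x r \<subseteq> {y. a \<bullet> y < b}"
      using openE[OF open_halfspace_lt, of x a b] by auto
    then show ?thesis using conic_ball[of _ x r] by (intro exI[of _ r]) fastforce
  next
    case 2
    then obtain r where r: "r > 0" "ball x r \<subseteq> {y. a \<bullet> y > b}"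
      using openE[OF open_halfspace_gt, of x b a] by auto
    then show ?thesis using conic_ball[of _ x r] by (intro exI[of _ r]) fastforce
  next
    case 3
    then show ?thesis
      by (intro exI[of _ 1]) (auto simp: inner_add_right inner_diff_right mult_le_0_iff algebra_simps)
  qed
qed

lemma locally_conic_Compl: "locally_conic A \<Longrightarrow> locally_conic (- A)"
  by (simp add: locally_conic_def)

lemma locally_conic_Int:
  assumes "locally_conic A" "locally_conic B"
  shows "locally_conic (A \<inter> B)"
proof (rule locally_conicI)
  fix x
  obtain r where r: "r > 0" "\<forall>y\<in>ball x r. \<forall>t. 0 < t \<and> t \<le> 1 \<longrightarrow> (x + t *\<^sub>R (y - x) \<in> A \<longleftrightarrow> y \<in> A)"
    using assms(1) unfolding locally_conic_def by blast
  obtain s where s: "s > 0" "\<forall>y\<in>ball x s. \<forall>t. 0 < t \<and> t \<le> 1 \<longrightarrow> (x + t *\<^sub>R (y - x) \<in> B \<longleftrightarrow> y \<in> B)"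
    using assms(2) unfolding locally_conic_def by blast
  show "\<exists>r>0. \<forall>y\<in>ball x r. \<forall>t. 0 < t \<and> t \<le> 1 \<longrightarrow> (x + t *\<^sub>R (y - x) \<in> A \<inter> B \<longleftrightarrow> y \<in> A \<inter> B)"
    using r s by (intro exI[of _ "min r s"]) auto
qed

lemma locally_conic_UNIV: "locally_conic UNIV"
  by (auto simp: locally_conic_def intro: exI[of _ 1])

lemma locally_conic_Inter: "finite F \<Longrightarrow> (\<And>A. A \<in> F \<Longrightarrow> locally_conic A) \<Longrightarrow> locally_conic (\<Inter>F)"
  by (induction F rule: finite_induct) (auto simp: locally_conic_UNIV locally_conic_Int)

lemma locally_conic_Union: 
  assumes "finite F" "\<And>A. A \<in> F \<Longrightarrow> locally_conic A" shows "locally_conic (\<Union>F)"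
proof -
  have "locally_conic (- \<Inter> (uminus ` F))"
    using assms by (intro locally_conic_Compl locally_conic_Inter) (auto intro: locally_conic_Compl)
  moreover have "- \<Inter> (uminus ` F) = \<Union>F" by auto
  ultimately show ?thesis by simp
qed

lemma locally_conic_interior:
  assumes "locally_conic (A :: (real^'n) set)"
  shows "locally_conic (interior A)"
proof (rule locally_conicI)
  fix x :: "real^'n"
  obtain r where r: "r > 0" "\<And>y t. y\<in>ball x r \<Longrightarrow> 0 < t \<Longrightarrow> t \<le> 1 \<Longrightarrow> (x + t *\<^sub>R (y - x) \<in> A \<longleftrightarrow> y \<in> A)"
    using assms unfolding locally_conic_def by blast
  have "x + t *\<^sub>R (y - x) \<in> interior A \<longleftrightarrow> y \<in> interior A" if y: "y \<in> ball x r" and t: "0 < t" "t \<le> 1" for y t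
  proof
    let ?f = "\<lambda>z. x + t *\<^sub>R (z - x)" and ?g = "\<lambda>z. x + (1/t) *\<^sub>R (z - x)"
    have fg: "?f (?g z) = z" "?g (?f z) = z" for z using t by (auto simp: algebra_simps)
    have cf: "continuous_on UNIV ?f" "continuous_on UNIV ?g" by (intro continuous_intros)+
    { assume "?f y \<in> interior A"
      then have "y \<in> ball x r \<inter> ?f -` interior A" using y by simp
      moreover have "open (ball x r \<inter> ?f -` interior A)"
        using cf(1) by (intro open_Int open_ball open_vimage) auto
      moreover have "ball x r \<inter> ?f -` interior A \<subseteq> A"
        using r t interior_subset by fastforce
      ultimately show "y \<in> interior A" by (meson interiorI) }
    { assume "y \<in> interior A"
      then have "?f y \<in> ?g -` (ball x r \<inter> interior A)" using y fg by simp
      moreover have "open (?g -` (ball x r \<inter> interior A))"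
        using cf(2) by (intro open_vimage) auto
      moreover have "?g -` (ball x r \<inter> interior A) \<subseteq> A"
      proof
        fix z assume "z \<in> ?g -` (ball x r \<inter> interior A)"
        then have "?g z \<in> ball x r" "?g z \<in> A" using interior_subset by auto
        then have "?f (?g z) \<in> A" using r(2) t by blast
        then show "z \<in> A" unfolding fg .
      qed
      ultimately show "?f y \<in> interior A" by (meson interiorI) }
  qed
  then show "\<exists>r>0. \<forall>y\<in>ball x r. \<forall>t. 0 < t \<and> t \<le> 1 \<longrightarrow>
      (x + t *\<^sub>R (y - x) \<in> interior A \<longleftrightarrow> y \<in> interior A)"
    using r(1) by blast
qed

lemma locally_conic_polytope:
  assumes "polytope (P :: (real^'n) set)" shows "locally_conic P"
proof -
  obtain F where F: "finite F" "P = \<Inter>F" "\<forall>h\<in>F. \<exists>a b. a \<noteq> 0 \<and> h = {x. a \<bullet> x \<le> b}"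
    using polytope_imp_polyhedron[OF assms] unfolding polyhedron_def by blast
  show ?thesis unfolding F(2) using F by (intro locally_conic_Inter) (auto intro: locally_conic_halfspace)
qed

text \<open>The definition of a normal describes \<open>Q\<close> only in cones that open up as \<open>x\<close> is approached.  Scaling
towards \<open>x\<close> extends this to half balls of a fixed radius.\<close>

lemma locally_conic_normal:
  fixes \<nu> :: "real^'n"
  assumes Q: "locally_conic Q" and \<nu>: "is_outward_normal Q x \<nu>"
  obtains r where "r > 0" "half_ball \<nu> (\<nu> \<bullet> x) x r \<subseteq> Q" "half_ball (- \<nu>) (- (\<nu> \<bullet> x)) x r \<inter> Q = {}"
proof -
  obtain r where r: "r > 0" "\<And>y t. y\<in>ball x r \<Longrightarrow> 0 < t \<Longrightarrow> t \<le> 1 \<Longrightarrow> (x + t *\<^sub>R (y - x) \<in> Q \<longleftrightarrow> y \<in> Q)"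
    using Q unfolding locally_conic_def by blast
  \<comment> \<open>shrinking \<open>y\<close> towards \<open>x\<close> keeps its angle to \<open>\<nu>\<close> and brings it into the range of the definition\<close>
  have key: "\<exists>t. 0 < t \<and> t \<le> 1 \<and> 0 < dist (x + t *\<^sub>R (y - x)) x \<and> dist (x + t *\<^sub>R (y - x)) x < s"
    if "s > 0" "y \<noteq> x" for s y
  proof (intro exI conjI)
    let ?t = "min 1 (s / (2 * dist y x))"
    have d: "dist y x > 0" using that by simp
    show t: "0 < ?t" "?t \<le> 1" using that by auto
    have "dist (x + ?t *\<^sub>R (y - x)) x = ?t * dist y x" using t by (simp add: dist_norm)
    moreover have "?t * dist y x \<le> s / (2 * dist y x) * dist y x" using d by (intro mult_right_mono) auto
    ultimately show "0 < dist (x + ?t *\<^sub>R (y - x)) x" "dist (x + ?t *\<^sub>R (y - x)) x < s"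
      using d that t(1) by (simp_all add: field_simps)
  qed
  show thesis
  proof (rule that[OF r(1)])
    show "half_ball \<nu> (\<nu> \<bullet> x) x r \<subseteq> Q"
    proof
      fix y assume y: "y \<in> half_ball \<nu> (\<nu> \<bullet> x) x r"
      then have ne: "y \<noteq> x" and neg: "(y - x) \<bullet> \<nu> < 0"
        by (auto simp: half_ball_def inner_diff_right inner_commute[of _ \<nu>])
      define \<epsilon> where "\<epsilon> = - ((y - x) \<bullet> \<nu>) / dist y x"
      have \<epsilon>: "\<epsilon> > 0" "\<epsilon> * dist y x = - ((y - x) \<bullet> \<nu>)" using ne neg by (auto simp: \<epsilon>_def divide_neg_pos)
      obtain s where s: "s > 0" "\<And>y. 0 < dist y x \<Longrightarrow> dist y x < s \<Longrightarrow> (y - x) \<bullet> \<nu> \<le> - \<epsilon> * dist y x \<Longrightarrow> y \<in> Q"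
        using \<nu> \<epsilon>(1) unfolding is_outward_normal_def by blast
      obtain t where t: "0 < t" "t \<le> 1" "0 < dist (x + t *\<^sub>R (y - x)) x" "dist (x + t *\<^sub>R (y - x)) x < s"
        using key[OF s(1) ne] by blast
      have "x + t *\<^sub>R (y - x) \<in> Q"
      proof (rule s(2)[OF t(3,4)])
        have "dist (x + t *\<^sub>R (y - x)) x = t * dist y x" using t by (simp add: dist_norm)
        then have "- \<epsilon> * dist (x + t *\<^sub>R (y - x)) x = - (t * (\<epsilon> * dist y x))" by simp
        then show "(x + t *\<^sub>R (y - x) - x) \<bullet> \<nu> \<le> - \<epsilon> * dist (x + t *\<^sub>R (y - x)) x"
          unfolding \<epsilon>(2) by simp
      qed
      then show "y \<in> Q" using r(2)[of y t] y t by (simp add: half_ball_def)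
    qed
    show "half_ball (- \<nu>) (- (\<nu> \<bullet> x)) x r \<inter> Q = {}"
    proof (rule ccontr)
      assume "half_ball (- \<nu>) (- (\<nu> \<bullet> x)) x r \<inter> Q \<noteq> {}"
      then obtain y where yQ: "y \<in> Q" and y: "y \<in> half_ball (- \<nu>) (- (\<nu> \<bullet> x)) x r" by auto
      then have ne: "y \<noteq> x" and pos: "(y - x) \<bullet> \<nu> > 0"
        by (auto simp: half_ball_upper inner_diff_right inner_commute[of _ \<nu>])
      define \<epsilon> where "\<epsilon> = ((y - x) \<bullet> \<nu>) / dist y x"
      have \<epsilon>: "\<epsilon> > 0" "\<epsilon> * dist y x = (y - x) \<bullet> \<nu>" using ne pos by (auto simp: \<epsilon>_def)
      obtain s where s: "s > 0" "\<And>y. 0 < dist y x \<Longrightarrow> dist y x < s \<Longrightarrow> (y - x) \<bullet> \<nu> \<ge> \<epsilon> * dist y x \<Longrightarrow> y \<notin> Q"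
        using \<nu> \<epsilon>(1) unfolding is_outward_normal_def by blast
      obtain t where t: "0 < t" "t \<le> 1" "0 < dist (x + t *\<^sub>R (y - x)) x" "dist (x + t *\<^sub>R (y - x)) x < s"
        using key[OF s(1) ne] by blast
      have "x + t *\<^sub>R (y - x) \<notin> Q"
      proof (rule s(2)[OF t(3,4)])
        have "dist (x + t *\<^sub>R (y - x)) x = t * dist y x" using t by (simp add: dist_norm)
        then have "\<epsilon> * dist (x + t *\<^sub>R (y - x)) x = t * (\<epsilon> * dist y x)" by simp
        then show "(x + t *\<^sub>R (y - x) - x) \<bullet> \<nu> \<ge> \<epsilon> * dist (x + t *\<^sub>R (y - x)) x"
          unfolding \<epsilon>(2) by simp
      qed
      then show False using r(2)[of y t] y t yQ by (simp add: half_ball_def)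
    qed
  qed
qed

text \<open>Steps along \<open>\<nu>\<close> and \<open>- \<nu>\<close> lead out of and into \<open>Q\<close>, but small steps stay in \<open>U\<close>.\<close>

lemma not_normal_in_open:
  assumes U: "open U" "y \<in> U" and \<nu>: "is_outward_normal Q y \<nu>" and "U \<subseteq> Q \<or> U \<inter> Q = {}"
  shows False
proof -
  have n: "norm \<nu> = 1" using \<nu> by (simp add: is_outward_normal_def)
  obtain r where r: "r > 0" "\<And>z. 0 < dist z y \<Longrightarrow> dist z y < r \<Longrightarrow>
      ((z - y) \<bullet> \<nu> \<le> - (1/2) * dist z y \<longrightarrow> z \<in> Q) \<and> ((z - y) \<bullet> \<nu> \<ge> (1/2) * dist z y \<longrightarrow> z \<notin> Q)"
    using \<nu> unfolding is_outward_normal_def by (metis half_gt_zero zero_less_one)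
  obtain d where d: "d > 0" "ball y d \<subseteq> U" using U by (meson openE)
  define s where "s = min r d / 2"
  have s: "s > 0" "s < r" "s < d" using r d by (auto simp: s_def)
  have "y + s *\<^sub>R \<nu> \<notin> Q" using r(2)[of "y + s *\<^sub>R \<nu>"] s n inner_unit[OF n] by (simp add: dist_norm)
  moreover have "y - s *\<^sub>R \<nu> \<in> Q" using r(2)[of "y - s *\<^sub>R \<nu>"] s n inner_unit[OF n] by (simp add: dist_norm)
  moreover have "y + s *\<^sub>R \<nu> \<in> U" "y - s *\<^sub>R \<nu> \<in> U" using d s n by (auto simp: dist_norm)
  ultimately show False using assms(4) by auto
qed

text \<open>There are no normals in the open half balls, and on the disc between them \<open>\<nu>\<close> is a normal at every
point.\<close>

lemma locally_conic_normal_local: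
  fixes \<nu> :: "real^'n"
  assumes Q: "locally_conic Q" and \<nu>: "is_outward_normal Q x \<nu>"
  obtains r where "r > 0"
    "\<And>y. y \<in> ball x r \<Longrightarrow> (\<exists>\<nu>'. is_outward_normal Q y \<nu>') \<longleftrightarrow> \<nu> \<bullet> y = \<nu> \<bullet> x"
    "\<And>y. y \<in> ball x r \<Longrightarrow> \<nu> \<bullet> y = \<nu> \<bullet> x \<Longrightarrow> outward_normal Q y = \<nu>"
proof -
  obtain r where r: "r > 0" "half_ball \<nu> (\<nu> \<bullet> x) x r \<subseteq> Q" "half_ball (- \<nu>) (- (\<nu> \<bullet> x)) x r \<inter> Q = {}"
    using locally_conic_normal[OF assms] .
  have n: "norm \<nu> = 1" using \<nu> by (simp add: is_outward_normal_def)
  have on: "is_outward_normal Q y \<nu>" if y: "y \<in> ball x r" "\<nu> \<bullet> y = \<nu> \<bullet> x" for y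
  proof (rule is_outward_normal_half_ball[OF n y(2)])
    have "ball y (r - dist x y) \<subseteq> ball x r"
      by (auto simp: subset_eq) (metis add.commute dist_triangle less_diff_eq order_le_less_trans)
    then show "half_ball \<nu> (\<nu> \<bullet> x) y (r - dist x y) \<subseteq> Q"
      "half_ball (- \<nu>) (- (\<nu> \<bullet> x)) y (r - dist x y) \<inter> Q = {}"
      using r(2,3) unfolding half_ball_eq_Int by blast+
    show "r - dist x y > 0" using y by simp
  qed
  show thesis
  proof (rule that[OF r(1)])
    fix y assume y: "y \<in> ball x r"
    show "(\<exists>\<nu>'. is_outward_normal Q y \<nu>') \<longleftrightarrow> \<nu> \<bullet> y = \<nu> \<bullet> x"
    proof
      assume "\<exists>\<nu>'. is_outward_normal Q y \<nu>'"
      then obtain \<nu>' where \<nu>': "is_outward_normal Q y \<nu>'" by blast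
      have "y \<notin> half_ball \<nu> (\<nu> \<bullet> x) x r" "y \<notin> half_ball (- \<nu>) (- (\<nu> \<bullet> x)) x r"
        using not_normal_in_open[OF open_half_ball _ \<nu>'] r(2,3) by blast+
      then show "\<nu> \<bullet> y = \<nu> \<bullet> x" using y by (auto simp: half_ball_def half_ball_upper)
    qed (use on[OF y] in blast)
    show "outward_normal Q y = \<nu>" if "\<nu> \<bullet> y = \<nu> \<bullet> x"
      using on[OF y that] by (rule outward_normal_eqI)
  qed
qed

text \<open>The set \<open>E\<close> of points that have a normal coincides near each of its points with a hyperplane, on which
the normal is constant.  Thus \<open>E\<close> is locally closed, and \<open>outward_normal Q\<close> is continuous on \<open>E\<close> and
constant off \<open>E\<close>.\<close>

lemma outward_normal_measurable:
  assumes Q: "locally_conic (Q :: (real^'n) set)"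
  shows "outward_normal Q \<in> borel_measurable borel"
proof -
  define E where "E = {x. \<exists>\<nu>. is_outward_normal Q x \<nu>}"
  have "\<exists>r. r > 0 \<and> (\<forall>y\<in>ball x r. y \<in> E \<longleftrightarrow> outward_normal Q x \<bullet> y = outward_normal Q x \<bullet> x) \<and>
      (\<forall>y\<in>ball x r \<inter> E. outward_normal Q y = outward_normal Q x)" if xE: "x \<in> E" for x
  proof -
    obtain \<nu> where \<nu>: "is_outward_normal Q x \<nu>" using xE by (auto simp: E_def)
    obtain r where r: "r > 0" "\<And>y. y \<in> ball x r \<Longrightarrow> (\<exists>\<nu>'. is_outward_normal Q y \<nu>') \<longleftrightarrow> \<nu> \<bullet> y = \<nu> \<bullet> x"
      "\<And>y. y \<in> ball x r \<Longrightarrow> \<nu> \<bullet> y = \<nu> \<bullet> x \<Longrightarrow> outward_normal Q y = \<nu>"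
      using locally_conic_normal_local[OF Q \<nu>] by metis
    have "outward_normal Q y = \<nu>" if "y \<in> ball x r \<inter> E" for y
      using that r(2)[of y] r(3)[of y] unfolding E_def by blast
    then show ?thesis unfolding outward_normal_eqI[OF \<nu>] using r(1,2)
      by (intro exI[of _ r]) (simp add: E_def)
  qed
  then have "\<forall>x\<in>E. \<exists>r. r > 0 \<and> (\<forall>y\<in>ball x r. y \<in> E \<longleftrightarrow> outward_normal Q x \<bullet> y = outward_normal Q x \<bullet> x) \<and>
      (\<forall>y\<in>ball x r \<inter> E. outward_normal Q y = outward_normal Q x)" by blast
  from bchoice[OF this] obtain r where r': "\<forall>x\<in>E. r x > 0 \<and>
      (\<forall>y\<in>ball x (r x). y \<in> E \<longleftrightarrow> outward_normal Q x \<bullet> y = outward_normal Q x \<bullet> x) \<and>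
      (\<forall>y\<in>ball x (r x) \<inter> E. outward_normal Q y = outward_normal Q x)" by blast
  have r: "\<And>x. x \<in> E \<Longrightarrow> r x > 0"
    "\<And>x y. x \<in> E \<Longrightarrow> y \<in> ball x (r x) \<Longrightarrow> y \<in> E \<longleftrightarrow> outward_normal Q x \<bullet> y = outward_normal Q x \<bullet> x"
    "\<And>x y. x \<in> E \<Longrightarrow> y \<in> ball x (r x) \<Longrightarrow> y \<in> E \<Longrightarrow> outward_normal Q y = outward_normal Q x"
    using r' by blast+
  \<comment> \<open>\<open>E\<close> is locally closed\<close>
  have "E = (\<Union>x\<in>E. ball x (r x)) \<inter> closure E"
  proof
    show "E \<subseteq> (\<Union>x\<in>E. ball x (r x)) \<inter> closure E"
    proof
      fix x assume x: "x \<in> E"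
      then have "x \<in> ball x (r x)" using r(1) by simp
      then show "x \<in> (\<Union>x\<in>E. ball x (r x)) \<inter> closure E" using x closure_subset[of E] by blast
    qed
    show "(\<Union>x\<in>E. ball x (r x)) \<inter> closure E \<subseteq> E"
    proof
      fix y assume "y \<in> (\<Union>x\<in>E. ball x (r x)) \<inter> closure E"
      then obtain x where x: "x \<in> E" "y \<in> ball x (r x)" and cl: "y \<in> closure E" by auto
      let ?H = "{y. outward_normal Q x \<bullet> y = outward_normal Q x \<bullet> x}"
      have "y \<in> closure (ball x (r x) \<inter> E)" using open_Int_closure_subset[of "ball x (r x)" E] x(2) cl by auto
      moreover have "closure (ball x (r x) \<inter> E) \<subseteq> ?H"
        using r(2)[OF x(1)] by (intro closure_minimal closed_hyperplane) blast
      ultimately show "y \<in> E" using r(2)[OF x] by blast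
    qed
  qed
  moreover have "open (\<Union>x\<in>E. ball x (r x))" by auto
  ultimately have E: "E \<in> sets borel" by (metis sets.Int borel_open borel_closed closed_closure)
  have "continuous_on E (outward_normal Q)"
  proof (rule continuous_on_eq_continuous_within[THEN iffD2], rule ballI)
    fix x assume x: "x \<in> E"
    have "continuous (at x within E) (\<lambda>_. outward_normal Q x)" by simp
    then show "continuous (at x within E) (outward_normal Q)"
    proof (rule continuous_transform_within[OF _ r(1)[OF x] x])
      fix y assume "y \<in> E" "dist y x < r x"
      then show "outward_normal Q x = outward_normal Q y"
        using r(3)[OF x, of y] by (simp add: dist_commute)
    qed
  qed
  then have "(\<lambda>x. if x \<in> E then outward_normal Q x else (THE \<nu>. False)) \<in> borel_measurable borel"
    using E by (intro borel_measurable_continuous_on_if) auto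
  moreover have "outward_normal Q x = (THE \<nu>. False)" if "x \<notin> E" for x
    using that by (simp add: outward_normal_def E_def)
  then have "(\<lambda>x. if x \<in> E then outward_normal Q x else (THE \<nu>. False)) = outward_normal Q" by auto
  ultimately show ?thesis by simp
qed

text \<open>Where no normal exists, \<open>outward_normal\<close> is the unspecified value of an improper description.\<close>

lemma outward_normal_bounded: "norm (outward_normal Q x :: real^'n) \<le> max 1 (norm (THE \<nu>::real^'n. False))"
proof (cases "\<exists>\<nu>. is_outward_normal Q x \<nu>")
  case True
  then obtain \<nu> where \<nu>: "is_outward_normal Q x \<nu>" by blast
  then have "norm \<nu> = 1" by (simp add: is_outward_normal_def)
  then show ?thesis by (simp add: outward_normal_eqI[OF \<nu>])
next
  case False
  then have "outward_normal Q x = (THE \<nu>. False)" by (simp add: outward_normal_def)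
  then show ?thesis by simp
qed

section \<open>The divergence theorem on polytopes\<close>

text \<open>Facets are exposed, and an exposing hyperplane of a facet has the dimension of its affine hull.\<close>

lemma facet_description:
  fixes K :: "(real^'n) set"
  assumes K: "polytope K" "interior K \<noteq> {}" and F: "F facet_of K"
  obtains n b where "norm n = 1" "F = K \<inter> {y. n \<bullet> y = b}" "K \<subseteq> {y. n \<bullet> y \<le> b}"
    "affine hull F = {y. n \<bullet> y = b}"
proof -
  have adK: "aff_dim K = int CARD('n)"
    using K(2) aff_dim_nonempty_interior[of K] by simp
  have Ff: "F face_of K" "F \<noteq> {}" "aff_dim F = int CARD('n) - 1"
    using F adK by (auto simp: facet_of_def)
  have "F exposed_face_of K"
    using exposed_face_of_polyhedron[OF polytope_imp_polyhedron[OF K(1)]] Ff by blast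
  then obtain a c where ac: "K \<subseteq> {x. a \<bullet> x \<le> c}" "F = K \<inter> {x. a \<bullet> x = c}"
    unfolding exposed_face_of_def by blast
  have "F \<noteq> K" using Ff adK by auto
  then have a: "a \<noteq> 0" using ac Ff(2) by auto
  define n b where "n = a /\<^sub>R norm a" and "b = c / norm a"
  have n: "norm n = 1" using a by (simp add: n_def)
  have eq: "{x. a \<bullet> x = c} = {y. n \<bullet> y = b}" "{x. a \<bullet> x \<le> c} = {y. n \<bullet> y \<le> b}"
    using a by (auto simp: n_def b_def field_simps)
  have "affine hull F = {y. n \<bullet> y = b}"
  proof (rule affine_dim_equal)
    show "affine hull F \<subseteq> {y. n \<bullet> y = b}"
      using ac eq by (intro hull_minimal affine_hyperplane) auto
    have "n \<noteq> 0" using n by auto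
    then show "aff_dim (affine hull F) = aff_dim {y. n \<bullet> y = b}" using Ff by (simp add: aff_dim_hyperplane)
  qed (use Ff in \<open>auto simp: affine_hyperplane\<close>)
  then show thesis using that[OF n] ac eq by auto
qed

lemma facet_hull_hyperplane:
  fixes K :: "(real^'n) set"
  assumes K: "polytope K" "interior K \<noteq> {}" and F: "F facet_of K"
  shows "affine hull F \<in> hyperplanes" "F = K \<inter> affine hull F"
proof -
  obtain n b where n: "norm n = 1" "F = K \<inter> {y. n \<bullet> y = b}" "affine hull F = {y. n \<bullet> y = b}"
    using facet_description[OF assms] by metis
  have "n \<noteq> 0" using n(1) by auto
  then show "affine hull F \<in> hyperplanes" "F = K \<inter> affine hull F"
    unfolding n(3) using n(2) by (auto intro: hyperplane_in_hyperplanes)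
qed

lemma frontier_polytope:
  fixes K :: "(real^'n) set"
  assumes K: "polytope K" "interior K \<noteq> {}"
  shows "frontier K = \<Union>{F. F facet_of K}"
proof -
  have "affine hull K = UNIV" using K(2) by (rule affine_hull_nonempty_interior)
  then show ?thesis
    using rel_frontier_frontier[of K] rel_frontier_of_polyhedron[OF polytope_imp_polyhedron[OF K(1)]] by simp
qed

definition facet_hulls :: "(real^'n) set \<Rightarrow> (real^'n) set set" where
  "facet_hulls K = (\<lambda>F. affine hull F) ` {F. F facet_of K}"

lemma finite_facet_hulls: "polytope K \<Longrightarrow> finite (facet_hulls K)"
  by (simp add: facet_hulls_def finite_polytope_facets)

lemma facet_hulls_hyperplanes: "polytope K \<Longrightarrow> interior K \<noteq> {} \<Longrightarrow> facet_hulls K \<subseteq> hyperplanes"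
  unfolding facet_hulls_def using facet_hull_hyperplane(1) by blast

lemma frontier_subset_facet_hulls:
  fixes K :: "(real^'n) set"
  shows "polytope K \<Longrightarrow> interior K \<noteq> {} \<Longrightarrow> frontier K \<subseteq> \<Union>(facet_hulls K)"
  unfolding frontier_polytope facet_hulls_def using hull_subset by fastforce

text \<open>Connects the facets of \<open>K\<close> with \<open>outward_normal\<close>, which is defined by blowing up.\<close>

lemma polytope_generic_normal:
  fixes K :: "(real^'n) set"
  assumes K: "polytope K" "interior K \<noteq> {}" and F: "F facet_of K" and x: "x \<in> F"
    and only: "\<And>F'. F' facet_of K \<Longrightarrow> x \<in> affine hull F' \<Longrightarrow> affine hull F' = affine hull F"
  obtains n b r where "norm n = 1" "affine hull F = {y. n \<bullet> y = b}" "half_ball n b x r \<subseteq> interior K"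
    "K \<subseteq> {y. n \<bullet> y \<le> b}" "r > 0" "outward_normal K x = n"
proof -
  have xH: "x \<in> affine hull F" using x by (simp add: hull_inc)
  obtain r where r: "generic_at (facet_hulls K) (affine hull F) x r"
    using generic_at_exists[OF finite_facet_hulls[OF K(1)] facet_hulls_hyperplanes[OF K] xH]
      only by (auto simp: facet_hulls_def)
  have xf: "x \<in> frontier K" using frontier_polytope[OF K] F x by auto
  obtain n b where n: "norm n = 1" "affine hull F = {y. n \<bullet> y = b}" "half_ball n b x r \<subseteq> interior K"
    "K \<subseteq> {y. n \<bullet> y \<le> b}"
    using convex_generic_frontier_point[OF r facet_hull_hyperplane(1)[OF K F] polytope_imp_convex[OF K(1)]
        polytope_imp_closed[OF K(1)] K(2) frontier_subset_facet_hulls[OF K] xf] .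
  have r0: "r > 0" using r by (simp add: generic_at_def)
  have "is_outward_normal K x n"
  proof (rule is_outward_normal_half_ball[OF n(1) _ r0])
    show "n \<bullet> x = b" using xH n(2) by auto
    show "half_ball n b x r \<subseteq> K" using n(3) interior_subset by blast
    show "half_ball (- n) (- b) x r \<inter> K = {}" using n(4) by (auto simp: half_ball_upper)
  qed
  then show thesis using that[OF n(1,2,3,4) r0] outward_normal_eqI by blast
qed

lemma bounded_set_integrable:
  fixes \<phi> :: "'a::topological_space \<Rightarrow> 'b::{banach, second_countable_topology}"
  assumes "sets M = sets borel" "A \<in> sets borel" "emeasure M A < \<infinity>" "\<phi> \<in> borel_measurable borel"
    and "\<And>x. x \<in> A \<Longrightarrow> norm (\<phi> x) \<le> B"
  shows "set_integrable M A \<phi>"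
proof -
  have [measurable_cong]: "sets M = sets borel" by fact
  have [measurable]: "\<phi> \<in> borel_measurable M" "A \<in> sets M"
    using assms measurable_cong_sets[of M borel] by auto
  show ?thesis unfolding set_integrable_def
    by (rule integrableI_bounded_set_indicator) (use assms in \<open>auto simp: AE_I2\<close>)
qed

text \<open>The fundamental theorem of calculus on the segment that a line in direction \<open>w\<close> cuts out of \<open>K\<close>.  The
assumptions on \<open>y\<close> say that the line lies in no facet hyperplane and meets no two of them at the same
point.  Then each end point of the segment lies in exactly one facet, \<open>n \<bullet> w\<close> is positive at the final
and negative at the initial point, and the remaining facets are not hit.  The segment is not a single
point, since near a point of a single facet \<open>K\<close> contains a half ball, which the line enters.\<close>

lemma divergence_on_line:
  fixes K :: "(real^'n) set" and w :: "real^'n" and f :: "real^'n \<Rightarrow> real"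
  assumes K: "polytope K" "interior K \<noteq> {}"
    and n: "\<And>F. F facet_of K \<Longrightarrow> norm (n F) = 1"
      "\<And>F. F facet_of K \<Longrightarrow> F = K \<inter> {y. n F \<bullet> y = b F}"
      "\<And>F. F facet_of K \<Longrightarrow> K \<subseteq> {y. n F \<bullet> y \<le> b F}"
      "\<And>F. F facet_of K \<Longrightarrow> affine hull F = {y. n F \<bullet> y = b F}"
    and w: "norm w = 1"
    and f: "\<And>x. (f has_derivative f' x) (at x)" and cont: "continuous_on UNIV (\<lambda>x. f' x w)"
    and gen0: "\<And>F. F facet_of K \<Longrightarrow> n F \<bullet> w = 0 \<Longrightarrow> n F \<bullet> y \<noteq> b F"
    and gen: "\<And>F G. F facet_of K \<Longrightarrow> G facet_of K \<Longrightarrow> F \<noteq> G \<Longrightarrow> n F \<bullet> w \<noteq> 0 \<Longrightarrow>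
        n G \<bullet> (y - ((n F \<bullet> y - b F) / (n F \<bullet> w)) *\<^sub>R w) \<noteq> b G"
  shows "(LINT s|lborel. indicator K (y + s *\<^sub>R w) * f' (y + s *\<^sub>R w) w) =
    (\<Sum>F | F facet_of K. sgn (n F \<bullet> w) *
      (\<lambda>z. indicator F z * f z) (y - ((n F \<bullet> y - b F) / (n F \<bullet> w)) *\<^sub>R w))"
proof -
  define t where "t F = - ((n F \<bullet> y - b F) / (n F \<bullet> w))" for F
  have tw: "y - ((n F \<bullet> y - b F) / (n F \<bullet> w)) *\<^sub>R w = y + t F *\<^sub>R w" for F by (simp add: t_def)
  have fin: "finite {F. F facet_of K}" by (rule finite_polytope_facets[OF K(1)])
  have hit: "n F \<bullet> (y + s *\<^sub>R w) = b F \<longleftrightarrow> n F \<bullet> w \<noteq> 0 \<and> s = t F" if "F facet_of K" for F s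
    using gen0[OF that] by (cases "n F \<bullet> w = 0") (auto simp: t_def inner_add_right field_simps)
  have hitF: "y + s *\<^sub>R w \<in> F \<longleftrightarrow> n F \<bullet> w \<noteq> 0 \<and> s = t F \<and> y + s *\<^sub>R w \<in> K" if "F facet_of K" for F s
    using n(2)[OF that] hit[OF that, of s] by auto
  have uniq: "F = G" if "F facet_of K" "G facet_of K" "y + s *\<^sub>R w \<in> F" "n G \<bullet> (y + s *\<^sub>R w) = b G" for F G s
    using gen[OF that(1,2)] that hitF[OF that(1), of s] unfolding tw by auto
  define I where "I = {s. y + s *\<^sub>R w \<in> K}"
  have Ivim: "I = (\<lambda>s. y + s *\<^sub>R w) -` K" by (auto simp: I_def)
  have cl: "closed I" unfolding Ivim
    by (intro closed_vimage polytope_imp_closed K continuous_intros)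
  have cv: "convex I" unfolding convex_def
  proof (intro ballI allI impI)
    fix s t u v :: real assume "s \<in> I" "t \<in> I" "0 \<le> u" "0 \<le> v" "u + v = 1"
    then have "u *\<^sub>R (y + s *\<^sub>R w) + v *\<^sub>R (y + t *\<^sub>R w) \<in> K"
      using polytope_imp_convex[OF K(1)] by (auto simp: I_def convex_def)
    moreover have "u *\<^sub>R (y + s *\<^sub>R w) + v *\<^sub>R (y + t *\<^sub>R w) = (u + v) *\<^sub>R y + (u * s + v * t) *\<^sub>R w"
      by (simp add: algebra_simps)
    ultimately show "u *\<^sub>R s + v *\<^sub>R t \<in> I" using \<open>u + v = 1\<close> by (simp add: I_def)
  qed
  have bd: "bounded I"
  proof -
    obtain B where B: "\<And>x. x \<in> K \<Longrightarrow> norm x \<le> B" using polytope_imp_bounded[OF K(1)] by (auto simp: bounded_iff)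
    have "\<bar>s\<bar> \<le> B + norm y" if "s \<in> I" for s
    proof -
      have "norm (s *\<^sub>R w) \<le> norm (y + s *\<^sub>R w) + norm y" by (metis add.commute norm_triangle_sub add_diff_cancel norm_minus_commute norm_triangle_ineq4)
      then show ?thesis using B[of "y + s *\<^sub>R w"] that w by (simp add: I_def)
    qed
    then show ?thesis by (intro boundedI[of _ "B + norm y"]) auto
  qed
  show ?thesis
  proof (cases "I = {}")
    case True
    then have "y + s *\<^sub>R w \<notin> K" for s by (auto simp: I_def)
    moreover have "F \<subseteq> K" if "F facet_of K" for F using that by (simp add: facet_of_imp_subset)
    ultimately have "y + s *\<^sub>R w \<notin> F" if "F facet_of K" for F s using that by blast
    then show ?thesis unfolding tw using \<open>\<And>s. y + s *\<^sub>R w \<notin> K\<close> by simp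
  next
    case False
    obtain s1 s2 where I12: "I = {s1..s2}"
      using connected_compact_interval_1[of I] cv cl bd compact_eq_bounded_closed convex_connected by metis
    have s12: "s1 \<le> s2" using False I12 by auto
    have I: "s1 \<in> I" "s2 \<in> I" using s12 I12 by auto
    have bdry: "y + s *\<^sub>R w \<in> frontier K" if s: "s = s1 \<or> s = s2" for s
    proof -
      have "y + s *\<^sub>R w \<notin> interior K"
      proof
        assume "y + s *\<^sub>R w \<in> interior K"
        then obtain e where e: "e > 0" "ball (y + s *\<^sub>R w) e \<subseteq> K" by (meson mem_interior)
        have "y + (s + e/2) *\<^sub>R w \<in> ball (y + s *\<^sub>R w) e" "y + (s - e/2) *\<^sub>R w \<in> ball (y + s *\<^sub>R w) e"
          using e w by (auto simp: dist_norm algebra_simps)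
        then have "s + e/2 \<in> I" "s - e/2 \<in> I" using e by (auto simp: I_def)
        then show False using s I12 e s12 by auto
      qed
      moreover have "y + s *\<^sub>R w \<in> K" using I s by (auto simp: I_def)
      ultimately show ?thesis using polytope_imp_closed[OF K(1)] by (simp add: frontier_def)
    qed
    have "\<exists>F. F facet_of K \<and> y + s *\<^sub>R w \<in> F" if "s = s1 \<or> s = s2" for s
      using bdry[OF that] frontier_polytope[OF K] by auto
    then obtain F1 F2 where F1: "F1 facet_of K" "y + s1 *\<^sub>R w \<in> F1" and F2: "F2 facet_of K" "y + s2 *\<^sub>R w \<in> F2"
      by metis
    have nF1: "n F1 \<bullet> w \<noteq> 0" "s1 = t F1" and nF2: "n F2 \<bullet> w \<noteq> 0" "s2 = t F2"
      using hitF F1 F2 by blast+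
    have lt: "s1 < s2"
    proof (rule ccontr)
      assume "\<not> s1 < s2"
      then have eq: "s2 = s1" using s12 by simp
      let ?z = "y + s1 *\<^sub>R w"
      have only: "affine hull F' = affine hull F1" if "F' facet_of K" "?z \<in> affine hull F'" for F'
        using uniq[OF F1(1) that(1) F1(2)] that n(4)[OF that(1)] by auto
      obtain n' b' r where n': "norm n' = 1" "affine hull F1 = {y. n' \<bullet> y = b'}" "half_ball n' b' ?z r \<subseteq> interior K"
        "r > 0" using polytope_generic_normal[OF K F1 only] by metis
      have hz: "n' \<bullet> ?z = b'" using n'(2) F1(2) by (metis hull_inc mem_Collect_eq)
      have "n' \<bullet> w \<noteq> 0"
      proof
        assume "n' \<bullet> w = 0"
        then have "?z + w \<in> affine hull F1" using n'(2) hz by (simp add: inner_add_right)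
        then have "n F1 \<bullet> (?z + w) = b F1" using n(4)[OF F1(1)] by auto
        moreover have "n F1 \<bullet> ?z = b F1" using n(2)[OF F1(1)] F1(2) by auto
        ultimately show False using nF1 by (simp add: inner_add_right)
      qed
      \<comment> \<open>a step along the line into the half ball inside \<open>K\<close>\<close>
      define d where "d = - sgn (n' \<bullet> w) * (r / 2)"
      have "n' \<bullet> (?z + d *\<^sub>R w) = b' - r/2 * \<bar>n' \<bullet> w\<bar>"
      proof -
        have "n' \<bullet> (?z + d *\<^sub>R w) = b' + d * (n' \<bullet> w)"
          using hz by (simp only: inner_add_right[of n' ?z] inner_scaleR_right)
        then show ?thesis by (simp add: d_def abs_sgn)
      qed
      then have "?z + d *\<^sub>R w \<in> half_ball n' b' ?z r"
        using \<open>n' \<bullet> w \<noteq> 0\<close> n'(4) w by (simp add: half_ball_def dist_norm d_def abs_mult abs_sgn_eq)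
      then have "?z + d *\<^sub>R w \<in> K" using n'(3) interior_subset by blast
      then have "s1 + d \<in> I" by (simp add: I_def algebra_simps)
      moreover have "d \<noteq> 0" using \<open>n' \<bullet> w \<noteq> 0\<close> n'(4) by (simp add: d_def sgn_zero_iff)
      ultimately show False using I12 eq by auto
    qed
    have le: "n F \<bullet> (y + s *\<^sub>R w) \<le> b F" if "F facet_of K" "s \<in> I" for F s
      using n(3)[OF that(1)] that(2) by (auto simp: I_def)
    have sign: "(n F \<bullet> w > 0 \<longrightarrow> s \<le> t F) \<and> (n F \<bullet> w < 0 \<longrightarrow> t F \<le> s)" if "F facet_of K" "s \<in> I" for F s
      using le[OF that] by (auto simp: t_def inner_add_right field_simps)
    have pos2: "n F2 \<bullet> w > 0"
      using sign[OF F2(1) I(1)] nF2 lt by (cases "n F2 \<bullet> w > 0") auto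
    have neg1: "n F1 \<bullet> w < 0"
      using sign[OF F1(1) I(2)] nF1 lt by (cases "n F1 \<bullet> w < 0") auto
    have other: "sgn (n F \<bullet> w) * (indicator F (y + t F *\<^sub>R w) * f (y + t F *\<^sub>R w)) = 0"
      if F: "F facet_of K" "F \<noteq> F1" "F \<noteq> F2" for F
    proof (rule ccontr)
      assume "sgn (n F \<bullet> w) * (indicator F (y + t F *\<^sub>R w) * f (y + t F *\<^sub>R w)) \<noteq> 0"
      then have nw: "n F \<bullet> w \<noteq> 0" and inF: "y + t F *\<^sub>R w \<in> F" by (auto simp: indicator_def sgn_zero_iff split: if_splits)
      then have "t F \<in> I" using hitF[OF F(1)] by (auto simp: I_def)
      then have "t F = s1 \<or> t F = s2"
        using sign[OF F(1) I(1)] sign[OF F(1) I(2)] nw I12 by (cases "n F \<bullet> w > 0") auto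
      then have "F = F1 \<or> F = F2"
        using uniq[OF F1(1) F(1) F1(2)] uniq[OF F2(1) F(1) F2(2)] inF n(2)[OF F(1)] by auto
      then show False using F by auto
    qed
    have "F1 \<noteq> F2" using pos2 neg1 by auto
    have "(\<Sum>F | F facet_of K. sgn (n F \<bullet> w) * (indicator F (y + t F *\<^sub>R w) * f (y + t F *\<^sub>R w))) =
        (\<Sum>F\<in>{F1, F2}. sgn (n F \<bullet> w) * (indicator F (y + t F *\<^sub>R w) * f (y + t F *\<^sub>R w)))"
      using other F1 F2 fin by (intro sum.mono_neutral_right) auto
    also have "\<dots> = f (y + s2 *\<^sub>R w) - f (y + s1 *\<^sub>R w)"
      using \<open>F1 \<noteq> F2\<close> pos2 neg1 nF1(2) nF2(2) F1(2) F2(2) by simp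
    finally have rhs: "(\<Sum>F | F facet_of K. sgn (n F \<bullet> w) * (indicator F (y + t F *\<^sub>R w) * f (y + t F *\<^sub>R w))) =
        f (y + s2 *\<^sub>R w) - f (y + s1 *\<^sub>R w)" .
    have "(LINT s|lborel. (f' (y + s *\<^sub>R w) w) * indicator {s1..s2} s) = f (y + s2 *\<^sub>R w) - f (y + s1 *\<^sub>R w)"
    proof (rule integral_FTC_Icc_real[OF s12])
      fix s
      have "((\<lambda>s. f (y + s *\<^sub>R w)) has_derivative (\<lambda>h. f' (y + s *\<^sub>R w) (h *\<^sub>R w))) (at s)"
        by (rule has_derivative_compose[OF _ f]) (auto intro!: derivative_eq_intros)
      moreover have "f' (y + s *\<^sub>R w) (h *\<^sub>R w) = f' (y + s *\<^sub>R w) w * h" for h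
        using has_derivative_bounded_linear[OF f, THEN bounded_linear.linear] by (simp add: linear_scale)
      ultimately show "DERIV (\<lambda>s. f (y + s *\<^sub>R w)) s :> f' (y + s *\<^sub>R w) w"
        by (simp add: has_field_derivative_def)
      have "continuous_on UNIV (\<lambda>s. f' (y + s *\<^sub>R w) w)"
        by (rule continuous_on_compose2[OF cont]) (auto intro!: continuous_intros)
      then show "isCont (\<lambda>s. f' (y + s *\<^sub>R w) w) s" by (simp add: continuous_on_eq_continuous_at)
    qed
    moreover have "indicator K (y + s *\<^sub>R w) = (indicator {s1..s2} s :: real)" for s
      using I12 by (auto simp: I_def indicator_def)
    ultimately show ?thesis unfolding tw using rhs by (simp add: mult.commute)
  qed
qed

lemma facet_normals:
  fixes K :: "(real^'n) set"
  assumes K: "polytope K" "interior K \<noteq> {}"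
  obtains n b where "\<And>F. F facet_of K \<Longrightarrow> norm (n F) = 1"
      "\<And>F. F facet_of K \<Longrightarrow> F = K \<inter> {y. n F \<bullet> y = b F}"
      "\<And>F. F facet_of K \<Longrightarrow> K \<subseteq> {y. n F \<bullet> y \<le> b F}"
      "\<And>F. F facet_of K \<Longrightarrow> affine hull F = {y. n F \<bullet> y = b F}"
proof -
  have "\<forall>F\<in>{F. F facet_of K}. \<exists>z. norm (fst z) = 1 \<and> F = K \<inter> {y. fst z \<bullet> y = snd z} \<and>
      K \<subseteq> {y. fst z \<bullet> y \<le> snd z} \<and> affine hull F = {y. fst z \<bullet> y = snd z}"
    using facet_description[OF K] by (metis fst_conv mem_Collect_eq snd_conv)
  from bchoice[OF this] obtain z where "\<forall>F\<in>{F. F facet_of K}. norm (fst (z F)) = 1 \<and>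
      F = K \<inter> {y. fst (z F) \<bullet> y = snd (z F)} \<and>
      K \<subseteq> {y. fst (z F) \<bullet> y \<le> snd (z F)} \<and> affine hull F = {y. fst (z F) \<bullet> y = snd (z F)}" by blast
  then show thesis using that[of "\<lambda>F. fst (z F)" "\<lambda>F. snd (z F)"] by blast
qed

lemma surface_measure_frontier_polytope:
  fixes K :: "(real^'n) set"
  assumes K: "polytope K" "interior K \<noteq> {}"
  shows "emeasure surface_measure (frontier K) < \<infinity>"
proof (rule emeasure_surface_bounded[OF finite_facet_hulls[OF K(1)] facet_hulls_hyperplanes[OF K]])
  show "frontier K \<in> sets borel" by (rule borel_closed[OF frontier_closed])
  show "bounded (frontier K)"
    using polytope_imp_bounded[OF K(1)] frontier_subset_closed[OF polytope_imp_closed[OF K(1)]] bounded_subset by blast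
qed (rule frontier_subset_facet_hulls[OF K])

text \<open>Integrate \<open>divergence_on_line\<close> over the hyperplane orthogonal to \<open>w\<close>.  Fubini along lines produces the
volume integral, and transport along \<open>w\<close> produces the facet integrals together with their factors
\<open>n \<bullet> w\<close>.\<close>

lemma divergence_polytope_unit:
  fixes K :: "(real^'n) set" and w :: "real^'n" and f :: "real^'n \<Rightarrow> real"
  assumes K: "polytope K" "interior K \<noteq> {}" and w: "norm w = 1"
    and f: "\<And>x. (f has_derivative f' x) (at x)" and cont: "continuous_on UNIV (\<lambda>x. f' x w)"
  shows "(LINT x:K|lborel. f' x w) = (LINT x:frontier K|surface_measure. (outward_normal K x \<bullet> w) * f x)"
proof -
  obtain n b where n: "\<And>F. F facet_of K \<Longrightarrow> norm (n F) = 1"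
      "\<And>F. F facet_of K \<Longrightarrow> F = K \<inter> {y. n F \<bullet> y = b F}"
      "\<And>F. F facet_of K \<Longrightarrow> K \<subseteq> {y. n F \<bullet> y \<le> b F}"
      "\<And>F. F facet_of K \<Longrightarrow> affine hull F = {y. n F \<bullet> y = b F}"
    using facet_normals[OF K] by metis
  have fin: "finite {F. F facet_of K}" by (rule finite_polytope_facets[OF K(1)])
  have cK: "compact K" by (rule polytope_imp_compact[OF K(1)])
  have fc: "continuous_on UNIV f" using f by (meson continuous_at_imp_continuous_on has_derivative_continuous)
  have fm [measurable]: "f \<in> borel_measurable borel" using fc by (rule borel_measurable_continuous_onI)
  have f'm [measurable]: "(\<lambda>x. f' x w) \<in> borel_measurable borel" using cont by (rule borel_measurable_continuous_onI)
  obtain B where B: "\<And>x. x \<in> K \<Longrightarrow> \<bar>f x\<bar> \<le> B"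
    using compact_imp_bounded[OF compact_continuous_image[OF continuous_on_subset[OF fc] cK]]
    by (auto simp: bounded_iff)
  have FK: "F \<subseteq> K" if "F facet_of K" for F using that by (rule facet_of_imp_subset)
  have Fb: "F \<in> sets borel" if "F facet_of K" for F
    using facet_of_imp_face_of[OF that] K(1) face_of_polytope_polytope polytope_imp_closed by (intro borel_closed) blast
  have hyp: "affine hull F \<in> hyperplanes" if "F facet_of K" for F by (rule facet_hull_hyperplane(1)[OF K that])
  have inj: "F = G" if "F facet_of K" "G facet_of K" "affine hull F = affine hull G" for F G
    using facet_hull_hyperplane(2)[OF K that(1)] facet_hull_hyperplane(2)[OF K that(2)] that(3) by simp
  let ?S = "\<lambda>F. hyperplane_lborel {y. n F \<bullet> y = b F}"
  let ?\<mu> = "hyperplane_lborel {y. w \<bullet> y = 0}"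
  let ?p = "\<lambda>F y. y - ((n F \<bullet> y - b F) / (n F \<bullet> w)) *\<^sub>R w"
  have ww: "w \<bullet> w = 1" using w by (rule inner_unit)
  have si: "set_integrable surface_measure F f" if F: "F facet_of K" for F
  proof (rule bounded_set_integrable[OF _ Fb[OF F] _ fm])
    have "emeasure surface_measure F \<le> emeasure surface_measure (frontier K)"
      using F frontier_polytope[OF K] borel_closed[OF frontier_closed, of K] by (intro emeasure_mono) auto
    then show "emeasure surface_measure F < \<infinity>" using surface_measure_frontier_polytope[OF K] by (rule order_le_less_trans)
    show "norm (f x) \<le> B" if "x \<in> F" for x using that B FK[OF F] by auto
  qed simp
  have iS: "integrable (?S F) (\<lambda>z. indicator F z * f z)" if F: "F facet_of K" for F
    using surface_hyperplane_integral(2)[OF hyp[OF F] Fb[OF F] hull_subset fm] si[OF F] n(4)[OF F] by simp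
  have "(LINT x:frontier K|surface_measure. (outward_normal K x \<bullet> w) * f x) =
      (LINT x|surface_measure. (\<Sum>F | F facet_of K. (n F \<bullet> w) * (indicator F x * f x)))"
    unfolding set_lebesgue_integral_def
  proof (rule integral_cong_AE)
    have [measurable]: "outward_normal K \<in> borel_measurable borel"
      by (rule outward_normal_measurable[OF locally_conic_polytope[OF K(1)]])
    have [measurable]: "frontier K \<in> sets borel" by (rule borel_closed[OF frontier_closed])
    show "(\<lambda>x. indicat_real (frontier K) x *\<^sub>R (outward_normal K x \<bullet> w * f x)) \<in> borel_measurable surface_measure"
      by measurable
    show "(\<lambda>x. \<Sum>F | F facet_of K. (n F \<bullet> w) * (indicator F x * f x)) \<in> borel_measurable surface_measure"
      using Fb by (intro borel_measurable_sum) auto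
    show "AE x in surface_measure. indicat_real (frontier K) x *\<^sub>R (outward_normal K x \<bullet> w * f x) =
        (\<Sum>F | F facet_of K. (n F \<bullet> w) * (indicator F x * f x))"
      using AE_surface_generic[OF finite_facet_hulls[OF K(1)] facet_hulls_hyperplanes[OF K]]
    proof eventually_elim
      case (elim x)
      show ?case
      proof (cases "x \<in> frontier K")
        case False
        then have "x \<notin> F" if "F facet_of K" for F using that frontier_polytope[OF K] by auto
        then show ?thesis using False by simp
      next
        case True
        then obtain F where F: "F facet_of K" "x \<in> F" using frontier_polytope[OF K] by auto
        have xF: "x \<in> affine hull F" using F(2) by (simp add: hull_inc)
        have only: "affine hull F' = affine hull F" if "F' facet_of K" "x \<in> affine hull F'" for F'
          using elim that F(1) xF by (auto simp: facet_hulls_def)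
        obtain n' b' r where n': "norm n' = 1" "affine hull F = {y. n' \<bullet> y = b'}" "half_ball n' b' x r \<subseteq> interior K"
          "K \<subseteq> {y. n' \<bullet> y \<le> b'}" "r > 0" "outward_normal K x = n'"
          using polytope_generic_normal[OF K F only] by metis
        have "outward_normal K x = n F"
        proof (rule outward_normal_eqI, rule is_outward_normal_half_ball[OF n(1)[OF F(1)] _ n'(5)])
          show nx: "n F \<bullet> x = b F" using xF n(4)[OF F(1)] by auto
          have hx: "n' \<bullet> x = b'" using xF n'(2) by auto
          have sub: "half_ball n' b' x r \<subseteq> K" using n'(3) interior_subset by blast
          have nn: "n F \<bullet> n F = 1" "n' \<bullet> n' = 1" using inner_unit n(1)[OF F(1)] n'(1) by auto
          \<comment> \<open>two unit normals of the same hyperplane are equal or opposite\<close>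
          have par: "n F = (n F \<bullet> n') *\<^sub>R n'"
          proof -
            define d where "d = n F - (n F \<bullet> n') *\<^sub>R n'"
            have "n' \<bullet> d = 0" by (simp add: d_def inner_diff_right nn inner_commute)
            then have "x + d \<in> affine hull F" using n'(2) hx by (simp add: inner_add_right)
            then have "n F \<bullet> (x + d) = b F" using n(4)[OF F(1)] by auto
            then have "n F \<bullet> d = 0" using nx by (simp add: inner_add_right)
            then have "d \<bullet> d = 0" using \<open>n' \<bullet> d = 0\<close> by (simp add: d_def inner_diff_left)
            then show ?thesis by (simp add: d_def)
          qed
          have "x - (r/2) *\<^sub>R n' \<in> K" using half_ball_nonempty[OF n'(1) hx n'(5)] sub by blast
          then have "n F \<bullet> (x - (r/2) *\<^sub>R n') \<le> b F" using n(3)[OF F(1)] by auto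
          then have ge: "n F \<bullet> n' \<ge> 0" using nx n'(5) by (simp add: inner_diff_right zero_le_mult_iff)
          have "(n F \<bullet> n') * (n F \<bullet> n') = 1" using nn(1) par by (metis inner_scaleR_right inner_commute)
          then have "n F \<bullet> n' = 1" using ge by (metis abs_of_nonneg abs_square_eq_1 power2_eq_square)
          then have eqn: "n F = n'" using par by simp
          then have eqb: "b F = b'" using nx hx by simp
          show "half_ball (n F) (b F) x r \<subseteq> K" using sub eqn eqb by simp
          show "half_ball (- n F) (- b F) x r \<inter> K = {}" using n(3)[OF F(1)] by (auto simp: half_ball_upper)
        qed
        moreover have "(\<Sum>F | F facet_of K. (n F \<bullet> w) * (indicator F x * f x)) =
            (\<Sum>F\<in>{F}. (n F \<bullet> w) * (indicator F x * f x))"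
        proof (rule sum.mono_neutral_right[OF fin])
          show "\<forall>G\<in>{F. F facet_of K} - {F}. (n G \<bullet> w) * (indicator G x * f x) = 0"
          proof
            fix G assume G: "G \<in> {F. F facet_of K} - {F}"
            have "x \<notin> G"
            proof
              assume "x \<in> G"
              then have "affine hull G = affine hull F" using only[of G] G by (simp add: hull_inc)
              then show False using inj G F(1) by blast
            qed
            then show "(n G \<bullet> w) * (indicator G x * f x) = 0" by simp
          qed
        qed (use F in auto)
        ultimately show ?thesis using True F(2) by simp
      qed
    qed
  qed
  also have "\<dots> = (\<Sum>F | F facet_of K. (n F \<bullet> w) * (LINT x|surface_measure. indicator F x * f x))"
    using si by (subst Bochner_Integration.integral_sum) (auto simp: set_integrable_def)
  also have "\<dots> = (\<Sum>F | F facet_of K. LINT y|?\<mu>. sgn (n F \<bullet> w) * (\<lambda>z. indicator F z * f z) (?p F y))"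
  proof (rule sum.cong[OF refl])
    fix F assume "F \<in> {F. F facet_of K}"
    then have F: "F facet_of K" by simp
    have "(LINT x|surface_measure. indicator F x * f x) = (LINT x|?S F. indicator F x * f x)"
      using surface_hyperplane_integral(1)[OF hyp[OF F] Fb[OF F] hull_subset fm] n(4)[OF F]
      by (simp add: set_lebesgue_integral_def)
    then show "(n F \<bullet> w) * (LINT x|surface_measure. indicator F x * f x) =
        (LINT y|?\<mu>. sgn (n F \<bullet> w) * (\<lambda>z. indicator F z * f z) (?p F y))"
    proof (cases "n F \<bullet> w = 0")
      case False
      have "(n F \<bullet> w) * (LINT x|?S F. indicator F x * f x) =
          sgn (n F \<bullet> w) * (\<bar>n F \<bullet> w\<bar> * (LINT x|?S F. indicator F x * f x))"
        by (simp add: linordered_idom_class.mult_sgn_abs)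
      also have "\<bar>n F \<bullet> w\<bar> * (LINT x|?S F. indicator F x * f x) =
          \<bar>w \<bullet> w\<bar> * (LINT y|?\<mu>. (\<lambda>z. indicator F z * f z) (?p F y))"
        by (rule integral_hyperplane_transport(1)[OF n(1)[OF F] False w _ iS[OF F]]) (simp add: ww)
      finally show ?thesis using \<open>(LINT x|surface_measure. indicator F x * f x) = _\<close> by (simp add: ww)
    qed simp
  qed
  also have "\<dots> = (LINT y|?\<mu>. (\<Sum>F | F facet_of K. sgn (n F \<bullet> w) * (\<lambda>z. indicator F z * f z) (?p F y)))"
  proof (rule Bochner_Integration.integral_sum[symmetric])
    fix F assume "F \<in> {F. F facet_of K}"
    then have F: "F facet_of K" by simp
    show "integrable ?\<mu> (\<lambda>y. sgn (n F \<bullet> w) * (\<lambda>z. indicator F z * f z) (?p F y))"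
    proof (cases "n F \<bullet> w = 0")
      case False
      have "integrable ?\<mu> (\<lambda>y. (\<lambda>z. indicator F z * f z) (?p F y))"
        by (rule integral_hyperplane_transport(2)[OF n(1)[OF F] False w _ iS[OF F]]) (simp add: ww)
      then show ?thesis by simp
    qed simp
  qed
  also have "\<dots> = (LINT y|?\<mu>. (LINT s|lborel. indicator K (y + s *\<^sub>R w) * f' (y + s *\<^sub>R w) w))"
  proof (rule integral_cong_AE)
    have [measurable]: "K \<in> sets borel" using cK by (simp add: borel_compact)
    have iL: "integrable lborel (\<lambda>x. indicator K x * f' x w)"
      using borel_integrable_compact[OF cK continuous_on_subset[OF cont]] by simp
    show "(\<lambda>y. LINT s|lborel. indicator K (y + s *\<^sub>R w) * f' (y + s *\<^sub>R w) w) \<in> borel_measurable ?\<mu>"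
      using integral_hyperplane_lines(2)[OF w _ iL, of w 0] ww by (auto dest: borel_measurable_integrable)
    show "(\<lambda>y. \<Sum>F | F facet_of K. sgn (n F \<bullet> w) * (\<lambda>z. indicator F z * f z) (?p F y)) \<in> borel_measurable ?\<mu>"
    proof (rule borel_measurable_sum)
      fix F assume "F \<in> {F. F facet_of K}"
      then have [measurable]: "F \<in> sets borel" using Fb by simp
      show "(\<lambda>y. sgn (n F \<bullet> w) * (\<lambda>z. indicator F z * f z) (?p F y)) \<in> borel_measurable ?\<mu>" by measurable
    qed
    \<comment> \<open>lines within a facet hyperplane that is parallel to \<open>w\<close>\<close>
    have g0: "AE y in ?\<mu>. n F \<bullet> w = 0 \<longrightarrow> n F \<bullet> y \<noteq> b F" if F: "F facet_of K" for F
    proof (cases "n F \<bullet> w = 0")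
      case True
      have "{y. w \<bullet> y = 0} \<noteq> {y. n F \<bullet> y = b F}"
      proof
        assume eq: "{y. w \<bullet> y = 0} = {y. n F \<bullet> y = b F}"
        have b0: "b F = 0" using eq[THEN eqset_imp_iff, of 0] by simp
        have "w \<in> {y. n F \<bullet> y = b F}" using True b0 by simp
        then have "w \<in> {y. w \<bullet> y = 0}" unfolding eq .
        then show False using ww by simp
      qed
      then have "AE y in ?\<mu>. y \<notin> {y. n F \<bullet> y = b F}"
        using null_hyperplane_meet_eq[OF w n(1)[OF F]] by (intro AE_not_in) auto
      then show ?thesis by eventually_elim auto
    qed simp
    \<comment> \<open>lines through the intersection of two facet hyperplanes: along \<open>w\<close> this set corresponds to a null set of one of them\<close>
    have g1: "AE y in ?\<mu>. F \<noteq> G \<longrightarrow> n F \<bullet> w \<noteq> 0 \<longrightarrow> n G \<bullet> ?p F y \<noteq> b G" if F: "F facet_of K" and G: "G facet_of K" for F G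
    proof (cases "F \<noteq> G \<and> n F \<bullet> w \<noteq> 0")
      case True
      have [measurable]: "{y. n G \<bullet> y = b G} \<in> sets borel" by measurable
      have "affine hull F \<noteq> affine hull G" using inj[OF F G] True by auto
      then have "emeasure (?S F) {y. n G \<bullet> y = b G} = 0"
        using null_hyperplane_meet_eq[OF n(1)[OF F] n(1)[OF G]] n(4)[OF F] n(4)[OF G] by auto
      then have "(\<integral>\<^sup>+y. indicator {y. n G \<bullet> y = b G} y \<partial>?S F) = 0" by simp
      moreover have "ennreal \<bar>n F \<bullet> w\<bar> * (\<integral>\<^sup>+y. indicator {y. n G \<bullet> y = b G} y \<partial>?S F) =
          ennreal \<bar>w \<bullet> w\<bar> * (\<integral>\<^sup>+y. indicator {y. n G \<bullet> y = b G} (?p F y) \<partial>?\<mu>)"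
        using True ww by (intro nn_integral_hyperplane_transport[OF n(1)[OF F] _ w]) auto
      ultimately have "(\<integral>\<^sup>+y. indicator {y. n G \<bullet> y = b G} (?p F y) \<partial>?\<mu>) = 0" by (simp add: ww)
      then have "AE y in ?\<mu>. indicator {y. n G \<bullet> y = b G} (?p F y) = (0::ennreal)"
        by (subst (asm) nn_integral_0_iff_AE) measurable
      then show ?thesis by eventually_elim (auto simp: indicator_def split: if_splits)
    qed auto
    have A0: "AE y in ?\<mu>. \<forall>F\<in>{F. F facet_of K}. n F \<bullet> w = 0 \<longrightarrow> n F \<bullet> y \<noteq> b F"
      using g0 by (intro AE_finite_allI fin) auto
    have A1: "AE y in ?\<mu>. \<forall>F\<in>{F. F facet_of K}. \<forall>G\<in>{F. F facet_of K}. F \<noteq> G \<longrightarrow> n F \<bullet> w \<noteq> 0 \<longrightarrow> n G \<bullet> ?p F y \<noteq> b G"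
      using g1 by (intro AE_finite_allI fin) auto
    show "AE y in ?\<mu>. (\<Sum>F | F facet_of K. sgn (n F \<bullet> w) * (\<lambda>z. indicator F z * f z) (?p F y)) =
        (LINT s|lborel. indicator K (y + s *\<^sub>R w) * f' (y + s *\<^sub>R w) w)"
      using A0 A1
    proof eventually_elim
      case (elim y)
      show ?case
        by (rule divergence_on_line[OF K n w f cont, symmetric]) (use elim in auto)
    qed
  qed
  also have "\<dots> = (LINT x:K|lborel. f' x w)"
  proof -
    have "integrable lborel (\<lambda>x. indicator K x * f' x w)"
      using borel_integrable_compact[OF cK continuous_on_subset[OF cont]] by simp
    from integral_hyperplane_lines(1)[OF w _ this, of w 0] show ?thesis
      by (simp add: ww set_lebesgue_integral_def)
  qed
  finally show ?thesis ..
qed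

theorem divergence_polytope:
  fixes K :: "(real^'n) set" and w :: "real^'n" and f :: "real^'n \<Rightarrow> real"
  assumes K: "polytope K" "interior K \<noteq> {}"
    and f: "\<And>x. (f has_derivative f' x) (at x)" and cont: "continuous_on UNIV (\<lambda>x. f' x w)"
  shows "(LINT x:K|lborel. f' x w) = (LINT x:frontier K|surface_measure. (outward_normal K x \<bullet> w) * f x)"
proof (cases "w = 0")
  case True
  have "f' x 0 = 0" for x using has_derivative_bounded_linear[OF f, of x] by (simp add: linear_simps)
  then show ?thesis using True by (simp add: set_lebesgue_integral_def)
next
  case False
  define v where "v = w /\<^sub>R norm w"
  have w: "w = norm w *\<^sub>R v" "norm v = 1" using False by (simp_all add: v_def)
  have lin: "f' x (c *\<^sub>R v) = c * f' x v" for x c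
    using has_derivative_bounded_linear[OF f, THEN bounded_linear.linear] by (simp add: linear_scale)
  have "f' x v = f' x w / norm w" for x using lin[of x "norm w"] w False by simp
  then have "continuous_on UNIV (\<lambda>x. f' x v)" using cont False by (auto intro!: continuous_intros)
  from divergence_polytope_unit[OF K w(2) f this]
  have "norm w * (LINT x:K|lborel. f' x v) =
      norm w * (LINT x:frontier K|surface_measure. (outward_normal K x \<bullet> v) * f x)" by simp
  moreover have "norm w * (LINT x:K|lborel. f' x v) = (LINT x:K|lborel. f' x w)"
    by (subst (2) w(1)) (simp add: lin del: w)
  moreover have "norm w * (LINT x:frontier K|surface_measure. (outward_normal K x \<bullet> v) * f x) =
      (LINT x:frontier K|surface_measure. (outward_normal K x \<bullet> w) * f x)"
    by (subst (2) w(1)) (simp add: mult.assoc)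
  ultimately show ?thesis by simp
qed

section \<open>Polynomials\<close>

abbreviation pdiff :: "'n::finite \<Rightarrow> (real^'n \<Rightarrow> complex) \<Rightarrow> real^'n \<Rightarrow> complex" where
  "pdiff i f \<equiv> dir_deriv (axis i 1) f"

definition multi_indices :: "nat \<Rightarrow> ('n::finite \<Rightarrow> nat) set" where
  "multi_indices p = {\<alpha>. sum \<alpha> UNIV \<le> p}"

definition monomial :: "('n::finite \<Rightarrow> nat) \<Rightarrow> real^'n \<Rightarrow> complex" where
  "monomial \<alpha> x = (\<Prod>i\<in>UNIV. complex_of_real (x $ i) ^ \<alpha> i)"

lemma poly_space_iff: "f \<in> poly_space p \<longleftrightarrow> (\<exists>c. f = (\<lambda>x. \<Sum>\<alpha>\<in>multi_indices p. c \<alpha> * monomial \<alpha> x))"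
  by (simp add: poly_space_def multi_indices_def monomial_def)

lemma finite_multi_indices: "finite (multi_indices p :: ('n::finite \<Rightarrow> nat) set)"
proof (rule finite_subset)
  show "multi_indices p \<subseteq> PiE (UNIV::'n set) (\<lambda>_. {..p})"
  proof
    fix \<alpha> :: "'n \<Rightarrow> nat" assume "\<alpha> \<in> multi_indices p"
    then have "\<alpha> i \<le> p" for i
      using member_le_sum[of i UNIV \<alpha>] by (simp add: multi_indices_def)
    then show "\<alpha> \<in> PiE UNIV (\<lambda>_. {..p})" by auto
  qed
  show "finite (PiE (UNIV::'n set) (\<lambda>_. {..p}))" by (intro finite_PiE) auto
qed

lemma poly_space_lincomb:
  assumes "f \<in> poly_space p" "g \<in> poly_space p"
  shows "(\<lambda>x. f x + c * g x) \<in> poly_space p"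
proof -
  obtain a b where f: "f = (\<lambda>x. \<Sum>\<alpha>\<in>multi_indices p. a \<alpha> * monomial \<alpha> x)"
    and g: "g = (\<lambda>x. \<Sum>\<alpha>\<in>multi_indices p. b \<alpha> * monomial \<alpha> x)"
    using assms by (auto simp: poly_space_iff)
  show ?thesis unfolding poly_space_iff f g
    by (rule exI[of _ "\<lambda>\<alpha>. a \<alpha> + c * b \<alpha>"])
      (simp add: sum_distrib_left sum.distrib[symmetric] algebra_simps)
qed

lemma poly_space_zero: "(\<lambda>x. 0) \<in> poly_space p"
  unfolding poly_space_iff by (rule exI[of _ "\<lambda>_. 0"]) simp

lemma poly_space_sum:
  "(\<And>a. a \<in> A \<Longrightarrow> g a \<in> poly_space p) \<Longrightarrow> (\<lambda>x. \<Sum>a\<in>A. c a * g a x) \<in> poly_space p"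
proof (induction A rule: infinite_finite_induct)
  case (insert a A)
  have "(\<lambda>x. (\<Sum>a\<in>A. c a * g a x) + c a * g a x) \<in> poly_space p"
    by (rule poly_space_lincomb) (use insert in auto)
  then show ?case using insert by (simp add: add.commute)
qed (simp_all add: poly_space_zero)

lemma monomial_in_poly_space:
  assumes "\<alpha> \<in> multi_indices p" shows "monomial \<alpha> \<in> poly_space p"
  unfolding poly_space_iff
proof (intro exI ext)
  fix x
  have "(\<Sum>\<beta>\<in>multi_indices p. (if \<beta> = \<alpha> then 1 else 0) * monomial \<beta> x) =
      (\<Sum>\<beta>\<in>multi_indices p. if \<beta> = \<alpha> then monomial \<beta> x else 0)"
    by (rule sum.cong) simp_all
  also have "\<dots> = monomial \<alpha> x" using assms by (simp only: sum.delta[OF finite_multi_indices] if_True)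
  finally show "monomial \<alpha> x = (\<Sum>\<beta>\<in>multi_indices p. (if \<beta> = \<alpha> then 1 else 0) * monomial \<beta> x)" ..
qed

lemma multi_indices_lower: "\<alpha> \<in> multi_indices p \<Longrightarrow> \<alpha>(i := \<alpha> i - 1) \<in> multi_indices p"
  unfolding multi_indices_def mem_Collect_eq
  by (erule order_trans[rotated], rule sum_mono) auto

text \<open>For \<open>\<alpha> i = 0\<close> the truncated exponent \<open>\<alpha> i - 1\<close> is harmless because the factor \<open>of_nat (\<alpha> i)\<close> vanishes.\<close>

lemma monomial_has_derivative:
  "(monomial \<alpha> has_derivative
     (\<lambda>h. \<Sum>i\<in>UNIV. complex_of_real (h $ i) * (of_nat (\<alpha> i) * monomial (\<alpha>(i := \<alpha> i - 1)) x))) (at x)"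
proof -
  have low: "monomial (\<alpha>(i := \<alpha> i - 1)) x =
      complex_of_real (x $ i) ^ (\<alpha> i - 1) * (\<Prod>j\<in>UNIV - {i}. complex_of_real (x $ j) ^ \<alpha> j)" for i
    unfolding monomial_def by (subst prod.remove[of UNIV i]) auto
  have c: "((\<lambda>x. complex_of_real (x $ i)) has_derivative (\<lambda>h. complex_of_real (h $ i))) (at x)" for i :: 'a and x
    by (intro derivative_intros bounded_linear_imp_has_derivative) 
       (auto intro: bounded_linear_compose[OF bounded_linear_of_real bounded_linear_vec_nth])
  have "((\<lambda>x. \<Prod>i\<in>UNIV. complex_of_real (x $ i) ^ \<alpha> i) has_derivative
      (\<lambda>h. \<Sum>i\<in>UNIV. (of_nat (\<alpha> i) * complex_of_real (h $ i) * complex_of_real (x $ i) ^ (\<alpha> i - 1)) *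
        (\<Prod>j\<in>UNIV - {i}. complex_of_real (x $ j) ^ \<alpha> j))) (at x)"
    by (rule has_derivative_prod) (use has_derivative_power[OF c] in blast)
  moreover have "(\<lambda>x. \<Prod>i\<in>UNIV. complex_of_real (x $ i) ^ \<alpha> i) = monomial \<alpha>"
    by (simp add: monomial_def fun_eq_iff)
  ultimately show ?thesis unfolding low by (simp add: mult.assoc mult.left_commute)
qed

lemma dir_deriv_eqI: "(f has_derivative f') (at x) \<Longrightarrow> dir_deriv \<nu> f x = f' \<nu>"
  unfolding dir_deriv_def using frechet_derivative_at by metis

lemma sum_axis: "(\<Sum>j\<in>UNIV. complex_of_real (axis i 1 $ j) * g j) = g i"
  by (subst sum.remove[of UNIV i]) (auto simp: axis_def)

lemma monomial_sum_has_derivative: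
  assumes "f = (\<lambda>x. \<Sum>\<alpha>\<in>multi_indices p. c \<alpha> * monomial \<alpha> x)"
  shows "pdiff i f = (\<lambda>x. \<Sum>\<alpha>\<in>multi_indices p. (c \<alpha> * of_nat (\<alpha> i)) * monomial (\<alpha>(i := \<alpha> i - 1)) x)"
    and "(f has_derivative (\<lambda>h. \<Sum>i\<in>UNIV. complex_of_real (h $ i) * pdiff i f x)) (at x)"
proof -
  let ?g = "\<lambda>i x. \<Sum>\<alpha>\<in>multi_indices p. (c \<alpha> * of_nat (\<alpha> i)) * monomial (\<alpha>(i := \<alpha> i - 1)) x"
  have d: "(f has_derivative (\<lambda>h. \<Sum>i\<in>UNIV. complex_of_real (h $ i) * ?g i x)) (at x)" for x
  proof -
    have "(f has_derivative (\<lambda>h. \<Sum>\<alpha>\<in>multi_indices p. c \<alpha> *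
        (\<Sum>i\<in>UNIV. complex_of_real (h $ i) * (of_nat (\<alpha> i) * monomial (\<alpha>(i := \<alpha> i - 1)) x)))) (at x)"
      unfolding assms
      by (intro has_derivative_sum has_derivative_mult_right monomial_has_derivative)
    moreover have "(\<Sum>\<alpha>\<in>multi_indices p. c \<alpha> *
        (\<Sum>i\<in>UNIV. complex_of_real (h $ i) * (of_nat (\<alpha> i) * monomial (\<alpha>(i := \<alpha> i - 1)) x))) =
        (\<Sum>i\<in>UNIV. complex_of_real (h $ i) * ?g i x)" for h
      unfolding sum_distrib_left by (subst sum.swap) (simp add: mult.assoc mult.left_commute)
    ultimately show ?thesis by simp
  qed
  show 1: "pdiff i f = ?g i" for i
    using dir_deriv_eqI[OF d, of "axis i 1"] by (simp add: fun_eq_iff sum_axis)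
  show "(f has_derivative (\<lambda>h. \<Sum>i\<in>UNIV. complex_of_real (h $ i) * pdiff i f x)) (at x)"
    using d unfolding 1 .
qed

lemma poly_has_derivative:
  "f \<in> poly_space p \<Longrightarrow> (f has_derivative (\<lambda>h. \<Sum>i\<in>UNIV. complex_of_real (h $ i) * pdiff i f x)) (at x)"
  using monomial_sum_has_derivative(2) by (auto simp: poly_space_iff)

lemma poly_dir_deriv:
  "f \<in> poly_space p \<Longrightarrow> dir_deriv \<nu> f = (\<lambda>x. \<Sum>i\<in>UNIV. complex_of_real (\<nu> $ i) * pdiff i f x)"
  using dir_deriv_eqI[OF poly_has_derivative] by (auto simp: fun_eq_iff)

lemma poly_pdiff: "f \<in> poly_space p \<Longrightarrow> pdiff i f \<in> poly_space p"
proof -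
  assume "f \<in> poly_space p"
  then obtain c where f: "f = (\<lambda>x. \<Sum>\<alpha>\<in>multi_indices p. c \<alpha> * monomial \<alpha> x)" by (auto simp: poly_space_iff)
  show ?thesis unfolding monomial_sum_has_derivative(1)[OF f]
    by (intro poly_space_sum monomial_in_poly_space multi_indices_lower)
qed

lemma poly_dir_deriv_closed: "f \<in> poly_space p \<Longrightarrow> dir_deriv \<nu> f \<in> poly_space p"
  using poly_dir_deriv[of f p \<nu>] by (auto intro!: poly_space_sum poly_pdiff)

lemma poly_continuous: "f \<in> poly_space p \<Longrightarrow> continuous_on S f"
  by (meson continuous_at_imp_continuous_on has_derivative_continuous poly_has_derivative)

lemma poly_measurable: "f \<in> poly_space p \<Longrightarrow> f \<in> borel_measurable borel"
  by (rule borel_measurable_continuous_onI[OF poly_continuous])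

lemma poly_dir_deriv_lincomb:
  assumes "f \<in> poly_space p" "g \<in> poly_space p"
  shows "dir_deriv \<nu> (\<lambda>x. f x + c * g x) = (\<lambda>x. dir_deriv \<nu> f x + c * dir_deriv \<nu> g x)"
proof
  fix x
  have "((\<lambda>x. f x + c * g x) has_derivative (\<lambda>h. (\<Sum>i\<in>UNIV. complex_of_real (h $ i) * pdiff i f x) +
      c * (\<Sum>i\<in>UNIV. complex_of_real (h $ i) * pdiff i g x))) (at x)"
    by (intro has_derivative_add has_derivative_mult_right poly_has_derivative[OF assms(1)] poly_has_derivative[OF assms(2)])
  from dir_deriv_eqI[OF this, of \<nu>]
  show "dir_deriv \<nu> (\<lambda>x. f x + c * g x) x = dir_deriv \<nu> f x + c * dir_deriv \<nu> g x"
    by (simp add: fun_cong[OF poly_dir_deriv[OF assms(1), of \<nu>]] fun_cong[OF poly_dir_deriv[OF assms(2), of \<nu>]])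
qed

lemma poly_pdiff_commute:
  assumes "f \<in> poly_space p" shows "pdiff i (pdiff j f) = pdiff j (pdiff i f)"
proof -
  obtain c where f: "f = (\<lambda>x. \<Sum>\<alpha>\<in>multi_indices p. c \<alpha> * monomial \<alpha> x)"
    using assms by (auto simp: poly_space_iff)
  have pm: "pdiff k (monomial \<beta>) x = of_nat (\<beta> k) * monomial (\<beta>(k := \<beta> k - 1)) x" for k \<beta> x
    using dir_deriv_eqI[OF monomial_has_derivative, of "axis k 1"] by (simp add: sum_axis)
  have two: "pdiff i (pdiff j f) x = (\<Sum>\<alpha>\<in>multi_indices p. (c \<alpha> * of_nat (\<alpha> j)) *
      (of_nat ((\<alpha>(j := \<alpha> j - 1)) i) * monomial ((\<alpha>(j := \<alpha> j - 1))(i := (\<alpha>(j := \<alpha> j - 1)) i - 1)) x))" for i j x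
  proof -
    have "((\<lambda>x. \<Sum>\<alpha>\<in>multi_indices p. (c \<alpha> * of_nat (\<alpha> j)) * monomial (\<alpha>(j := \<alpha> j - 1)) x) has_derivative
       (\<lambda>h. \<Sum>\<alpha>\<in>multi_indices p. (c \<alpha> * of_nat (\<alpha> j)) * (\<Sum>i\<in>UNIV. complex_of_real (h $ i) *
          (of_nat ((\<alpha>(j := \<alpha> j - 1)) i) * monomial ((\<alpha>(j := \<alpha> j - 1))(i := (\<alpha>(j := \<alpha> j - 1)) i - 1)) x)))) (at x)"
      by (intro has_derivative_sum has_derivative_mult_right monomial_has_derivative)
    from dir_deriv_eqI[OF this, of "axis i 1"]
    show ?thesis unfolding monomial_sum_has_derivative(1)[OF f] by (simp add: sum_axis)
  qed
  show ?thesis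
  proof (cases "i = j")
    case False
    then show ?thesis by (auto simp: two fun_eq_iff fun_upd_twist[of i j] mult_ac)
  qed simp
qed

text \<open>The Rellich multiplier \<open>(x - z) \<bullet> \<nabla>f\<close>.\<close>

definition euler_op :: "real^'n \<Rightarrow> (real^'n \<Rightarrow> complex) \<Rightarrow> real^'n \<Rightarrow> complex" where
  "euler_op z f x = (\<Sum>i\<in>UNIV. complex_of_real ((x - z) $ i) * pdiff i f x)"

lemma euler_op_dir_deriv: "f \<in> poly_space p \<Longrightarrow> euler_op z f x = dir_deriv (x - z) f x"
  using fun_cong[OF poly_dir_deriv, of f p "x - z" x] by (simp add: euler_op_def)

text \<open>\<open>x\<^sub>i \<partial>/\<partial>x\<^sub>i\<close> maps each monomial to a multiple of itself, so the degree does not grow.  This makes the multiplier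
an admissible test function.\<close>

lemma euler_op_closed:
  assumes "f \<in> poly_space p" shows "euler_op z f \<in> poly_space p"
proof -
  obtain c where f: "f = (\<lambda>x. \<Sum>\<alpha>\<in>multi_indices p. c \<alpha> * monomial \<alpha> x)"
    using assms by (auto simp: poly_space_iff)
  have m: "complex_of_real (x $ i) * (of_nat (\<alpha> i) * monomial (\<alpha>(i := \<alpha> i - 1)) x) =
      of_nat (\<alpha> i) * monomial \<alpha> x" for i \<alpha> and x :: "real^'a"
  proof (cases "\<alpha> i")
    case (Suc k)
    have "complex_of_real (x $ i) * monomial (\<alpha>(i := \<alpha> i - 1)) x = monomial \<alpha> x"
      unfolding monomial_def by (subst (1 2) prod.remove[of UNIV i]) (auto simp: Suc)
    then show ?thesis by (metis mult.left_commute)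
  qed simp
  have "(\<lambda>x. \<Sum>i\<in>UNIV. 1 * (\<Sum>\<alpha>\<in>multi_indices p. (c \<alpha> * of_nat (\<alpha> i)) * monomial \<alpha> x)) \<in> poly_space p"
    by (intro poly_space_sum monomial_in_poly_space)
  moreover have "(\<lambda>x. \<Sum>i\<in>UNIV. complex_of_real (z $ i) * pdiff i f x) \<in> poly_space p"
    by (intro poly_space_sum poly_pdiff assms)
  ultimately have "(\<lambda>x. (\<Sum>i\<in>UNIV. 1 * (\<Sum>\<alpha>\<in>multi_indices p. (c \<alpha> * of_nat (\<alpha> i)) * monomial \<alpha> x)) +
      (- 1) * (\<Sum>i\<in>UNIV. complex_of_real (z $ i) * pdiff i f x)) \<in> poly_space p"
    by (rule poly_space_lincomb)
  moreover have "complex_of_real (x $ i) * pdiff i f x = (\<Sum>\<alpha>\<in>multi_indices p. (c \<alpha> * of_nat (\<alpha> i)) * monomial \<alpha> x)" for i x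
    unfolding monomial_sum_has_derivative(1)[OF f] sum_distrib_left
    by (intro sum.cong refl) (metis m mult.assoc mult.left_commute)
  ultimately show ?thesis
    by (simp add: euler_op_def[abs_def] left_diff_distrib sum_subtractf)
qed

lemma pdiff_euler_op:
  assumes f: "f \<in> poly_space p"
  shows "pdiff j (euler_op z f) x = pdiff j f x + euler_op z (pdiff j f) x"
proof -
  have c: "((\<lambda>x. complex_of_real ((x - z) $ i)) has_derivative (\<lambda>h. complex_of_real (h $ i))) (at x)" for i
    by (auto intro!: derivative_eq_intros bounded_linear_imp_has_derivative[OF bounded_linear_vec_nth])
  have "(euler_op z f has_derivative (\<lambda>h. \<Sum>i\<in>UNIV. complex_of_real ((x - z) $ i) *
      (\<Sum>k\<in>UNIV. complex_of_real (h $ k) * pdiff k (pdiff i f) x) + complex_of_real (h $ i) * pdiff i f x)) (at x)"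
    unfolding euler_op_def[abs_def]
    by (intro has_derivative_sum has_derivative_mult c poly_has_derivative[OF poly_pdiff[OF f]])
  from dir_deriv_eqI[OF this, of "axis j 1"]
  have "pdiff j (euler_op z f) x = (\<Sum>i\<in>UNIV. complex_of_real ((x - z) $ i) * pdiff j (pdiff i f) x) + pdiff j f x"
    by (simp add: sum_axis sum.distrib)
  then show ?thesis by (simp add: euler_op_def poly_pdiff_commute[OF f, of j])
qed

lemma poly_zero_on_open:
  fixes f :: "real^'n \<Rightarrow> complex"
  assumes f: "f \<in> poly_space p" and U: "open U" "U \<noteq> {}" and z: "\<And>x. x \<in> U \<Longrightarrow> f x = 0"
  shows "f = (\<lambda>x. 0)"
proof
  fix y
  obtain c where fc: "f = (\<lambda>x. \<Sum>\<alpha>\<in>multi_indices p. c \<alpha> * monomial \<alpha> x)"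
    using f by (auto simp: poly_space_iff)
  obtain u e where u: "u \<in> U" "e > 0" "ball u e \<subseteq> U" using U by (metis all_not_in_conv openE)
  \<comment> \<open>along a line through \<open>u\<close> the function is a polynomial in one variable with infinitely many zeros\<close>
  define q where "q = (\<Sum>\<alpha>\<in>multi_indices p. smult (c \<alpha>)
      (\<Prod>i\<in>UNIV. [:complex_of_real (u $ i), complex_of_real ((y - u) $ i):] ^ \<alpha> i))"
  have q: "poly q (complex_of_real t) = f (u + t *\<^sub>R (y - u))" for t
    by (simp add: q_def fc poly_sum poly_prod monomial_def algebra_simps)
  define d where "d = e / (norm (y - u) + 1)"
  have nn: "norm (y - u) + 1 > 0" by (simp add: add_nonneg_pos)
  have d: "d > 0" using u nn by (simp add: d_def)
  have "poly q (complex_of_real t) = 0" if t: "t \<in> {0<..<d}" for t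
  proof -
    have "norm (t *\<^sub>R (y - u)) = t * norm (y - u)" using t by simp
    also have "\<dots> \<le> t * (norm (y - u) + 1)" using t by (intro mult_left_mono) auto
    also have "\<dots> < e" using t nn by (simp add: d_def pos_less_divide_eq)
    finally have "u + t *\<^sub>R (y - u) \<in> U" using u(3) by (auto simp: dist_norm)
    then show ?thesis using z q by simp
  qed
  then have "complex_of_real ` {0<..<d} \<subseteq> {x. poly q x = 0}" by auto
  moreover have "infinite (complex_of_real ` {0<..<d})"
    using d by (subst finite_image_iff) (auto simp: inj_on_def)
  ultimately have "infinite {x. poly q x = 0}" using finite_subset by blast
  then have "q = 0" using poly_roots_finite by blast
  then show "f y = 0" using q[of 1] by simp
qed

lemma iter_deriv_lincomb:
  assumes "f \<in> poly_space p" "g \<in> poly_space p"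
  shows "(dir_deriv \<nu> ^^ j) (\<lambda>x. f x + c * g x) = (\<lambda>x. (dir_deriv \<nu> ^^ j) f x + c * (dir_deriv \<nu> ^^ j) g x)"
    and "(dir_deriv \<nu> ^^ j) f \<in> poly_space p" 
proof -
  have cl: "(dir_deriv \<nu> ^^ j) f \<in> poly_space p" if "f \<in> poly_space p" for f j
    by (induction j) (simp_all add: that poly_dir_deriv_closed)
  show "(dir_deriv \<nu> ^^ j) f \<in> poly_space p" by (rule cl[OF assms(1)])
  show "(dir_deriv \<nu> ^^ j) (\<lambda>x. f x + c * g x) = (\<lambda>x. (dir_deriv \<nu> ^^ j) f x + c * (dir_deriv \<nu> ^^ j) g x)"
    by (induction j) (simp_all add: poly_dir_deriv_lincomb[OF cl[OF assms(1)] cl[OF assms(2)]])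
qed

lemma iter_deriv_sum:
  assumes "finite A" "\<And>a. a \<in> A \<Longrightarrow> g a \<in> poly_space p"
  shows "(dir_deriv \<nu> ^^ j) (\<lambda>x. \<Sum>a\<in>A. c a * g a x) = (\<lambda>x. \<Sum>a\<in>A. c a * (dir_deriv \<nu> ^^ j) (g a) x)"
  using assms
proof (induction A rule: finite_induct)
  case empty
  have "(dir_deriv \<nu> ^^ j) (\<lambda>x. 0 + (-1) * 0) = (\<lambda>x. (dir_deriv \<nu> ^^ j) (\<lambda>x. 0) x + (-1) * (dir_deriv \<nu> ^^ j) (\<lambda>x. 0) x)"
    by (rule iter_deriv_lincomb(1)[OF poly_space_zero poly_space_zero])
  then show ?case by simp
next
  case (insert a A)
  have "(dir_deriv \<nu> ^^ j) (\<lambda>x. (\<Sum>a\<in>A. c a * g a x) + c a * g a x) =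
      (\<lambda>x. (dir_deriv \<nu> ^^ j) (\<lambda>x. \<Sum>a\<in>A. c a * g a x) x + c a * (dir_deriv \<nu> ^^ j) (g a) x)"
    by (rule iter_deriv_lincomb(1)[OF poly_space_sum]) (use insert in auto)
  then show ?case using insert by (simp add: add.commute)
qed

text \<open>The direction varies with the evaluation point.  Expanding the derivative that is applied first into
partial derivatives reduces the order by one and replaces \<open>f\<close> by other polynomials, which is why the
induction is over all \<open>f\<close>.\<close>

lemma iter_deriv_measurable:
  assumes f: "f \<in> poly_space p" and \<nu> [measurable]: "\<nu> \<in> borel_measurable borel" and B: "\<And>x. norm (\<nu> x :: real^'n) \<le> B"
  shows "(\<lambda>x. (dir_deriv (\<nu> x) ^^ j) f x) \<in> borel_measurable borel \<and>
     (\<forall>S. compact S \<longrightarrow> (\<exists>C. \<forall>x\<in>S. cmod ((dir_deriv (\<nu> x) ^^ j) f x) \<le> C))"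
  using f
proof (induction j arbitrary: f)
  case 0
  have "\<exists>C. \<forall>x\<in>S. cmod (f x) \<le> C" if "compact S" for S
    using compact_imp_bounded[OF compact_continuous_image[OF poly_continuous[OF 0] that]]
    unfolding bounded_iff by blast
  then show ?case using poly_measurable[OF 0] by simp
next
  case (Suc j)
  have eq: "(dir_deriv (\<nu> x) ^^ Suc j) f x = (\<Sum>i\<in>UNIV. complex_of_real (\<nu> x $ i) * (dir_deriv (\<nu> x) ^^ j) (pdiff i f) x)" for x
    unfolding funpow_Suc_right o_apply poly_dir_deriv[OF Suc.prems, of "\<nu> x"]
    by (subst iter_deriv_sum) (auto intro: poly_pdiff Suc.prems)
  note IH = Suc.IH[OF poly_pdiff[OF Suc.prems]]
  have [measurable]: "(\<lambda>x. (dir_deriv (\<nu> x) ^^ j) (pdiff i f) x) \<in> borel_measurable borel" for i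
    using IH by blast
  have [measurable]: "(\<lambda>x. \<nu> x $ i) \<in> borel_measurable borel" for i
    by (rule measurable_compose[OF \<nu> borel_measurable_continuous_onI]) (intro continuous_intros)
  show ?case unfolding eq
  proof (intro conjI allI impI)
    show "(\<lambda>x. \<Sum>i\<in>UNIV. complex_of_real (\<nu> x $ i) * (dir_deriv (\<nu> x) ^^ j) (pdiff i f) x) \<in> borel_measurable borel"
      by measurable
    fix S :: "(real^'n) set" assume S: "compact S"
    then have "\<forall>i. \<exists>C. \<forall>x\<in>S. cmod ((dir_deriv (\<nu> x) ^^ j) (pdiff i f) x) \<le> C" using IH by blast
    then obtain C where C: "\<And>i x. x \<in> S \<Longrightarrow> cmod ((dir_deriv (\<nu> x) ^^ j) (pdiff i f) x) \<le> C i" by metis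
    show "\<exists>C. \<forall>x\<in>S. cmod (\<Sum>i\<in>UNIV. complex_of_real (\<nu> x $ i) * (dir_deriv (\<nu> x) ^^ j) (pdiff i f) x) \<le> C"
    proof (intro exI ballI)
      fix x assume x: "x \<in> S"
      show "cmod (\<Sum>i\<in>UNIV. complex_of_real (\<nu> x $ i) * (dir_deriv (\<nu> x) ^^ j) (pdiff i f) x) \<le> (\<Sum>i\<in>UNIV. B * C i)"
      proof (rule sum_norm_le)
        fix i
        have "\<bar>\<nu> x $ i\<bar> \<le> B" using component_le_norm_cart[of "\<nu> x" i] B[of x] by linarith
        then show "cmod (complex_of_real (\<nu> x $ i) * (dir_deriv (\<nu> x) ^^ j) (pdiff i f) x) \<le> B * C i"
          unfolding norm_mult using C[OF x, of i] by (intro mult_mono) (auto intro: order_trans[OF norm_ge_zero])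
      qed
    qed
  qed
qed

section \<open>Rellich identities on one element\<close>

lemma set_integral_lebesgue_lborel:
  fixes \<phi> :: "'a::euclidean_space \<Rightarrow> 'b::{banach, second_countable_topology}"
  assumes [measurable]: "\<phi> \<in> borel_measurable borel" "K \<in> sets borel"
  shows "(LINT x:K|lebesgue. \<phi> x) = (LINT x:K|lborel. \<phi> x)"
  unfolding set_lebesgue_integral_def by (rule integral_completion) measurable

lemma continuous_set_integrable:
  fixes \<phi> :: "'a::euclidean_space \<Rightarrow> 'b::{banach, second_countable_topology}"
  assumes "compact K" "continuous_on UNIV \<phi>"
  shows "set_integrable lborel K \<phi>"
  unfolding set_integrable_def by (rule borel_integrable_compact[OF assms(1) continuous_on_subset[OF assms(2)]]) simp

lemma Re_set_integral:
  assumes "set_integrable M K \<phi>"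
  shows "Re (LINT x:K|M. \<phi> x) = (LINT x:K|M. Re (\<phi> x))"
  using assms unfolding set_lebesgue_integral_def set_integrable_def by (simp add: integral_Re[symmetric])

lemma Re_mult_cnj_commute: "Re (a * cnj b) = Re (b * cnj a)"
  by (simp add: mult.commute)

lemma normal_flux_integrable:
  fixes K :: "(real^'n) set" and w :: "real^'n \<Rightarrow> real^'n" and \<phi> :: "real^'n \<Rightarrow> real"
  assumes K: "polytope K" "interior K \<noteq> {}" and c: "continuous_on UNIV w" "continuous_on UNIV \<phi>"
  shows "set_integrable surface_measure (frontier K) (\<lambda>x. (outward_normal K x \<bullet> w x) * \<phi> x)"
proof -
  have [measurable]: "outward_normal K \<in> borel_measurable borel"
    by (rule outward_normal_measurable[OF locally_conic_polytope[OF K(1)]])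
  have [measurable]: "w \<in> borel_measurable borel" "\<phi> \<in> borel_measurable borel"
    using c by (auto intro: borel_measurable_continuous_onI)
  have "compact (frontier K)" using polytope_imp_compact[OF K(1)] by (rule compact_frontier)
  then have "bounded ((\<lambda>x. norm (w x) * \<bar>\<phi> x\<bar>) ` frontier K)"
    using c by (intro compact_imp_bounded compact_continuous_image continuous_intros) (auto intro: continuous_on_subset)
  then obtain B where B: "\<And>x. x \<in> frontier K \<Longrightarrow> norm (w x) * \<bar>\<phi> x\<bar> \<le> B" by (auto simp: bounded_iff)
  define N where "N = max 1 (norm (THE \<nu>::real^'n. False))"
  show ?thesis
  proof (rule bounded_set_integrable[where B = "N * B"])
    show "frontier K \<in> sets borel" by (rule borel_closed[OF frontier_closed])
    show "(\<lambda>x. (outward_normal K x \<bullet> w x) * \<phi> x) \<in> borel_measurable borel" by measurable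
    fix x assume x: "x \<in> frontier K"
    have "\<bar>outward_normal K x \<bullet> w x\<bar> \<le> norm (outward_normal K x) * norm (w x)"
      by (rule Cauchy_Schwarz_ineq2)
    also have "\<dots> \<le> N * norm (w x)"
      using outward_normal_bounded[of K x] by (intro mult_right_mono) (simp_all add: N_def)
    finally have "\<bar>outward_normal K x \<bullet> w x\<bar> * \<bar>\<phi> x\<bar> \<le> N * norm (w x) * \<bar>\<phi> x\<bar>" by (rule mult_right_mono) simp
    also have "\<dots> = N * (norm (w x) * \<bar>\<phi> x\<bar>)" by simp
    also have "\<dots> \<le> N * B" using B[OF x] by (intro mult_left_mono) (simp_all add: N_def)
    finally show "norm ((outward_normal K x \<bullet> w x) * \<phi> x) \<le> N * B"
      by (simp only: real_norm_def abs_mult)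
  qed (use surface_measure_frontier_polytope[OF K] in auto)
qed

text \<open>The divergence of the field \<open>(x - z) |f|\<^sup>2\<close> is \<open>d |f|\<^sup>2 + 2 Re ((x - z) \<bullet> \<nabla>f cnj f)\<close>.\<close>

lemma euler_divergence:
  fixes K :: "(real^'n) set"
  assumes K: "polytope K" "interior K \<noteq> {}" and f: "f \<in> poly_space p"
  shows "(LINT x:K|lborel. real CARD('n) * (cmod (f x))\<^sup>2 + 2 * Re (euler_op z f x * cnj (f x))) =
    (LINT x:frontier K|surface_measure. (outward_normal K x \<bullet> (x - z)) * (cmod (f x))\<^sup>2)"
proof -
  have cK: "compact K" by (rule polytope_imp_compact[OF K(1)])
  have [measurable]: "f \<in> borel_measurable borel" by (rule poly_measurable[OF f])
  have nm [measurable]: "outward_normal K \<in> borel_measurable borel"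
    by (rule outward_normal_measurable[OF locally_conic_polytope[OF K(1)]])
  let ?F = "\<lambda>i x. (x - z) $ i * (cmod (f x))\<^sup>2"
  let ?F' = "\<lambda>i x h. h $ i * (cmod (f x))\<^sup>2 +
      (x - z) $ i * (2 * Re ((\<Sum>k\<in>UNIV. complex_of_real (h $ k) * pdiff k f x) * cnj (f x)))"
  have c: "((\<lambda>x. (x - z) $ i) has_derivative (\<lambda>h. h $ i)) (at x)" for i x
    by (auto intro!: derivative_eq_intros bounded_linear_imp_has_derivative[OF bounded_linear_vec_nth])
  have d: "(?F i has_derivative ?F' i x) (at x)" for i x
  proof -
    have "((\<lambda>x. f x \<bullet> f x) has_derivative (\<lambda>h. f x \<bullet> (\<Sum>k\<in>UNIV. complex_of_real (h $ k) * pdiff k f x) +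
        (\<Sum>k\<in>UNIV. complex_of_real (h $ k) * pdiff k f x) \<bullet> f x)) (at x)"
      by (rule has_derivative_inner[OF poly_has_derivative[OF f] poly_has_derivative[OF f]])
    then have "((\<lambda>x. (cmod (f x))\<^sup>2) has_derivative
        (\<lambda>h. 2 * Re ((\<Sum>k\<in>UNIV. complex_of_real (h $ k) * pdiff k f x) * cnj (f x)))) (at x)"
      by (simp add: dot_square_norm inner_complex_def algebra_simps)
    from has_derivative_mult[OF c this] show ?thesis by (simp add: add.commute)
  qed
  have F'ax: "?F' i x (axis i 1) = (cmod (f x))\<^sup>2 + (x - z) $ i * (2 * Re (pdiff i f x * cnj (f x)))" for i x
    by (simp add: sum_axis)
  have c': "continuous_on UNIV (\<lambda>x. ?F' i x (axis i 1))" for i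
    unfolding F'ax by (intro continuous_intros poly_continuous[OF f] poly_continuous[OF poly_pdiff[OF f]])
  have "(LINT x:K|lborel. real CARD('n) * (cmod (f x))\<^sup>2 + 2 * Re (euler_op z f x * cnj (f x))) =
      (LINT x:K|lborel. (\<Sum>i\<in>UNIV. ?F' i x (axis i 1)))"
    unfolding F'ax euler_op_def
    by (simp add: sum.distrib sum_distrib_left sum_distrib_right algebra_simps sum_subtractf)
  also have "\<dots> = (\<Sum>i\<in>UNIV. LINT x:K|lborel. ?F' i x (axis i 1))"
    using continuous_set_integrable[OF cK c']
    unfolding set_lebesgue_integral_def set_integrable_def scaleR_sum_right
    by (intro Bochner_Integration.integral_sum) blast
  also have "\<dots> = (\<Sum>i\<in>UNIV. LINT x:frontier K|surface_measure. (outward_normal K x \<bullet> axis i 1) * ?F i x)"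
    by (intro sum.cong refl divergence_polytope[OF K d c'])
  also have "\<dots> = (LINT x:frontier K|surface_measure. (\<Sum>i\<in>UNIV. (outward_normal K x \<bullet> axis i 1) * ?F i x))"
  proof -
    have "set_integrable surface_measure (frontier K) (\<lambda>x. (outward_normal K x \<bullet> axis i 1) * ?F i x)" for i
      by (intro normal_flux_integrable[OF K] continuous_intros poly_continuous[OF f])
    then show ?thesis
      unfolding set_lebesgue_integral_def set_integrable_def scaleR_sum_right
      by (intro Bochner_Integration.integral_sum[symmetric]) blast
  qed
  also have "\<dots> = (LINT x:frontier K|surface_measure. (outward_normal K x \<bullet> (x - z)) * (cmod (f x))\<^sup>2)"
  proof -
    have "(\<Sum>i\<in>UNIV. (outward_normal K x \<bullet> axis i 1) * ?F i x) = (outward_normal K x \<bullet> (x - z)) * (cmod (f x))\<^sup>2" for x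
      by (simp add: inner_axis inner_vec_def[of "outward_normal K x" "x - z"] sum_distrib_right mult.assoc)
    then show ?thesis by simp
  qed
  finally show ?thesis .
qed

lemma rellich_mass:
  fixes K :: "(real^'n) set"
  assumes K: "polytope K" "interior K \<noteq> {}" and f: "f \<in> poly_space p"
  shows "2 * Re (L2_inner lebesgue K f (euler_op z f)) = - real CARD('n) * (LINT x:K|lborel. (cmod (f x))\<^sup>2) +
    (LINT x:frontier K|surface_measure. (outward_normal K x \<bullet> (x - z)) * (cmod (f x))\<^sup>2)"
proof -
  have cK: "compact K" by (rule polytope_imp_compact[OF K(1)])
  have Kb: "K \<in> sets borel" using cK by (rule borel_compact)
  note cf = poly_continuous[OF f] poly_continuous[OF euler_op_closed[OF f]]
  have c1: "continuous_on UNIV (\<lambda>x. f x * cnj (euler_op z f x))" by (intro continuous_intros cf)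
  have c2: "continuous_on UNIV (\<lambda>x. real CARD('n) * (cmod (f x))\<^sup>2)" by (intro continuous_intros cf)
  have c3: "continuous_on UNIV (\<lambda>x. 2 * Re (euler_op z f x * cnj (f x)))" by (intro continuous_intros cf)
  have "Re (L2_inner lebesgue K f (euler_op z f)) = (LINT x:K|lborel. Re (f x * cnj (euler_op z f x)))"
    unfolding L2_inner_def
    by (subst set_integral_lebesgue_lborel[OF borel_measurable_continuous_onI[OF c1] Kb])
      (rule Re_set_integral[OF continuous_set_integrable[OF cK c1]])
  then have "2 * Re (L2_inner lebesgue K f (euler_op z f)) = (LINT x:K|lborel. 2 * Re (euler_op z f x * cnj (f x)))"
    by (simp add: Re_mult_cnj_commute[of "f _"] del: complex_cnj_mult times_complex.simps)
  moreover have "(LINT x:K|lborel. real CARD('n) * (cmod (f x))\<^sup>2 + 2 * Re (euler_op z f x * cnj (f x))) =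
     real CARD('n) * (LINT x:K|lborel. (cmod (f x))\<^sup>2) + (LINT x:K|lborel. 2 * Re (euler_op z f x * cnj (f x)))"
    using set_integral_add(2)[OF continuous_set_integrable[OF cK c2] continuous_set_integrable[OF cK c3]] by simp
  ultimately show ?thesis using euler_divergence[OF K f, of z] by linarith
qed

text \<open>Taking the gradient commutes with the multiplier up to the gradient itself (\<open>pdiff_euler_op\<close>), so this
is \<open>euler_divergence\<close> applied to each partial derivative.\<close>

lemma rellich_stiffness:
  fixes K :: "(real^'n) set"
  assumes K: "polytope K" "interior K \<noteq> {}" and f: "f \<in> poly_space p"
  shows "2 * Re (grad_inner K f (euler_op z f)) =
    (2 - real CARD('n)) * (LINT x:K|lborel. (\<Sum>j\<in>UNIV. (cmod (pdiff j f x))\<^sup>2)) +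
    (\<Sum>j\<in>UNIV. LINT x:frontier K|surface_measure. (outward_normal K x \<bullet> (x - z)) * (cmod (pdiff j f x))\<^sup>2)"
proof -
  have cK: "compact K" by (rule polytope_imp_compact[OF K(1)])
  have Kb: "K \<in> sets borel" using cK by (rule borel_compact)
  let ?g = "\<lambda>j. pdiff j f"
  have g: "?g j \<in> poly_space p" for j by (rule poly_pdiff[OF f])
  have e: "pdiff j (euler_op z f) \<in> poly_space p" for j by (intro poly_pdiff euler_op_closed f)
  note cg = poly_continuous[OF g] poly_continuous[OF euler_op_closed[OF g]]
  have c1: "continuous_on UNIV (\<lambda>x. \<Sum>i\<in>UNIV. pdiff i f x * cnj (pdiff i (euler_op z f) x))"
    by (intro continuous_intros cg poly_continuous[OF e])
  have c2: "continuous_on UNIV (\<lambda>x. (2 - real CARD('n)) * (\<Sum>j\<in>UNIV. (cmod (?g j x))\<^sup>2))"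
    by (intro continuous_intros cg)
  have c3: "continuous_on UNIV (\<lambda>x. real CARD('n) * (cmod (?g j x))\<^sup>2 + 2 * Re (euler_op z (?g j) x * cnj (?g j x)))" for j
    by (intro continuous_intros cg)
  have "2 * Re (grad_inner K f (euler_op z f)) =
      (LINT x:K|lborel. 2 * Re (\<Sum>i\<in>UNIV. pdiff i f x * cnj (pdiff i (euler_op z f) x)))"
    unfolding grad_inner_def
    by (subst set_integral_lebesgue_lborel[OF borel_measurable_continuous_onI[OF c1] Kb])
      (subst Re_set_integral[OF continuous_set_integrable[OF cK c1]], simp)
  also have "\<dots> = (LINT x:K|lborel. (2 - real CARD('n)) * (\<Sum>j\<in>UNIV. (cmod (?g j x))\<^sup>2) +
      (\<Sum>j\<in>UNIV. real CARD('n) * (cmod (?g j x))\<^sup>2 + 2 * Re (euler_op z (?g j) x * cnj (?g j x))))"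
  proof -
    have "2 * Re (\<Sum>i\<in>UNIV. pdiff i f x * cnj (pdiff i (euler_op z f) x)) =
        (2 - real CARD('n)) * (\<Sum>j\<in>UNIV. (cmod (?g j x))\<^sup>2) +
        (\<Sum>j\<in>UNIV. real CARD('n) * (cmod (?g j x))\<^sup>2 + 2 * Re (euler_op z (?g j) x * cnj (?g j x)))" for x
    proof -
      have "2 * Re (pdiff i f x * cnj (pdiff i (euler_op z f) x)) =
        (2 - real CARD('n)) * (cmod (?g i x))\<^sup>2 +
        (real CARD('n) * (cmod (?g i x))\<^sup>2 + 2 * Re (euler_op z (?g i) x * cnj (?g i x)))" for i
      proof -
        have "pdiff i f x * cnj (pdiff i (euler_op z f) x) =
            complex_of_real ((cmod (?g i x))\<^sup>2) + ?g i x * cnj (euler_op z (?g i) x)"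
          unfolding pdiff_euler_op[OF f] by (simp add: distrib_left complex_norm_square[symmetric] del: of_real_power)
        then have "Re (pdiff i f x * cnj (pdiff i (euler_op z f) x)) =
            (cmod (?g i x))\<^sup>2 + Re (euler_op z (?g i) x * cnj (?g i x))"
          unfolding Re_mult_cnj_commute[of "euler_op z (?g i) x"] by (simp del: times_complex.simps)
        then show ?thesis by (simp add: algebra_simps del: times_complex.simps)
      qed
      then show ?thesis
        unfolding Re_sum sum_distrib_left by (simp only: sum.distrib[symmetric])
    qed
    then show ?thesis by simp
  qed
  also have "\<dots> = (LINT x:K|lborel. (2 - real CARD('n)) * (\<Sum>j\<in>UNIV. (cmod (?g j x))\<^sup>2)) +
      (LINT x:K|lborel. (\<Sum>j\<in>UNIV. real CARD('n) * (cmod (?g j x))\<^sup>2 + 2 * Re (euler_op z (?g j) x * cnj (?g j x))))"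
    by (intro set_integral_add(2) continuous_set_integrable[OF cK] c2 continuous_on_sum c3)
  also have "(LINT x:K|lborel. (\<Sum>j\<in>UNIV. real CARD('n) * (cmod (?g j x))\<^sup>2 + 2 * Re (euler_op z (?g j) x * cnj (?g j x)))) =
      (\<Sum>j\<in>UNIV. LINT x:K|lborel. real CARD('n) * (cmod (?g j x))\<^sup>2 + 2 * Re (euler_op z (?g j) x * cnj (?g j x)))"
    using continuous_set_integrable[OF cK c3]
    unfolding set_lebesgue_integral_def set_integrable_def scaleR_sum_right
    by (intro Bochner_Integration.integral_sum) blast
  also have "\<dots> = (\<Sum>j\<in>UNIV. LINT x:frontier K|surface_measure. (outward_normal K x \<bullet> (x - z)) * (cmod (?g j x))\<^sup>2)"
    by (intro sum.cong refl euler_divergence[OF K g])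
  finally show ?thesis by simp
qed

section \<open>Local structure of the mesh\<close>

lemma polytope_arrangement:
  fixes P :: "(real^'n) set"
  assumes P: "polytope P"
  shows "\<exists>\<H>. finite \<H> \<and> \<H> \<subseteq> hyperplanes \<and> frontier P \<subseteq> \<Union>\<H>"
proof (cases "interior P = {}")
  case False
  then show ?thesis
    using finite_facet_hulls[OF P] facet_hulls_hyperplanes[OF P False] frontier_subset_facet_hulls[OF P False] by blast
next
  case True
  then obtain a b where a: "a \<noteq> 0" "P \<subseteq> {x. a \<bullet> x = b}"
    using empty_interior_subset_hyperplane[OF polytope_imp_convex[OF P]] by blast
  have "frontier P \<subseteq> P" using polytope_imp_closed[OF P] by (rule frontier_subset_closed)
  then show ?thesis using a hyperplane_in_hyperplanes[OF a(1), of b]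
    by (intro exI[of _ "{{x. a \<bullet> x = b}}"]) auto
qed

lemma simplex_interior_nonempty:
  fixes K :: "(real^'n) set"
  assumes "int CARD('n) simplex K"
  shows "polytope K" "interior K \<noteq> {}"
proof -
  show "polytope K" using assms by (rule simplex_imp_polytope)
  have "aff_dim K = int CARD('n)" using assms by (rule aff_dim_simplex)
  then have U: "affine hull K = UNIV" "K \<noteq> {}" using aff_dim_eq_full[of K] by auto
  have "convex K" using \<open>polytope K\<close> by (rule polytope_imp_convex)
  then have "rel_interior K \<noteq> {}" using U(2) rel_interior_eq_empty by blast
  then show "interior K \<noteq> {}" using rel_interior_interior[OF U(1)] by simp
qed

text \<open>The geometric setting, reduced to what the argument uses.  \<open>\<H>\<close> is a finite arrangement of hyperplanes
that carries the facets of all elements and the boundary of \<open>\<Omega>\<^sub>1\<close>.  That \<open>\<Omega>\<^sub>1\<close> is the interior of its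
closure puts elements on the inner side of its boundary, and local conicity makes normals measurable.\<close>

locale meshed_domain =
  fixes \<Omega>\<^sub>1 D :: "(real^'n) set" and T \<H> :: "(real^'n) set set" and lab :: "(real^'n) set \<Rightarrow> nat"
  assumes open_\<Omega>\<^sub>1: "open \<Omega>\<^sub>1" and bounded_\<Omega>\<^sub>1: "bounded \<Omega>\<^sub>1" and regular_\<Omega>\<^sub>1: "interior (closure \<Omega>\<^sub>1) = \<Omega>\<^sub>1"
    and conic_\<Omega>\<^sub>1: "locally_conic \<Omega>\<^sub>1"
    and open_D: "open D" and D_sub: "D \<subseteq> \<Omega>\<^sub>1"
    and mesh: "simplicial_mesh (\<Omega>\<^sub>1 - D) T" and inj_lab: "inj_on lab T"
    and dim2: "CARD('n) \<ge> 2"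
    and finite_\<H>: "finite \<H>" and hyp_\<H>: "\<H> \<subseteq> hyperplanes"
    and hulls: "\<And>K. K \<in> T \<Longrightarrow> facet_hulls K \<subseteq> \<H>" and frontier_\<Omega>\<^sub>1: "frontier \<Omega>\<^sub>1 \<subseteq> \<Union>\<H>"
begin

abbreviation "\<Omega> \<equiv> \<Omega>\<^sub>1 - D"

definition generic :: "real^'n \<Rightarrow> bool" where
  "generic x \<longleftrightarrow> (\<forall>H\<in>\<H>. \<forall>H'\<in>\<H>. x \<in> H \<longrightarrow> x \<in> H' \<longrightarrow> H = H')"

lemma AE_generic: "AE x in surface_measure. generic x"
  unfolding generic_def by (rule AE_surface_generic[OF finite_\<H> hyp_\<H>])

lemma finite_T: "finite T" and Union_T: "\<Union>T = closure \<Omega>"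
  using mesh by (auto simp: simplicial_mesh_def)

lemma
  assumes "K \<in> T"
  shows polytope_T: "polytope K" and interior_T: "interior K \<noteq> {}" and compact_T: "compact K"
    and closed_T: "closed K" and convex_T: "convex K" and frontier_T: "frontier K \<subseteq> \<Union>\<H>"
    and frontier_subset_T: "frontier K \<subseteq> K"
proof -
  have "int CARD('n) simplex K" using mesh assms by (auto simp: simplicial_mesh_def)
  from simplex_interior_nonempty[OF this] show p: "polytope K" and i: "interior K \<noteq> {}" by auto
  show "compact K" using p by (rule polytope_imp_compact)
  show c: "closed K" using p by (rule polytope_imp_closed)
  show "convex K" using p by (rule polytope_imp_convex)
  show "frontier K \<subseteq> \<Union>\<H>" using frontier_subset_facet_hulls[OF p i] hulls[OF assms] by blast
  show "frontier K \<subseteq> K" using c by (rule frontier_subset_closed)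
qed

lemma interiors_disjoint: "K \<in> T \<Longrightarrow> K' \<in> T \<Longrightarrow> K \<noteq> K' \<Longrightarrow> interior K \<inter> interior K' = {}"
  using mesh by (auto simp: simplicial_mesh_def pairwise_def)

lemma D_disjoint: "D \<inter> \<Union>T = {}"
proof -
  have "D \<inter> closure \<Omega> \<subseteq> closure (D \<inter> \<Omega>)" by (rule open_Int_closure_subset[OF open_D])
  then show ?thesis unfolding Union_T by auto
qed

text \<open>Each point of \<open>\<Omega>\<^sub>1\<close> lies either in \<open>D\<close> or in an element.  Hence the boundary of \<open>D\<close> inside \<open>\<Omega>\<^sub>1\<close> is polyhedral,
too.\<close>

lemma \<Omega>_eq: "\<Omega> = \<Omega>\<^sub>1 \<inter> \<Union>T"
proof
  show "\<Omega> \<subseteq> \<Omega>\<^sub>1 \<inter> \<Union>T" unfolding Union_T using closure_subset[of \<Omega>] by blast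
  show "\<Omega>\<^sub>1 \<inter> \<Union>T \<subseteq> \<Omega>" using D_disjoint by blast
qed

lemma T_subset_closure: "K \<in> T \<Longrightarrow> K \<subseteq> closure \<Omega>\<^sub>1"
  using Union_T closure_mono[of \<Omega> \<Omega>\<^sub>1] by blast

lemma interior_subset_\<Omega>\<^sub>1: "K \<in> T \<Longrightarrow> interior K \<subseteq> \<Omega>\<^sub>1"
  using interior_mono[OF T_subset_closure] regular_\<Omega>\<^sub>1 by auto

lemma interior_subset_\<Omega>: "K \<in> T \<Longrightarrow> interior K \<subseteq> \<Omega>"
  unfolding \<Omega>_eq using interior_subset_\<Omega>\<^sub>1[of K] interior_subset[of K] by blast

lemma conic_\<Omega>: "locally_conic \<Omega>"
  unfolding \<Omega>_eq by (intro locally_conic_Int conic_\<Omega>\<^sub>1 locally_conic_Union finite_T locally_conic_polytope polytope_T)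

text \<open>Near \<open>x\<close>, the element \<open>K\<close> is the lower half of a ball, and only one hyperplane of the arrangement is met.\<close>

definition element_at :: "(real^'n) set \<Rightarrow> real^'n \<Rightarrow> real \<Rightarrow> real^'n \<Rightarrow> real \<Rightarrow> bool" where
  "element_at K n b x r \<longleftrightarrow> K \<in> T \<and> norm n = 1 \<and> {y. n \<bullet> y = b} \<in> \<H> \<and> generic_at \<H> {y. n \<bullet> y = b} x r \<and>
     half_ball n b x r \<subseteq> interior K \<and> K \<subseteq> {y. n \<bullet> y \<le> b}"

lemma element_atD:
  assumes "element_at K n b x r"
  shows "K \<in> T" "norm n = 1" "{y. n \<bullet> y = b} \<in> \<H>" "generic_at \<H> {y. n \<bullet> y = b} x r"
    "half_ball n b x r \<subseteq> interior K" "K \<subseteq> {y. n \<bullet> y \<le> b}" "r > 0" "n \<bullet> x = b"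
  using assms by (auto simp: element_at_def generic_at_def)

lemma element_at_frontier:
  assumes e: "element_at K n b x r" and y: "y \<in> ball x r" "n \<bullet> y = b"
  shows "y \<in> frontier K"
proof -
  note e' = element_atD[OF e]
  have "half_ball n b x r \<subseteq> K" using e'(5) interior_subset by blast
  then have "y \<in> K"
    using ball_in_closure_half_balls[OF e'(2) y(1), of b] y(2) closure_minimal[OF _ closed_T[OF e'(1)]] by auto
  moreover have "y \<notin> interior K"
  proof -
    have "interior K \<subseteq> interior {y. n \<bullet> y \<le> b}" by (rule interior_mono[OF e'(6)])
    moreover have "n \<noteq> 0" using e'(2) by auto
    ultimately show ?thesis using y(2) interior_halfspace_le[of n b] by auto
  qed
  ultimately show ?thesis using closed_T[OF e'(1)] by (simp add: frontier_def)
qed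

lemma element_at_normal:
  assumes e: "element_at K n b x r" shows "outward_normal K x = n"
proof -
  note e' = element_atD[OF e]
  have "half_ball n b x r \<subseteq> K" using e'(5) interior_subset by blast
  moreover have "half_ball (- n) (- b) x r \<inter> K = {}" using e'(6) by (auto simp: half_ball_upper)
  ultimately show ?thesis
    by (intro outward_normal_eqI is_outward_normal_half_ball[OF e'(2,8,7)])
qed

text \<open>On the half ball opposite to \<open>K\<close>, membership in each element and in \<open>\<Omega>\<^sub>1\<close> is constant.  Either a second
element fills it, or no element meets it; in the latter case it lies in \<open>\<Omega>\<^sub>1\<close> and therefore in \<open>D\<close>, or
outside \<open>\<Omega>\<^sub>1\<close>.\<close>

lemma frontier_point_cases:
  assumes K: "K \<in> T" and x: "x \<in> frontier K" and g: "generic x"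
  obtains (interior) n b r K' where "element_at K n b x r" "element_at K' (- n) (- b) x r" "K' \<noteq> K"
  | (inner) n b r where "element_at K n b x r" "half_ball (- n) (- b) x r \<subseteq> D" "ball x r \<subseteq> \<Omega>\<^sub>1"
  | (outer) n b r where "element_at K n b x r" "half_ball (- n) (- b) x r \<inter> \<Omega>\<^sub>1 = {}"
      "half_ball (- n) (- b) x r \<inter> \<Union>T = {}"
proof -
  obtain H where H: "H \<in> \<H>" "x \<in> H" using frontier_T[OF K] x by auto
  have "\<And>H'. H' \<in> \<H> \<Longrightarrow> x \<in> H' \<Longrightarrow> H' = H" using g H by (auto simp: generic_def)
  then obtain r where r: "generic_at \<H> H x r" using generic_at_exists[OF finite_\<H> hyp_\<H> H(2)] by blast
  have Hh: "H \<in> hyperplanes" using H hyp_\<H> by auto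
  obtain n b where n: "norm n = 1" "H = {y. n \<bullet> y = b}" "half_ball n b x r \<subseteq> interior K" "K \<subseteq> {y. n \<bullet> y \<le> b}"
    using convex_generic_frontier_point[OF r Hh convex_T[OF K] closed_T[OF K] interior_T[OF K] frontier_T[OF K] x] .
  have e: "element_at K n b x r" unfolding element_at_def using K n H r by auto
  note e' = element_atD[OF e]
  have gm: "generic_at \<H> {y. (- n) \<bullet> y = - b} x r" using e'(4) by simp
  show thesis
  proof (cases "\<exists>K'\<in>T. half_ball (- n) (- b) x r \<subseteq> interior K'")
    case True
    then obtain K' where K': "K' \<in> T" "half_ball (- n) (- b) x r \<subseteq> interior K'" by blast
    have hK: "half_ball (- n) (- b) x r \<inter> K = {}" using e'(6) by (auto simp: half_ball_upper)
    have ne: "half_ball (- n) (- b) x r \<noteq> {}" "half_ball n b x r \<noteq> {}"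
      using half_ball_nonempty[of "- n" x "- b" r] half_ball_nonempty[of n x b r] e' by auto
    have "K' \<noteq> K" using K'(2) hK ne(1) interior_subset[of K] by blast
    have "half_ball n b x r \<inter> K' = {}"
      using half_ball_dichotomy[OF e'(4) frontier_T[OF K'(1)]] e'(5) ne(2)
        interiors_disjoint[OF K K'(1)] \<open>K' \<noteq> K\<close> by blast
    then have "K' \<subseteq> {y. (- n) \<bullet> y \<le> - b}"
      using K'(2) interior_subset[of K'] e'
      by (intro supporting_if_half_ball[OF convex_T[OF K'(1)], where r = r and x = x]) auto
    then have "element_at K' (- n) (- b) x r" unfolding element_at_def using K' e' gm by auto
    then show thesis using interior e \<open>K' \<noteq> K\<close> by blast
  next
    case False
    have noT: "half_ball (- n) (- b) x r \<inter> \<Union>T = {}"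
    proof (rule ccontr)
      assume "half_ball (- n) (- b) x r \<inter> \<Union>T \<noteq> {}"
      then obtain K' where "K' \<in> T" "half_ball (- n) (- b) x r \<inter> K' \<noteq> {}" by blast
      then show False using half_ball_dichotomy[OF gm frontier_T] False by blast
    qed
    have "half_ball (- n) (- b) x r \<subseteq> interior \<Omega>\<^sub>1 \<or> half_ball (- n) (- b) x r \<inter> \<Omega>\<^sub>1 = {}"
      by (rule half_ball_dichotomy[OF gm frontier_\<Omega>\<^sub>1])
    then show thesis
    proof
      assume 1: "half_ball (- n) (- b) x r \<subseteq> interior \<Omega>\<^sub>1"
      then have up: "half_ball (- n) (- b) x r \<subseteq> \<Omega>\<^sub>1" using interior_subset by blast
      have "half_ball n b x r \<subseteq> \<Omega>\<^sub>1" using e'(5) interior_subset_\<Omega>\<^sub>1[OF K] by blast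
      then have "ball x r \<subseteq> closure \<Omega>\<^sub>1"
        using up closure_subset[of \<Omega>\<^sub>1] by (intro ball_subset_of_half_balls[OF e'(2)]) auto
      then have "ball x r \<subseteq> \<Omega>\<^sub>1" using interior_maximal[OF _ open_ball] regular_\<Omega>\<^sub>1 by blast
      moreover have "half_ball (- n) (- b) x r \<subseteq> D" using up noT \<Omega>_eq by blast
      ultimately show thesis using inner[OF e] by blast
    qed (use outer[OF e] noT in blast)
  qed
qed

text \<open>Every element that meets the ball fills one of the two half balls, and interiors are disjoint.\<close>

lemma elements_at_interior:
  assumes e: "element_at K n b x r" "element_at K' (- n) (- b) x r"
    and y: "y \<in> ball x r" and K'': "K'' \<in> T" "y \<in> K''"
  shows "K'' = K \<or> K'' = K'"
proof -
  note e1 = element_atD[OF e(1)] and e2 = element_atD[OF e(2)]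
  have ne: "half_ball (- n) (- b) x r \<noteq> {}" "half_ball n b x r \<noteq> {}"
    using half_ball_nonempty[of "- n" x "- b" r] half_ball_nonempty[of n x b r] e1 by auto
  show ?thesis
    using half_ball_of_convex[OF e1(4,2) convex_T closed_T interior_T frontier_T, OF K''(1) K''(1) K''(1) K''(1) K''(2) y] interiors_disjoint[OF K''(1) e1(1)]
      interiors_disjoint[OF K''(1) e2(1)] e1(5) e2(5) ne by blast
qed

lemma elements_at_boundary:
  assumes e: "element_at K n b x r" and noT: "half_ball (- n) (- b) x r \<inter> \<Union>T = {}"
    and y: "y \<in> ball x r" and K'': "K'' \<in> T" "y \<in> K''"
  shows "K'' = K"
proof -
  note e1 = element_atD[OF e(1)]
  have ne: "half_ball (- n) (- b) x r \<noteq> {}" "half_ball n b x r \<noteq> {}"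
    using half_ball_nonempty[of "- n" x "- b" r] half_ball_nonempty[of n x b r] e1 by auto
  have "\<not> half_ball (- n) (- b) x r \<subseteq> interior K''"
    using noT K''(1) ne(1) interior_subset[of K''] by blast
  then show ?thesis
    using half_ball_of_convex[OF e1(4,2) convex_T closed_T interior_T frontier_T, OF K''(1) K''(1) K''(1) K''(1) K''(2) y] interiors_disjoint[OF K''(1) e1(1)] e1(5) ne by blast
qed

lemma glue_boundary:
  assumes e: "element_at K n b x r" and noT: "half_ball (- n) (- b) x r \<inter> \<Union>T = {}"
    and y: "y \<in> ball x r" "n \<bullet> y = b"
  shows "glue T u y = u K y"
proof -
  have "y \<in> K" using element_at_frontier[OF e y] frontier_subset_T[OF element_atD(1)[OF e]] by blast
  moreover have "K'' = K" if "K'' \<in> T" "y \<in> K''" for K''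
    by (rule elements_at_boundary[OF e noT y(1) that])
  ultimately have "{K \<in> T. y \<in> K} = {K}" using element_atD(1)[OF e] by blast
  then show ?thesis by (simp add: glue_def)
qed

lemma inner_point:
  assumes e: "element_at K n b x r" and D: "half_ball (- n) (- b) x r \<subseteq> D"
    and y: "y \<in> ball x r" "n \<bullet> y = b"
  shows "half_ball (- n) (- b) x r \<inter> \<Union>T = {}" "y \<in> frontier D"
proof -
  show "half_ball (- n) (- b) x r \<inter> \<Union>T = {}" using D D_disjoint by blast
  note e' = element_atD[OF e]
  have "y \<in> closure (half_ball (- n) (- b) x r)" using e' y by (intro ball_in_closure_half_balls) auto
  then have "y \<in> closure D" using closure_mono[OF D] by auto
  moreover have "y \<notin> D" using element_at_frontier[OF e y] frontier_subset_T[OF e'(1)] e'(1) D_disjoint by blast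
  ultimately show "y \<in> frontier D" using open_D by (simp add: frontier_def interior_open)
qed

lemma inner_normals:
  assumes e: "element_at K n b x r" and D: "half_ball (- n) (- b) x r \<subseteq> D"
  shows "is_outward_normal D x (- n)" "outward_normal \<Omega> x = n"
proof -
  note e' = element_atD[OF e]
  have K: "half_ball n b x r \<subseteq> \<Omega>" using e'(5) interior_subset_\<Omega>[OF e'(1)] by blast
  show "is_outward_normal D x (- n)"
    by (rule is_outward_normal_half_ball[of _ x "- b" r]) (use e' D K in auto)
  show "outward_normal \<Omega> x = n"
    by (rule outward_normal_eqI, rule is_outward_normal_half_ball[of _ x b r]) (use e' D K in auto)
qed

lemma outer_point:
  assumes e: "element_at K n b x r" and O: "half_ball (- n) (- b) x r \<inter> \<Omega>\<^sub>1 = {}"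
  shows "\<And>y. y \<in> ball x r \<Longrightarrow> n \<bullet> y = b \<Longrightarrow> y \<in> frontier \<Omega>\<^sub>1" "x \<notin> frontier D" "is_outward_normal \<Omega>\<^sub>1 x n"
proof -
  note e' = element_atD[OF e]
  have low: "half_ball n b x r \<subseteq> \<Omega>\<^sub>1" using e'(5) interior_subset_\<Omega>\<^sub>1[OF e'(1)] by blast
  show fr: "y \<in> frontier \<Omega>\<^sub>1" if y: "y \<in> ball x r" "n \<bullet> y = b" for y
  proof -
    have "y \<in> closure \<Omega>\<^sub>1"
      using element_at_frontier[OF e y] frontier_subset_T[OF e'(1)] T_subset_closure[OF e'(1)] by blast
    moreover have "y \<notin> \<Omega>\<^sub>1"
    proof
      assume "y \<in> \<Omega>\<^sub>1"
      moreover have "y \<in> closure (half_ball (- n) (- b) x r)" using e' y by (intro ball_in_closure_half_balls) auto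
      ultimately show False using open_Int_closure_eq_empty[OF open_\<Omega>\<^sub>1, of "half_ball (- n) (- b) x r"] O by blast
    qed
    ultimately show ?thesis using open_\<Omega>\<^sub>1 by (simp add: frontier_def interior_open)
  qed
  have "ball x r \<inter> D = {}"
  proof (rule ccontr)
    assume "ball x r \<inter> D \<noteq> {}"
    then obtain y where y: "y \<in> ball x r" "y \<in> D" by blast
    then have "y \<in> \<Omega>\<^sub>1" using D_sub by blast
    consider "n \<bullet> y < b" | "n \<bullet> y = b" | "n \<bullet> y > b" by linarith
    then show False
    proof cases
      case 1
      then have "y \<in> interior K" using y e'(5) by (auto simp: half_ball_def)
      then show False using interior_subset_\<Omega>[OF e'(1)] y by blast
    next
      case 2
      then show False using fr[OF y(1) 2] \<open>y \<in> \<Omega>\<^sub>1\<close> open_\<Omega>\<^sub>1 by (simp add: frontier_def interior_open)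
    next
      case 3
      then show False using O y \<open>y \<in> \<Omega>\<^sub>1\<close> by (auto simp: half_ball_upper)
    qed
  qed
  then have "x \<notin> closure D" using open_Int_closure_eq_empty[OF open_ball, of x r D] e'(7) centre_in_ball[of x r] by blast
  then show "x \<notin> frontier D" by (simp add: frontier_def)
  show "is_outward_normal \<Omega>\<^sub>1 x n"
    by (rule is_outward_normal_half_ball[OF e'(2,8,7) low O])
qed

end

section \<open>Faces at generic points\<close>

context meshed_domain
begin

abbreviation "faces \<equiv> interior_faces T \<union> boundary_faces T (frontier D)"

lemma interior_faceE:
  assumes "e \<in> interior_faces T"
  obtains K K' where "K \<in> T" "K' \<in> T" "K \<noteq> K'" "e = frontier K \<inter> frontier K'" "emeasure surface_measure e > 0"
  using assms by (auto simp: interior_faces_def)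

lemma boundary_faceE:
  assumes "e \<in> boundary_faces T \<Gamma>"
  obtains F K where "K \<in> T" "F facet_of K" "e = F \<inter> \<Gamma>" "emeasure surface_measure e > 0"
  using assms by (auto simp: boundary_faces_def)

lemma facet_closed: "K \<in> T \<Longrightarrow> F facet_of K \<Longrightarrow> closed F"
  by (meson facet_of_imp_face_of face_of_polytope_polytope polytope_T polytope_imp_closed)

lemma face_element: "e \<in> faces \<Longrightarrow> \<exists>K\<in>T. e \<subseteq> frontier K"
proof -
  assume "e \<in> faces"
  then consider "e \<in> interior_faces T" | "e \<in> boundary_faces T (frontier D)" by blast
  then show ?thesis
  proof cases
    case 1
    then show ?thesis by (elim interior_faceE) blast
  next
    case 2
    then obtain F K where K: "K \<in> T" "F facet_of K" "e = F \<inter> frontier D" by (elim boundary_faceE) blast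
    then have "F \<subseteq> frontier K" using frontier_polytope[OF polytope_T[OF K(1)] interior_T[OF K(1)]] by blast
    then show ?thesis using K by blast
  qed
qed

lemma face_borel: "e \<in> faces \<Longrightarrow> e \<in> sets borel"
proof (rule borel_closed)
  assume "e \<in> faces"
  then show "closed e"
    by (auto elim!: interior_faceE boundary_faceE intro!: closed_Int frontier_closed intro: facet_closed)
qed

lemma face_pos: "e \<in> faces \<Longrightarrow> emeasure surface_measure e > 0"
  by (auto elim!: interior_faceE boundary_faceE)

lemma face_finite_measure: "e \<in> faces \<Longrightarrow> emeasure surface_measure e < \<infinity>"
  and face_bounded: "e \<in> faces \<Longrightarrow> bounded e"
proof -
  assume e: "e \<in> faces"
  obtain K where K: "K \<in> T" "e \<subseteq> frontier K" using face_element[OF e] by blast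
  show "bounded e" using K polytope_imp_bounded[OF polytope_T[OF K(1)]] frontier_subset_T[OF K(1)] bounded_subset by blast
  then show "emeasure surface_measure e < \<infinity>"
    using K frontier_T[OF K(1)] by (intro emeasure_surface_bounded[OF finite_\<H> hyp_\<H> face_borel[OF e]]) blast+
qed

lemma finite_faces: "finite (interior_faces T)" "finite (boundary_faces T \<Gamma>)"
proof -
  have "interior_faces T \<subseteq> (\<lambda>(K, K'). frontier K \<inter> frontier K') ` (T \<times> T)"
    by (auto simp: interior_faces_def)
  then show "finite (interior_faces T)" using finite_T finite_subset by blast
  have "boundary_faces T \<Gamma> \<subseteq> (\<lambda>F. F \<inter> \<Gamma>) ` (\<Union>K\<in>T. {F. F facet_of K})"
    by (auto simp: boundary_faces_def)
  moreover have "finite (\<Union>K\<in>T. {F. F facet_of K})"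
    using finite_T polytope_T finite_polytope_facets by blast
  ultimately show "finite (boundary_faces T \<Gamma>)" using finite_subset by blast
qed

lemma \<Gamma>\<^sub>R_finite_measure: "emeasure surface_measure (frontier \<Omega>\<^sub>1) < \<infinity>"
proof (rule emeasure_surface_bounded[OF finite_\<H> hyp_\<H> _ _ frontier_\<Omega>\<^sub>1])
  show "bounded (frontier \<Omega>\<^sub>1)"
    using bounded_closure[OF bounded_\<Omega>\<^sub>1] bounded_subset unfolding frontier_def by blast
qed (rule borel_closed[OF frontier_closed])

lemma generic_in:
  assumes "A \<in> sets borel" "emeasure surface_measure A > 0"
  shows "\<exists>x\<in>A. generic x"
proof (rule ccontr)
  assume "\<not> (\<exists>x\<in>A. generic x)"
  then have "AE x in surface_measure. x \<notin> A" using AE_generic by auto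
  then have "A \<in> null_sets surface_measure" using assms(1) by (subst AE_iff_null_sets) auto
  then show False using assms(2) by auto
qed

lemma hyperplane_piece_pos:
  assumes e: "element_at K n b x r" and sub: "ball x r \<inter> {y. n \<bullet> y = b} \<subseteq> A" and A: "A \<in> sets borel"
  shows "emeasure surface_measure A > 0"
proof -
  note e' = element_atD[OF e]
  have "emeasure surface_measure (ball x r \<inter> {y. n \<bullet> y = b}) \<le> emeasure surface_measure A"
    using sub A by (intro emeasure_mono) auto
  then show ?thesis using emeasure_surface_ball[OF e'(2,8,7)] by (rule order_less_le_trans[rotated])
qed

lemma plus_minus_elem_pair:
  assumes "{K''\<in>T. e \<subseteq> frontier K''} = {K, K'}" "lab K' < lab K"
  shows "plus_elem T lab e = K" "minus_elem T lab e = K'"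
proof -
  have m: "K'' \<in> T \<and> e \<subseteq> frontier K'' \<longleftrightarrow> K'' = K \<or> K'' = K'" for K'' using assms(1) by blast
  show "plus_elem T lab e = K" unfolding plus_elem_def
  proof (rule the_equality)
    show "K \<in> T \<and> e \<subseteq> frontier K \<and> (\<forall>K'\<in>T. e \<subseteq> frontier K' \<longrightarrow> lab K' \<le> lab K)"
      using m assms(2) by (metis less_imp_le order_refl)
    fix L assume "L \<in> T \<and> e \<subseteq> frontier L \<and> (\<forall>K'\<in>T. e \<subseteq> frontier K' \<longrightarrow> lab K' \<le> lab L)"
    then show "L = K" using m assms(2) by (metis leD)
  qed
  show "minus_elem T lab e = K'" unfolding minus_elem_def
  proof (rule the_equality)
    show "K' \<in> T \<and> e \<subseteq> frontier K' \<and> (\<forall>K\<in>T. e \<subseteq> frontier K \<longrightarrow> lab K' \<le> lab K)"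
      using m assms(2) by (metis less_imp_le order_refl)
    fix L assume "L \<in> T \<and> e \<subseteq> frontier L \<and> (\<forall>K\<in>T. e \<subseteq> frontier K \<longrightarrow> lab L \<le> lab K)"
    then show "L = K'" using m assms(2) by (metis leD)
  qed
qed

lemma plus_elem_single:
  assumes "{K''\<in>T. e \<subseteq> frontier K''} = {K}"
  shows "plus_elem T lab e = K"
proof -
  have m: "K'' \<in> T \<and> e \<subseteq> frontier K'' \<longleftrightarrow> K'' = K" for K'' using assms by blast
  show ?thesis unfolding plus_elem_def
  proof (rule the_equality)
    show "K \<in> T \<and> e \<subseteq> frontier K \<and> (\<forall>K'\<in>T. e \<subseteq> frontier K' \<longrightarrow> lab K' \<le> lab K)"
      using m by (metis order_refl)
  qed (use m in blast)
qed

text \<open>Only two elements contain \<open>x\<close>, so \<open>x\<close> determines the face on which it lies, hanging nodes or not.\<close>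

lemma interior_point_face:
  assumes e: "element_at K n b x r" "element_at K' (- n) (- b) x r" and ne: "K' \<noteq> K"
  defines "e0 \<equiv> frontier K \<inter> frontier K'"
  shows "e0 \<in> interior_faces T" "ball x r \<inter> {y. n \<bullet> y = b} \<subseteq> e0"
    "\<And>e. e \<in> faces \<Longrightarrow> x \<in> e \<longleftrightarrow> e = e0" "{K''\<in>T. x \<in> frontier K''} = {K, K'}"
    "{K''\<in>T. e0 \<subseteq> frontier K''} = {K, K'}"
proof -
  note e1 = element_atD[OF e(1)] and e2 = element_atD[OF e(2)]
  have x: "x \<in> ball x r" using e1 by simp
  show sub: "ball x r \<inter> {y. n \<bullet> y = b} \<subseteq> e0"
    using element_at_frontier[OF e(1)] element_at_frontier[OF e(2)] unfolding e0_def by auto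
  then have xe0: "x \<in> e0" using x e1 by auto
  have "e0 \<in> sets borel" unfolding e0_def by (intro sets.Int borel_closed frontier_closed)
  from hyperplane_piece_pos[OF e(1) sub this]
  show e0: "e0 \<in> interior_faces T"
    unfolding interior_faces_def e0_def using e1(1) e2(1) ne by blast
  have two: "K'' = K \<or> K'' = K'" if "K'' \<in> T" "x \<in> frontier K''" for K''
    using elements_at_interior[OF e x that(1)] that frontier_subset_T[OF that(1)] by blast
  then show fr: "{K''\<in>T. x \<in> frontier K''} = {K, K'}" using xe0 e1(1) e2(1) unfolding e0_def by blast
  then show "{K''\<in>T. e0 \<subseteq> frontier K''} = {K, K'}" using xe0 e1(1) e2(1) unfolding e0_def by blast
  fix e assume "e \<in> faces"
  then consider "e \<in> interior_faces T" | "e \<in> boundary_faces T (frontier D)" by blast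
  then show "x \<in> e \<longleftrightarrow> e = e0"
  proof cases
    case 1
    then obtain K1 K2 where K12: "K1 \<in> T" "K2 \<in> T" "K1 \<noteq> K2" "e = frontier K1 \<inter> frontier K2" by (elim interior_faceE)
    show ?thesis
    proof
      assume "x \<in> e"
      then have "K1 = K \<or> K1 = K'" "K2 = K \<or> K2 = K'" using two K12 by auto
      then show "e = e0" using K12 unfolding e0_def by blast
    qed (use xe0 in simp)
  next
    case 2
    have "x \<notin> frontier D"
    proof
      assume "x \<in> frontier D"
      then have "ball x r \<inter> D \<noteq> {}"
        using x open_Int_closure_eq_empty[OF open_ball, of x r D] unfolding frontier_def by blast
      moreover have "ball x r \<subseteq> K \<union> K'"
        using e1(5) e2(5) interior_subset[of K] interior_subset[of K']
        by (intro ball_subset_of_half_balls[OF e1(2), where b = b] closed_Un closed_T e1(1) e2(1)) auto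
      ultimately show False using D_disjoint e1(1) e2(1) by blast
    qed
    moreover have "e \<subseteq> frontier D" using 2 by (elim boundary_faceE) blast
    ultimately show ?thesis using xe0 by blast
  qed
qed

lemma single_element_faces:
  assumes single: "{K''\<in>T. x \<in> frontier K''} \<subseteq> {K}" and e: "e \<in> interior_faces T"
  shows "x \<notin> e"
  using e by (elim interior_faceE) (use single in blast)

text \<open>A facet through \<open>x\<close> spans a hyperplane of the arrangement that contains \<open>x\<close>, and there is only one such
hyperplane; so \<open>K\<close> has only one facet through \<open>x\<close>.\<close>

lemma inner_point_face:
  assumes e: "element_at K n b x r" and D: "half_ball (- n) (- b) x r \<subseteq> D"
  obtains e0 where "e0 \<in> boundary_faces T (frontier D)" "e0 \<notin> interior_faces T" "ball x r \<inter> {y. n \<bullet> y = b} \<subseteq> e0"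
    "\<And>e. e \<in> faces \<Longrightarrow> x \<in> e \<longleftrightarrow> e = e0" "{K''\<in>T. x \<in> frontier K''} = {K}"
    "plus_elem T lab e0 = K"
proof -
  note e' = element_atD[OF e]
  have x: "x \<in> ball x r" using e' by simp
  note ip = inner_point[OF e D]
  have xf: "x \<in> frontier K" by (rule element_at_frontier[OF e x e'(8)])
  have one: "K'' = K" if "K'' \<in> T" "x \<in> frontier K''" for K''
    using elements_at_boundary[OF e ip(1)[OF x e'(8)] x that(1)] that frontier_subset_T[OF that(1)] by blast
  then have fr: "{K''\<in>T. x \<in> frontier K''} = {K}" using xf e'(1) by blast
  have hullH: "F' = K \<inter> {y. n \<bullet> y = b}" if F': "F' facet_of K" "x \<in> F'" for F'
  proof -
    have "affine hull F' \<in> \<H>" using hulls[OF e'(1)] F'(1) by (auto simp: facet_hulls_def)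
    moreover have "x \<in> affine hull F'" using F'(2) by (simp add: hull_inc)
    ultimately have "affine hull F' = {y. n \<bullet> y = b}" using e'(4) x unfolding generic_at_def by blast
    then show ?thesis using facet_hull_hyperplane(2)[OF polytope_T[OF e'(1)] interior_T[OF e'(1)] F'(1)] by simp
  qed
  obtain F where F: "F facet_of K" "x \<in> F"
    using xf frontier_polytope[OF polytope_T[OF e'(1)] interior_T[OF e'(1)]] by auto
  note Feq = hullH[OF F]
  define e0 where "e0 = F \<inter> frontier D"
  have sub: "ball x r \<inter> {y. n \<bullet> y = b} \<subseteq> e0"
  proof
    fix y assume "y \<in> ball x r \<inter> {y. n \<bullet> y = b}"
    then have y: "y \<in> ball x r" "n \<bullet> y = b" by auto
    show "y \<in> e0" unfolding e0_def Feq
      using element_at_frontier[OF e y] frontier_subset_T[OF e'(1)] ip(2)[OF y] y(2) by auto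
  qed
  then have xe0: "x \<in> e0" using x e' by auto
  have "e0 \<in> sets borel" unfolding e0_def
    by (intro sets.Int borel_closed frontier_closed facet_closed[OF e'(1) F(1)])
  from hyperplane_piece_pos[OF e sub this]
  have e0: "e0 \<in> boundary_faces T (frontier D)"
    unfolding boundary_faces_def e0_def using e'(1) F(1) by blast
  have noint: "x \<notin> e" if "e \<in> interior_faces T" for e
    using single_element_faces[OF _ that] fr by blast
  show thesis
  proof (rule that[OF e0 _ sub _ fr])
    show "e0 \<notin> interior_faces T" using noint xe0 by blast
    fix e assume "e \<in> faces"
    then consider "e \<in> interior_faces T" | "e \<in> boundary_faces T (frontier D)" by blast
    then show "x \<in> e \<longleftrightarrow> e = e0"
    proof cases
      case 1
      then show ?thesis using noint e0 xe0 by blast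
    next
      case 2
      then obtain F' K'' where F': "K'' \<in> T" "F' facet_of K''" "e = F' \<inter> frontier D" by (elim boundary_faceE)
      show ?thesis
      proof
        assume xe: "x \<in> e"
        have "F' \<subseteq> frontier K''" using frontier_polytope[OF polytope_T[OF F'(1)] interior_T[OF F'(1)]] F'(2) by blast
        then have "K'' = K" using one[OF F'(1)] xe F'(3) by blast
        then have "F' = F" using hullH[of F'] Feq F' xe by blast
        then show "e = e0" using F'(3) by (simp add: e0_def)
      qed (use xe0 in simp)
    qed
  next
    have "e0 \<subseteq> frontier K"
      using frontier_polytope[OF polytope_T[OF e'(1)] interior_T[OF e'(1)]] F(1) unfolding e0_def by blast
    then have "{K''\<in>T. e0 \<subseteq> frontier K''} = {K}" using fr xe0 e'(1) by blast
    then show "plus_elem T lab e0 = K" by (rule plus_elem_single)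
  qed
qed

lemma outer_point_no_face:
  assumes e: "element_at K n b x r" and O: "half_ball (- n) (- b) x r \<inter> \<Omega>\<^sub>1 = {}"
    and noT: "half_ball (- n) (- b) x r \<inter> \<Union>T = {}"
  shows "\<And>e. e \<in> faces \<Longrightarrow> x \<notin> e" "{K''\<in>T. x \<in> frontier K''} = {K}"
proof -
  note e' = element_atD[OF e]
  have x: "x \<in> ball x r" using e' by simp
  have xf: "x \<in> frontier K" by (rule element_at_frontier[OF e x e'(8)])
  have one: "K'' = K" if "K'' \<in> T" "x \<in> frontier K''" for K''
    using elements_at_boundary[OF e noT x that(1)] that frontier_subset_T[OF that(1)] by blast
  then show fr: "{K''\<in>T. x \<in> frontier K''} = {K}" using xf e'(1) by blast
  fix e0 assume "e0 \<in> faces"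
  then show "x \<notin> e0"
    using single_element_faces[of x K e0] fr outer_point(2)[OF e O] by (auto elim: boundary_faceE)
qed

text \<open>A face has positive measure and hence contains a generic point, where its neighbours can be read off.
Distinct labels make the descriptions in \<open>plus_elem\<close> and \<open>minus_elem\<close> proper.\<close>

lemma interior_face_elements:
  assumes e: "e \<in> interior_faces T"
  obtains K K' where "K \<in> T" "K' \<in> T" "plus_elem T lab e = K" "minus_elem T lab e = K'"
proof -
  have ef: "e \<in> faces" using e by simp
  obtain x where x: "x \<in> e" "generic x" using generic_in[OF face_borel[OF ef] face_pos[OF ef]] by blast
  obtain K1 where K1: "K1 \<in> T" "e \<subseteq> frontier K1" using face_element[OF ef] by blast
  have xf: "x \<in> frontier K1" using x K1 by blast
  from K1(1) xf x(2) show thesis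
  proof (cases rule: frontier_point_cases)
    case (interior n b r K')
    note f = interior_point_face[OF interior]
    have ee: "e = frontier K1 \<inter> frontier K'" using f(3)[OF ef] x by simp
    have KT: "K' \<in> T" by (rule element_atD(1)[OF interior(2)])
    have "lab K' \<noteq> lab K1" using inj_lab KT K1(1) interior(3) by (auto simp: inj_on_def)
    then consider "lab K' < lab K1" | "lab K1 < lab K'" by linarith
    then show thesis
    proof cases
      case 1
      from plus_minus_elem_pair[OF f(5) 1] show ?thesis unfolding ee[symmetric] by (rule that[OF K1(1) KT])
    next
      case 2
      have "{K''\<in>T. e \<subseteq> frontier K''} = {K', K1}" using f(5) ee by auto
      from plus_minus_elem_pair[OF this 2] show ?thesis by (rule that[OF KT K1(1)])
    qed
  next
    case (inner n b r)
    show ?thesis by (rule inner_point_face[OF inner(1,2)]) (use e ef x in blast)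
  next
    case (outer n b r)
    then show ?thesis using outer_point_no_face(1)[OF outer ef] x by blast
  qed
qed

lemma plus_elem_in_T: "e \<in> faces \<Longrightarrow> plus_elem T lab e \<in> T"
proof -
  assume ef: "e \<in> faces"
  show ?thesis
  proof (cases "e \<in> interior_faces T")
    case True
    then show ?thesis by (elim interior_face_elements) simp
  next
    case False
    obtain x where x: "x \<in> e" "generic x" using generic_in[OF face_borel[OF ef] face_pos[OF ef]] by blast
    obtain K1 where K1: "K1 \<in> T" "e \<subseteq> frontier K1" using face_element[OF ef] by blast
    have xf: "x \<in> frontier K1" using x K1 by blast
    from K1(1) xf x(2) show ?thesis
    proof (cases rule: frontier_point_cases)
      case (interior n b r K')
      then show ?thesis using interior_point_face(1,3)[OF interior] ef x False by blast
    next
      case (inner n b r)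
      show ?thesis
      proof (rule inner_point_face[OF inner(1,2)])
        fix e0 assume "\<And>e. e \<in> faces \<Longrightarrow> (x \<in> e) = (e = e0)" "plus_elem T lab e0 = K1"
        then show ?thesis using ef x K1(1) by blast
      qed
    next
      case (outer n b r)
      then show ?thesis using outer_point_no_face(1)[OF outer ef] x by blast
    qed
  qed
qed

lemma minus_elem_in_T: "e \<in> interior_faces T \<Longrightarrow> minus_elem T lab e \<in> T"
  by (elim interior_face_elements) simp

text \<open>In dimension at least 2 a disc has two distinct points.  So the penalty weights, which divide by the
diameter, have the sign of their parameters.\<close>

lemma face_diameter_pos: "e \<in> faces \<Longrightarrow> diameter e > 0"
proof -
  assume ef: "e \<in> faces"
  obtain x where x: "x \<in> e" "generic x" using generic_in[OF face_borel[OF ef] face_pos[OF ef]] by blast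
  obtain K1 where K1: "K1 \<in> T" "e \<subseteq> frontier K1" using face_element[OF ef] by blast
  have xf: "x \<in> frontier K1" using x K1 by blast
  have "\<exists>n b r. norm n = 1 \<and> r > 0 \<and> n \<bullet> x = b \<and> ball x r \<inter> {y. n \<bullet> y = b} \<subseteq> e"
    using K1(1) xf x(2)
  proof (cases rule: frontier_point_cases)
    case (interior n b r K')
    note f = interior_point_face[OF interior]
    have "e = frontier K1 \<inter> frontier K'" using f(3)[OF ef] x by simp
    then show ?thesis using f(2) element_atD(2,7,8)[OF interior(1)] by blast
  next
    case (inner n b r)
    show ?thesis
    proof (rule inner_point_face[OF inner(1,2)])
      fix e0 assume "\<And>e. e \<in> faces \<Longrightarrow> (x \<in> e) = (e = e0)" "ball x r \<inter> {y. n \<bullet> y = b} \<subseteq> e0"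
      then show ?thesis using ef x element_atD(2,7,8)[OF inner(1)] by blast
    qed
  next
    case (outer n b r)
    then show ?thesis using outer_point_no_face(1)[OF outer ef] x by blast
  qed
  then obtain n b r where nb: "norm n = 1" "r > 0" "n \<bullet> x = b" "ball x r \<inter> {y. n \<bullet> y = b} \<subseteq> e" by blast
  have "2 \<le> DIM(real^'n)" using dim2 by simp
  then obtain m :: "real^'n" where m: "m \<noteq> 0" "orthogonal n m" using orthogonal_to_vector_exists by blast
  define y where "y = x + (r / (2 * norm m)) *\<^sub>R m"
  have "dist x y = r / 2" using m nb by (simp add: y_def dist_norm)
  moreover have "n \<bullet> y = b" using m nb by (simp add: y_def inner_add_right orthogonal_def)
  ultimately have "y \<in> e" using nb by (intro set_mp[OF nb(4)]) auto
  then have "dist x y \<le> diameter e" using diameter_bounded_bound[OF face_bounded[OF ef] x(1)] by blast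
  then show ?thesis using \<open>dist x y = r / 2\<close> nb(2) by linarith
qed

end

section \<open>Hermitian and positive forms on the broken polynomial space\<close>

text \<open>Restricted to \<open>T\<close>, since the functions in \<open>dg_space T p\<close> are \<open>undefined\<close> off \<open>T\<close>.\<close>

definition lincomb :: "(real^'n) set set \<Rightarrow> complex \<Rightarrow> 'n broken \<Rightarrow> 'n broken \<Rightarrow> 'n broken" where
  "lincomb T c u w = (\<lambda>K\<in>T. \<lambda>x. u K x + c * w K x)"

lemma lincomb_closed: "u \<in> dg_space T p \<Longrightarrow> w \<in> dg_space T p \<Longrightarrow> lincomb T c u w \<in> dg_space T p"
  by (auto simp: lincomb_def dg_space_def intro!: poly_space_lincomb)

lemma dg_space_poly: "u \<in> dg_space T p \<Longrightarrow> K \<in> T \<Longrightarrow> u K \<in> poly_space p"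
  by (auto simp: dg_space_def)

lemma lincomb_apply: "K \<in> T \<Longrightarrow> lincomb T c u w K = (\<lambda>x. u K x + c * w K x)"
  by (simp add: lincomb_def)

text \<open>The operators in the forms: traces, jumps, averages and derivatives.  Local boundedness and Borel
measurability guarantee that their products are integrable over the faces and over \<open>\<Omega>\<close>, so that the
integrals are linear in them.\<close>

definition linear_op :: "(real^'n) set set \<Rightarrow> nat \<Rightarrow> ('n broken \<Rightarrow> real^'n \<Rightarrow> complex) \<Rightarrow> bool" where
  "linear_op T p L \<longleftrightarrow>
     (\<forall>u\<in>dg_space T p. L u \<in> borel_measurable borel \<and> (\<forall>S. compact S \<longrightarrow> (\<exists>C. \<forall>x\<in>S. cmod (L u x) \<le> C))) \<and>
     (\<forall>u\<in>dg_space T p. \<forall>w\<in>dg_space T p. \<forall>c x. L (lincomb T c u w) x = L u x + c * L w x)"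

lemma linear_op_combine:
  assumes "linear_op T p L" "linear_op T p L'"
  shows "linear_op T p (\<lambda>u x. a * L u x + b * L' u x)"
  unfolding linear_op_def
proof (intro conjI ballI allI impI)
  fix u assume u: "u \<in> dg_space T p"
  have [measurable]: "L u \<in> borel_measurable borel" "L' u \<in> borel_measurable borel"
    using assms u by (auto simp: linear_op_def)
  show "(\<lambda>x. a * L u x + b * L' u x) \<in> borel_measurable borel" by measurable
  fix S :: "(real^'a) set" assume "compact S"
  then obtain C C' where C: "\<forall>x\<in>S. cmod (L u x) \<le> C" "\<forall>x\<in>S. cmod (L' u x) \<le> C'"
    using assms u unfolding linear_op_def by meson
  show "\<exists>C. \<forall>x\<in>S. cmod (a * L u x + b * L' u x) \<le> C"
  proof (intro exI ballI)
    fix x assume "x \<in> S"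
    then show "cmod (a * L u x + b * L' u x) \<le> cmod a * C + cmod b * C'"
      using C by (intro norm_triangle_mono) (auto simp: norm_mult intro: mult_left_mono)
  qed
next
  fix u w c x assume "u \<in> dg_space T p" "w \<in> dg_space T p"
  then show "a * L (lincomb T c u w) x + b * L' (lincomb T c u w) x =
      a * L u x + b * L' u x + c * (a * L w x + b * L' w x)"
    using assms by (simp add: linear_op_def algebra_simps)
qed

definition hermitian_form :: "(real^'n) set set \<Rightarrow> nat \<Rightarrow> ('n broken \<Rightarrow> 'n broken \<Rightarrow> complex) \<Rightarrow> bool" where
  "hermitian_form T p A \<longleftrightarrow>
     (\<forall>u\<in>dg_space T p. \<forall>w\<in>dg_space T p. \<forall>v\<in>dg_space T p. \<forall>c. A (lincomb T c u w) v = A u v + c * A w v) \<and>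
     (\<forall>u\<in>dg_space T p. \<forall>v\<in>dg_space T p. A v u = cnj (A u v))"

text \<open>The last condition, a consequence of the Cauchy-Schwarz inequality, allows passing from \<open>P(u,u) = 0\<close> to
\<open>P(u,v) = 0\<close>.\<close>

definition positive_form :: "(real^'n) set set \<Rightarrow> nat \<Rightarrow> ('n broken \<Rightarrow> 'n broken \<Rightarrow> complex) \<Rightarrow> bool" where
  "positive_form T p A \<longleftrightarrow> hermitian_form T p A \<and>
     (\<forall>u\<in>dg_space T p. Re (A u u) \<ge> 0 \<and> (Re (A u u) = 0 \<longrightarrow> (\<forall>v\<in>dg_space T p. A u v = 0)))"

lemma hermitian_formI:
  assumes "\<And>u w v c. u \<in> dg_space T p \<Longrightarrow> w \<in> dg_space T p \<Longrightarrow> v \<in> dg_space T p \<Longrightarrow>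
      A (lincomb T c u w) v = A u v + c * A w v"
    and "\<And>u v. u \<in> dg_space T p \<Longrightarrow> v \<in> dg_space T p \<Longrightarrow> A v u = cnj (A u v)"
  shows "hermitian_form T p A"
  unfolding hermitian_form_def by (intro conjI ballI allI assms)

lemma hermitian_form_lincomb_left:
  "hermitian_form T p A \<Longrightarrow> u \<in> dg_space T p \<Longrightarrow> w \<in> dg_space T p \<Longrightarrow> v \<in> dg_space T p \<Longrightarrow>
    A (lincomb T c u w) v = A u v + c * A w v"
  unfolding hermitian_form_def by blast

lemma hermitian_form_cnj:
  "hermitian_form T p A \<Longrightarrow> u \<in> dg_space T p \<Longrightarrow> v \<in> dg_space T p \<Longrightarrow> A v u = cnj (A u v)"
  unfolding hermitian_form_def by blast

lemma hermitian_form_lincomb_right: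
  assumes A: "hermitian_form T p A" and u: "u \<in> dg_space T p" "w \<in> dg_space T p" "v \<in> dg_space T p"
  shows "A v (lincomb T c u w) = A v u + cnj c * A v w"
  by (simp add: hermitian_form_cnj[OF A lincomb_closed[OF u(1,2)] u(3)] hermitian_form_lincomb_left[OF A u]
      hermitian_form_cnj[OF A u(1,3)] hermitian_form_cnj[OF A u(2,3)])

lemma hermitian_form_real: "hermitian_form T p A \<Longrightarrow> u \<in> dg_space T p \<Longrightarrow> Im (A u u) = 0"
  using hermitian_form_cnj[of T p A u u] by (metis cnj.simps(2) equal_neg_zero)

lemma hermitian_form_add:
  assumes A: "hermitian_form T p A" and B: "hermitian_form T p B"
  shows "hermitian_form T p (\<lambda>u v. A u v + B u v)"
proof (rule hermitian_formI)
  fix u v assume u: "u \<in> dg_space T p" "v \<in> dg_space T p"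
  show "A v u + B v u = cnj (A u v + B u v)"
    by (simp add: hermitian_form_cnj[OF A u] hermitian_form_cnj[OF B u])
qed (simp add: hermitian_form_lincomb_left[OF A] hermitian_form_lincomb_left[OF B] algebra_simps)

lemma hermitian_form_scale:
  assumes A: "hermitian_form T p A"
  shows "hermitian_form T p (\<lambda>u v. complex_of_real r * A u v)"
proof (rule hermitian_formI)
  fix u v assume u: "u \<in> dg_space T p" "v \<in> dg_space T p"
  show "complex_of_real r * A v u = cnj (complex_of_real r * A u v)"
    by (simp add: hermitian_form_cnj[OF A u])
qed (simp add: hermitian_form_lincomb_left[OF A] algebra_simps)

lemma hermitian_form_zero: "hermitian_form T p (\<lambda>u v. 0)"
  by (simp add: hermitian_form_def)

lemma hermitian_form_sum:
  "(\<And>i. i \<in> I \<Longrightarrow> hermitian_form T p (A i)) \<Longrightarrow> hermitian_form T p (\<lambda>u v. \<Sum>i\<in>I. A i u v)"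
  by (induction I rule: infinite_finite_induct) (simp_all add: hermitian_form_zero hermitian_form_add)

lemma positive_form_add:
  assumes A: "positive_form T p A" and B: "positive_form T p B"
  shows "positive_form T p (\<lambda>u v. A u v + B u v)"
  unfolding positive_form_def
proof (intro conjI ballI impI)
  show "hermitian_form T p (\<lambda>u v. A u v + B u v)"
    using A B hermitian_form_add unfolding positive_form_def by blast
  fix u assume u: "u \<in> dg_space T p"
  have pos: "Re (A u u) \<ge> 0" "Re (B u u) \<ge> 0" using A B u unfolding positive_form_def by blast+
  then show "0 \<le> Re (A u u + B u u)" by simp
  fix v assume v: "v \<in> dg_space T p" and "Re (A u u + B u u) = 0"
  then have "Re (A u u) = 0" "Re (B u u) = 0" using pos by auto
  then have "A u v = 0" "B u v = 0" using A B u v unfolding positive_form_def by blast+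
  then show "A u v + B u v = 0" by simp
qed

lemma positive_form_scale:
  assumes "positive_form T p A" "r \<ge> 0"
  shows "positive_form T p (\<lambda>u v. complex_of_real r * A u v)"
proof (cases "r = 0")
  case False
  have "hermitian_form T p (\<lambda>u v. complex_of_real r * A u v)"
    using assms(1) unfolding positive_form_def by (blast intro: hermitian_form_scale)
  moreover have "Re (A u u) \<ge> 0" "Re (A u u) = 0 \<Longrightarrow> v \<in> dg_space T p \<Longrightarrow> A u v = 0"
    if "u \<in> dg_space T p" for u v
    using assms(1) that unfolding positive_form_def by blast+
  ultimately show ?thesis using assms(2) False by (simp add: positive_form_def)
qed (simp add: positive_form_def hermitian_form_zero)

lemma positive_form_zero: "positive_form T p (\<lambda>u v. 0)"
  by (simp add: positive_form_def hermitian_form_zero)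

lemma positive_form_sum:
  "(\<And>i. i \<in> I \<Longrightarrow> positive_form T p (A i)) \<Longrightarrow> positive_form T p (\<lambda>u v. \<Sum>i\<in>I. A i u v)"
  by (induction I rule: infinite_finite_induct) (simp_all add: positive_form_zero positive_form_add)

text \<open>Covers integration over elements and \<open>\<Omega>\<close> with Lebesgue measure, and over faces and the outer boundary
with surface measure.\<close>

definition integration_domain :: "(real^'n) measure \<Rightarrow> (real^'n) set \<Rightarrow> bool" where
  "integration_domain M S \<longleftrightarrow> S \<in> sets borel \<and> bounded S \<and> sets borel \<subseteq> sets M \<and> space M = UNIV \<and> emeasure M S < \<infinity>"

lemma integration_domain_measurable: "integration_domain M S \<Longrightarrow> \<phi> \<in> borel_measurable borel \<Longrightarrow> \<phi> \<in> borel_measurable M"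
  unfolding integration_domain_def measurable_def by auto

lemma integration_domain_surface:
  "S \<in> sets borel \<Longrightarrow> bounded S \<Longrightarrow> emeasure surface_measure S < \<infinity> \<Longrightarrow> integration_domain surface_measure S"
  by (simp add: integration_domain_def)

lemma integration_domain_lebesgue:
  assumes "S \<in> sets borel" "bounded S" shows "integration_domain lebesgue S"
proof -
  have "emeasure lebesgue S < \<infinity>" using emeasure_bounded_finite[OF assms(2)] assms(1) by simp
  then show ?thesis using assms unfolding integration_domain_def by auto
qed

lemma linear_op_integrable:
  assumes d: "integration_domain M S" and L: "linear_op T p L" "linear_op T p L'" and u: "u \<in> dg_space T p" "v \<in> dg_space T p"
  shows "set_integrable M S (\<lambda>x. L u x * cnj (L' v x))"
proof -
  have [measurable]: "L u \<in> borel_measurable borel" "L' v \<in> borel_measurable borel"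
    using L u by (auto simp: linear_op_def)
  have [measurable]: "cnj \<in> borel_measurable borel"
    by (rule borel_measurable_continuous_onI[OF continuous_on_cnj[OF continuous_on_id]])
  have m: "(\<lambda>x. L u x * cnj (L' v x)) \<in> borel_measurable borel" by measurable
  have "compact (closure S)" using d by (simp add: integration_domain_def)
  then obtain C C' where C: "\<forall>x\<in>closure S. cmod (L u x) \<le> C" "\<forall>x\<in>closure S. cmod (L' v x) \<le> C'"
    using L u unfolding linear_op_def by meson
  show ?thesis unfolding set_integrable_def
  proof (rule integrableI_bounded_set_indicator)
    show "S \<in> sets M" "emeasure M S < \<infinity>" using d by (auto simp: integration_domain_def)
    show "(\<lambda>x. L u x * cnj (L' v x)) \<in> borel_measurable M" by (rule integration_domain_measurable[OF d m])
    have "cmod (L u x * cnj (L' v x)) \<le> C * C'" if "x \<in> S" for x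
    proof -
      have "x \<in> closure S" using that closure_subset[of S] by blast
      then have "cmod (L u x) \<le> C" "cmod (L' v x) \<le> C'" using C by auto
      moreover from this(1) have "0 \<le> C" using norm_ge_zero order_trans by blast
      ultimately show ?thesis unfolding norm_mult complex_mod_cnj by (intro mult_mono) auto
    qed
    then show "AE x in M. x \<in> S \<longrightarrow> cmod (L u x * cnj (L' v x)) \<le> C * C'" by simp
  qed
qed

lemma L2_inner_lincomb:
  assumes d: "integration_domain M S" and L: "linear_op T p L" "linear_op T p L'"
    and u: "u \<in> dg_space T p" "w \<in> dg_space T p" "v \<in> dg_space T p"
  shows "L2_inner M S (L (lincomb T c u w)) (L' v) = L2_inner M S (L u) (L' v) + c * L2_inner M S (L w) (L' v)"
proof -
  note i = linear_op_integrable[OF d L u(1,3)] linear_op_integrable[OF d L u(2,3)]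
  have "L2_inner M S (L (lincomb T c u w)) (L' v) =
      (LINT x:S|M. L u x * cnj (L' v x) + c * (L w x * cnj (L' v x)))"
    using L(1) u unfolding L2_inner_def linear_op_def by (simp add: algebra_simps)
  also have "\<dots> = L2_inner M S (L u) (L' v) + (LINT x:S|M. c * (L w x * cnj (L' v x)))"
    unfolding L2_inner_def using i by (intro set_integral_add(2)) auto
  finally show ?thesis unfolding L2_inner_def by simp
qed

lemma L2_inner_commute: "L2_inner M S v u = cnj (L2_inner M S u v)"
proof -
  have "cnj (LINT x|M. indicator S x *\<^sub>R (u x * cnj (v x))) = (LINT x|M. cnj (indicator S x *\<^sub>R (u x * cnj (v x))))"
    by (rule Bochner_Integration.integral_cnj[symmetric])
  then show ?thesis by (simp add: L2_inner_def set_lebesgue_integral_def mult.commute)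
qed

lemma L2_inner_self:
  assumes i: "set_integrable M S (\<lambda>x. u x * cnj (u x))"
  shows "Re (L2_inner M S u u) = (LINT x:S|M. (cmod (u x))\<^sup>2)" "Re (L2_inner M S u u) \<ge> 0"
    "Re (L2_inner M S u u) = 0 \<Longrightarrow> AE x in M. x \<in> S \<longrightarrow> u x = 0"
proof -
  have sq: "Re (u x * cnj (u x)) = (cmod (u x))\<^sup>2" for x
    by (simp add: complex_norm_square[symmetric] del: times_complex.simps of_real_power)
  show eq: "Re (L2_inner M S u u) = (LINT x:S|M. (cmod (u x))\<^sup>2)"
    unfolding L2_inner_def Re_set_integral[OF i] sq ..
  show "Re (L2_inner M S u u) \<ge> 0"
    unfolding eq set_lebesgue_integral_def by (intro Bochner_Integration.integral_nonneg) auto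
  assume "Re (L2_inner M S u u) = 0"
  then have z: "(LINT x|M. indicator S x *\<^sub>R (cmod (u x))\<^sup>2) = 0" unfolding eq set_lebesgue_integral_def .
  have "integrable M (\<lambda>x. Re (indicator S x *\<^sub>R (u x * cnj (u x))))"
    using i unfolding set_integrable_def by (rule integrable_Re)
  then have "integrable M (\<lambda>x. indicator S x *\<^sub>R (cmod (u x))\<^sup>2)" by (simp only: scaleR_complex.sel(1) sq real_scaleR_def)
  then have "AE x in M. indicator S x *\<^sub>R (cmod (u x))\<^sup>2 = 0"
    using z by (subst (asm) integral_nonneg_eq_0_iff_AE) auto
  then show "AE x in M. x \<in> S \<longrightarrow> u x = 0" by eventually_elim auto
qed

lemma L2_inner_AE_zero:
  assumes "AE x in M. x \<in> S \<longrightarrow> u x = 0 \<or> v x = 0"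
  shows "L2_inner M S u v = 0"
proof -
  have "AE x in M. indicator S x *\<^sub>R (u x * cnj (v x)) = 0" using assms by eventually_elim (auto split: split_indicator)
  then show ?thesis unfolding L2_inner_def set_lebesgue_integral_def by (rule integral_eq_zero_AE)
qed

text \<open>If the integral of \<open>|L u|\<^sup>2\<close> vanishes, then \<open>L u\<close> vanishes almost everywhere.\<close>

lemma positive_form_L2:
  assumes d: "integration_domain M S" and L: "linear_op T p L"
  shows "positive_form T p (\<lambda>u v. L2_inner M S (L u) (L v))"
  unfolding positive_form_def hermitian_form_def
proof (intro conjI ballI allI impI)
  fix u v assume u: "u \<in> dg_space T p" and v: "v \<in> dg_space T p"
  note i = L2_inner_self[OF linear_op_integrable[OF d L L u u]]
  show "L2_inner M S (L v) (L u) = cnj (L2_inner M S (L u) (L v))" by (rule L2_inner_commute)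
  show "0 \<le> Re (L2_inner M S (L u) (L u))" by (rule i(2))
  assume "Re (L2_inner M S (L u) (L u)) = 0"
  then have "AE x in M. x \<in> S \<longrightarrow> L u x = 0" by (rule i(3))
  then show "L2_inner M S (L u) (L v) = 0" by (intro L2_inner_AE_zero) auto
qed (rule L2_inner_lincomb[OF d L L])

lemma hermitian_form_L2_pair:
  assumes d: "integration_domain M S" and L: "linear_op T p L" "linear_op T p L'"
  shows "hermitian_form T p (\<lambda>u v. L2_inner M S (L u) (L' v) + L2_inner M S (L' u) (L v))"
  unfolding hermitian_form_def
proof (intro conjI ballI allI)
  fix u w v c assume "u \<in> dg_space T p" "w \<in> dg_space T p" "v \<in> dg_space T p"
  then show "L2_inner M S (L (lincomb T c u w)) (L' v) + L2_inner M S (L' (lincomb T c u w)) (L v) =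
      L2_inner M S (L u) (L' v) + L2_inner M S (L' u) (L v) +
      c * (L2_inner M S (L w) (L' v) + L2_inner M S (L' w) (L v))"
    using L2_inner_lincomb[OF d L] L2_inner_lincomb[OF d L(2,1)] by (simp add: algebra_simps)
next
  fix u v assume "u \<in> dg_space T p" "v \<in> dg_space T p"
  show "L2_inner M S (L v) (L' u) + L2_inner M S (L' v) (L u) =
      cnj (L2_inner M S (L u) (L' v) + L2_inner M S (L' u) (L v))"
    unfolding complex_cnj_add L2_inner_commute[symmetric] by (rule add.commute)
qed

lemma linear_op_element: "K \<in> T \<Longrightarrow> linear_op T p (\<lambda>u. u K)"
  unfolding linear_op_def
proof (intro conjI ballI allI impI)
  fix u S assume K: "K \<in> T" and u: "u \<in> dg_space T p"
  note P = dg_space_poly[OF u K]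
  show "u K \<in> borel_measurable borel" by (rule poly_measurable[OF P])
  assume "compact (S :: (real^'a) set)"
  from compact_imp_bounded[OF compact_continuous_image[OF poly_continuous[OF P] this]]
  show "\<exists>C. \<forall>x\<in>S. cmod (u K x) \<le> C" unfolding bounded_iff by blast
qed (simp add: lincomb_apply)

lemma linear_op_iter_deriv:
  assumes K: "K \<in> T" and \<nu>: "\<nu> \<in> borel_measurable borel" "\<And>x. norm (\<nu> x) \<le> B"
  shows "linear_op T p (\<lambda>u x. (dir_deriv (\<nu> x) ^^ j) (u K) x)"
  unfolding linear_op_def
proof (intro conjI ballI allI impI)
  fix u assume u: "u \<in> dg_space T p"
  note m = iter_deriv_measurable[OF dg_space_poly[OF u K] \<nu>, of j]
  show "(\<lambda>x. (dir_deriv (\<nu> x) ^^ j) (u K) x) \<in> borel_measurable borel" using m by blast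
  fix S :: "(real^'a) set" assume "compact S"
  then show "\<exists>C. \<forall>x\<in>S. cmod ((dir_deriv (\<nu> x) ^^ j) (u K) x) \<le> C" using m by blast
next
  fix u w c x assume "u \<in> dg_space T p" "w \<in> dg_space T p"
  then show "(dir_deriv (\<nu> x) ^^ j) (lincomb T c u w K) x = (dir_deriv (\<nu> x) ^^ j) (u K) x + c * (dir_deriv (\<nu> x) ^^ j) (w K) x"
    using iter_deriv_lincomb(1)[OF dg_space_poly[OF _ K] dg_space_poly[OF _ K]] by (simp add: lincomb_apply[OF K])
qed

context meshed_domain
begin

lemma linear_op_jump:
  assumes e: "e \<in> faces" and W: "\<And>K. K \<in> T \<Longrightarrow> linear_op T p (\<lambda>u. W u K)"
  shows "linear_op T p (\<lambda>u. jump T lab e (W u))"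
proof (cases "e \<in> interior_faces T")
  case True
  have "linear_op T p (\<lambda>u x. 1 * W u (plus_elem T lab e) x + (-1) * W u (minus_elem T lab e) x)"
    by (intro linear_op_combine W plus_elem_in_T[OF e] minus_elem_in_T[OF True])
  then show ?thesis using True by (simp add: jump_def[abs_def])
next
  case False
  then have "(\<lambda>u. jump T lab e (W u)) = (\<lambda>u. W u (plus_elem T lab e))" by (simp add: jump_def[abs_def])
  then show ?thesis using W[OF plus_elem_in_T[OF e]] by simp
qed

lemma linear_op_average:
  assumes e: "e \<in> faces" and W: "\<And>K. K \<in> T \<Longrightarrow> linear_op T p (\<lambda>u. W u K)"
  shows "linear_op T p (\<lambda>u. average T lab e (W u))"
proof (cases "e \<in> interior_faces T")
  case True
  have "linear_op T p (\<lambda>u x. (1/2) * W u (plus_elem T lab e) x + (1/2) * W u (minus_elem T lab e) x)"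
    by (intro linear_op_combine W plus_elem_in_T[OF e] minus_elem_in_T[OF True])
  then show ?thesis using True by (simp add: average_def[abs_def] add_divide_distrib)
next
  case False
  then have "(\<lambda>u. average T lab e (W u)) = (\<lambda>u. W u (plus_elem T lab e))" by (simp add: average_def[abs_def])
  then show ?thesis using W[OF plus_elem_in_T[OF e]] by simp
qed

lemma linear_op_normal_deriv:
  assumes e: "e \<in> faces" and K: "K \<in> T"
  shows "linear_op T p (\<lambda>u. normal_deriv \<Omega> T lab e j u K)"
proof -
  have "face_normal \<Omega> T lab e = (if e \<in> interior_faces T then outward_normal (plus_elem T lab e) else outward_normal \<Omega>)"
    by (auto simp: face_normal_def fun_eq_iff)
  then have "face_normal \<Omega> T lab e \<in> borel_measurable borel"
    using outward_normal_measurable[OF conic_\<Omega>]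
      outward_normal_measurable[OF locally_conic_polytope[OF polytope_T[OF plus_elem_in_T[OF e]]]] by simp
  moreover have "norm (face_normal \<Omega> T lab e x) \<le> max 1 (norm (THE \<nu>::real^'n. False))" for x
    unfolding face_normal_def using outward_normal_bounded by auto
  ultimately have "linear_op T p (\<lambda>u x. (dir_deriv (face_normal \<Omega> T lab e x) ^^ j) (u K) x)"
    by (rule linear_op_iter_deriv[OF K])
  then show ?thesis by (simp add: normal_deriv_def[abs_def])
qed

lemma linear_op_tang_deriv:
  assumes K: "K \<in> T"
  shows "linear_op T p (\<lambda>u. tang_deriv \<nu> u K)"
  using linear_op_iter_deriv[OF K, of "\<lambda>_. \<nu>" "norm \<nu>" p 1] by (simp add: tang_deriv_def[abs_def])

lemma linear_op_glue: "linear_op T p (glue T)"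
proof -
  have g: "glue T u x = (\<Sum>K\<in>T. indicator K x * u K x)" for u x
    unfolding glue_def sum.inter_filter[OF finite_T] by (intro sum.cong) (auto split: split_indicator)
  show ?thesis unfolding linear_op_def
  proof (intro conjI ballI allI impI)
    fix u assume u: "u \<in> dg_space T p"
    show "glue T u \<in> borel_measurable borel" unfolding g[abs_def]
    proof (rule borel_measurable_sum)
      fix K assume K: "K \<in> T"
      have [measurable]: "K \<in> sets borel" "u K \<in> borel_measurable borel"
        using closed_T[OF K] poly_measurable[OF dg_space_poly[OF u K]] by auto
      show "(\<lambda>x. indicator K x * u K x) \<in> borel_measurable borel" by measurable
    qed
    fix S :: "(real^'n) set" assume S: "compact S"
    have "\<forall>K\<in>T. \<exists>C. \<forall>x\<in>S. cmod (u K x) \<le> C"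
      using linear_op_element[of _ T p] u S unfolding linear_op_def by blast
    from bchoice[OF this] obtain C where C: "\<forall>K\<in>T. \<forall>x\<in>S. cmod (u K x) \<le> C K" by blast
    show "\<exists>C. \<forall>x\<in>S. cmod (glue T u x) \<le> C" unfolding g
    proof (intro exI ballI)
      fix x assume x: "x \<in> S"
      show "cmod (\<Sum>K\<in>T. indicator K x * u K x) \<le> (\<Sum>K\<in>T. C K)"
      proof (rule sum_norm_le)
        fix K assume "K \<in> T"
        then have "cmod (u K x) \<le> C K" using C x by blast
        then show "cmod (indicator K x * u K x) \<le> C K"
          using norm_ge_zero[of "u K x"] by (auto simp: indicator_def simp del: norm_ge_zero)
      qed
    qed
  qed (simp add: g lincomb_apply sum.distrib sum_distrib_left algebra_simps)
qed

lemma face_domain: "e \<in> faces \<Longrightarrow> integration_domain surface_measure e"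
  by (intro integration_domain_surface face_borel face_bounded face_finite_measure)

lemma \<Gamma>\<^sub>R_domain: "integration_domain surface_measure (frontier \<Omega>\<^sub>1)"
proof (rule integration_domain_surface[OF borel_closed[OF frontier_closed] _ \<Gamma>\<^sub>R_finite_measure])
  show "bounded (frontier \<Omega>\<^sub>1)"
    using bounded_closure[OF bounded_\<Omega>\<^sub>1] bounded_subset unfolding frontier_def by blast
qed

lemma \<Omega>_domain: "integration_domain lebesgue \<Omega>"
proof (rule integration_domain_lebesgue)
  show "\<Omega> \<in> sets borel" using open_\<Omega>\<^sub>1 open_D by auto
  show "bounded \<Omega>" using bounded_\<Omega>\<^sub>1 bounded_subset by blast
qed

lemma hermitian_form_grad:
  assumes K: "K \<in> T"
  shows "hermitian_form T p (\<lambda>u v. grad_inner K (u K) (v K))"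
proof -
  have d: "integration_domain lebesgue K"
    using integration_domain_lebesgue[OF borel_closed[OF closed_T[OF K]] compact_imp_bounded[OF compact_T[OF K]]] .
  have l: "linear_op T p (\<lambda>u. pdiff i (u K))" for i
    using linear_op_iter_deriv[OF K, of "\<lambda>_. axis i 1" 1 p 1] by (simp add: norm_axis_1)
  have eq: "grad_inner K (u K) (v K) = (\<Sum>i\<in>UNIV. L2_inner lebesgue K (pdiff i (u K)) (pdiff i (v K)))"
    if "u \<in> dg_space T p" "v \<in> dg_space T p" for u v
    using linear_op_integrable[OF d l l that]
    unfolding grad_inner_def L2_inner_def set_lebesgue_integral_def set_integrable_def scaleR_sum_right
    by (intro Bochner_Integration.integral_sum) blast
  have "hermitian_form T p (\<lambda>u v. \<Sum>i\<in>UNIV. L2_inner lebesgue K (pdiff i (u K)) (pdiff i (v K)))"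
    using positive_form_L2[OF d l] unfolding positive_form_def by (intro hermitian_form_sum) blast
  note A = this
  show ?thesis
  proof (rule hermitian_formI)
    fix u w v c assume u: "u \<in> dg_space T p" "w \<in> dg_space T p" "v \<in> dg_space T p"
    show "grad_inner K (lincomb T c u w K) (v K) = grad_inner K (u K) (v K) + c * grad_inner K (w K) (v K)"
      unfolding eq[OF lincomb_closed[OF u(1,2)] u(3)] eq[OF u(1,3)] eq[OF u(2,3)]
      by (rule hermitian_form_lincomb_left[OF A u])
  next
    fix u v assume u: "u \<in> dg_space T p" "v \<in> dg_space T p"
    show "grad_inner K (v K) (u K) = cnj (grad_inner K (u K) (v K))"
      unfolding eq[OF u] eq[OF u(2,1)] by (rule hermitian_form_cnj[OF A u])
  qed
qed

lemma hermitian_form_b: "hermitian_form T p (form_b \<Omega> (frontier D) T lab)"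
proof -
  let ?c = "\<lambda>e u v. L2_inner surface_measure e (average T lab e (normal_deriv \<Omega> T lab e 1 u)) (jump T lab e v) +
      L2_inner surface_measure e (jump T lab e u) (average T lab e (normal_deriv \<Omega> T lab e 1 v))"
  have 1: "hermitian_form T p (\<lambda>u v. \<Sum>K\<in>T. grad_inner K (u K) (v K))"
    by (intro hermitian_form_sum hermitian_form_grad)
  have 2: "hermitian_form T p (?c e)" if e: "e \<in> faces" for e
    by (intro hermitian_form_L2_pair face_domain e linear_op_average linear_op_jump linear_op_normal_deriv linear_op_element)
  have "hermitian_form T p (\<lambda>u v. complex_of_real (-1) * (\<Sum>e\<in>faces. ?c e u v))"
    by (intro hermitian_form_scale hermitian_form_sum 2)
  from hermitian_form_add[OF 1 this] show ?thesis by (simp add: form_b_def[abs_def])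
qed

lemma positive_form_L1:
  assumes "\<And>e. e \<in> faces \<Longrightarrow> \<beta> e \<ge> 0"
  shows "positive_form T p (form_L1 (frontier D) T lab \<tau> p' \<beta>)"
  unfolding form_L1_def[abs_def]
proof (intro positive_form_sum positive_form_scale positive_form_L2 face_domain linear_op_jump linear_op_tang_deriv)
  fix e assume e: "e \<in> faces"
  show "0 \<le> \<beta> e * real p' / diameter e" using assms[OF e] face_diameter_pos[OF e] by simp
qed auto

lemma positive_form_J0:
  assumes "\<And>e. e \<in> faces \<Longrightarrow> \<gamma> e \<ge> 0"
  shows "positive_form T p (form_J0 (frontier D) T lab p' \<gamma>)"
  unfolding form_J0_def[abs_def]
proof (intro positive_form_sum positive_form_scale positive_form_L2 face_domain linear_op_jump linear_op_element)
  fix e assume e: "e \<in> faces"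
  show "0 \<le> \<gamma> e * real p' / diameter e" using assms[OF e] face_diameter_pos[OF e] by simp
qed auto

lemma positive_form_J:
  assumes "\<And>e. e \<in> interior_faces T \<Longrightarrow> \<gamma> e \<ge> 0"
  shows "positive_form T p (form_J \<Omega> T lab p' j \<gamma>)"
  unfolding form_J_def[abs_def]
proof (intro positive_form_sum positive_form_scale positive_form_L2 face_domain linear_op_jump linear_op_normal_deriv)
  fix e assume e: "e \<in> interior_faces T"
  show "0 \<le> \<gamma> e * (diameter e / real p') ^ (2 * j - 1)"
    using assms[OF e] face_diameter_pos[of e] e by (intro mult_nonneg_nonneg zero_le_power divide_nonneg_nonneg) auto
qed auto

end

section \<open>The Rellich argument\<close>

text \<open>\<open>f\<close> vanishes on a disc, so its tangential derivatives at the centre vanish.\<close>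

lemma normal_gradient:
  fixes f :: "real^'n \<Rightarrow> complex"
  assumes f: "f \<in> poly_space p" and n: "norm n = 1" and x: "n \<bullet> x = b" and r: "r > 0"
    and zero: "\<And>y. dist x y < r \<Longrightarrow> n \<bullet> y = b \<Longrightarrow> f y = 0"
  shows "pdiff i f x = complex_of_real (n $ i) * dir_deriv n f x"
    and "dir_deriv w f x = complex_of_real (n \<bullet> w) * dir_deriv n f x"
proof -
  have nn: "n \<bullet> n = 1" using n by (rule inner_unit)
  have dd: "dir_deriv \<nu> f x = (\<Sum>i\<in>UNIV. complex_of_real (\<nu> $ i) * pdiff i f x)" for \<nu>
    by (rule fun_cong[OF poly_dir_deriv[OF f]])
  \<comment> \<open>\<open>f\<close> vanishes along tangential lines\<close>
  have tang: "dir_deriv m f x = 0" if m: "n \<bullet> m = 0" for m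
  proof -
    have "((\<lambda>s::real. f (x + s *\<^sub>R m)) has_derivative (\<lambda>h. (\<Sum>i\<in>UNIV. complex_of_real ((h *\<^sub>R m) $ i) * pdiff i f x))) (at 0)"
    proof -
      have 1: "((\<lambda>s::real. x + s *\<^sub>R m) has_derivative (\<lambda>h. h *\<^sub>R m)) (at 0)"
        by (auto intro!: derivative_eq_intros)
      have 2: "(f has_derivative (\<lambda>h. \<Sum>i\<in>UNIV. complex_of_real (h $ i) * pdiff i f x)) (at (x + 0 *\<^sub>R m))"
        using poly_has_derivative[OF f, of x] by simp
      show ?thesis by (rule has_derivative_compose[OF 1 2])
    qed
    moreover have "((\<lambda>s::real. f (x + s *\<^sub>R m)) has_derivative (\<lambda>h. 0)) (at 0)"
    proof (rule has_derivative_transform_within_open[where f = "\<lambda>_. 0"])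
      show "open (ball (0::real) (r / (norm m + 1)))" by simp
      have nm: "norm m + 1 > 0" by (simp add: add_nonneg_pos)
      then show "0 \<in> ball (0::real) (r / (norm m + 1))" using r by simp
      fix s assume "s \<in> ball (0::real) (r / (norm m + 1))"
      then have "\<bar>s\<bar> * (norm m + 1) < r" using nm by (simp add: pos_less_divide_eq)
      then have "\<bar>s\<bar> * norm m < r" by (smt (verit) mult_left_mono abs_ge_zero)
      then show "0 = f (x + s *\<^sub>R m)"
        using zero[of "x + s *\<^sub>R m"] x m by (simp add: dist_norm inner_add_right)
    qed simp
    ultimately have "(\<lambda>h. (\<Sum>i\<in>UNIV. complex_of_real ((h *\<^sub>R m) $ i) * pdiff i f x)) = (\<lambda>h. 0)"
      by (rule has_derivative_unique)
    from fun_cong[OF this, of 1] show ?thesis by (simp add: dd[of m])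
  qed
  show w: "dir_deriv w f x = complex_of_real (n \<bullet> w) * dir_deriv n f x" for w
  proof -
    define m where "m = w - (n \<bullet> w) *\<^sub>R n"
    have "dir_deriv m f x = 0" by (rule tang) (simp add: m_def inner_diff_right nn)
    then have "(\<Sum>i\<in>UNIV. complex_of_real (m $ i) * pdiff i f x) = 0" unfolding dd[of m] .
    then show ?thesis unfolding dd[of w] dd[of n] m_def
      by (simp add: algebra_simps sum_subtractf sum_distrib_left)
  qed
  show "pdiff i f x = complex_of_real (n $ i) * dir_deriv n f x"
    using w[of "axis i 1"] by (simp add: inner_axis)
qed

text \<open>\<open>|P|\<^sup>2 - |Q|\<^sup>2 = Re ((P - Q) \<bullet> cnj (P + Q))\<close> for a difference that is parallel to \<open>n\<close>.\<close>

lemma cmod_diff_sum: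
  fixes P Q :: "'n::finite \<Rightarrow> complex" and n :: "real^'n"
  assumes "\<And>i. P i - Q i = complex_of_real (n $ i) * d"
  shows "(\<Sum>i\<in>UNIV. (cmod (P i))\<^sup>2) - (\<Sum>i\<in>UNIV. (cmod (Q i))\<^sup>2) =
    Re (d * cnj ((\<Sum>i\<in>UNIV. complex_of_real (n $ i) * P i) + (\<Sum>i\<in>UNIV. complex_of_real (n $ i) * Q i)))"
proof -
  have sq: "(cmod (P i))\<^sup>2 - (cmod (Q i))\<^sup>2 = Re (d * cnj (complex_of_real (n $ i) * P i + complex_of_real (n $ i) * Q i))" for i
  proof -
    have "(cmod (P i))\<^sup>2 - (cmod (Q i))\<^sup>2 = Re ((P i - Q i) * cnj (P i + Q i))"
      unfolding cmod_power2 by (simp add: algebra_simps power2_eq_square)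
    then show ?thesis unfolding assms by (simp add: algebra_simps)
  qed
  then show ?thesis
    by (simp only: sum_subtractf[symmetric] sum.distrib[symmetric] cnj_sum Re_sum sum_distrib_left)
qed

context meshed_domain
begin

text \<open>Almost every point lies off the arrangement, and there in the interior of at most one element.\<close>

lemma mass_decomposition:
  assumes u: "u \<in> dg_space T p" and v: "v \<in> dg_space T p"
  shows "L2_inner lebesgue \<Omega> (glue T u) (glue T v) = (\<Sum>K\<in>T. L2_inner lebesgue K (u K) (v K))"
proof -
  let ?g = "\<lambda>K x. indicat_real K x *\<^sub>R (u K x * cnj (v K x))"
  have i: "integrable lebesgue (?g K)" if K: "K \<in> T" for K
    using linear_op_integrable[OF integration_domain_lebesgue[OF borel_closed[OF closed_T[OF K]] compact_imp_bounded[OF compact_T[OF K]]]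
        linear_op_element[OF K] linear_op_element[OF K] u v] unfolding set_integrable_def .
  have null: "\<Union>\<H> \<in> null_sets lebesgue"
  proof -
    have "negligible H" if H: "H \<in> \<H>" for H
    proof -
      have "H \<in> hyperplanes" using hyp_\<H> H by blast
      then obtain n b where n: "norm n = 1" "H = {y. n \<bullet> y = b}" by (rule hyperplanesE)
      then have "n \<noteq> 0" by auto
      then show ?thesis unfolding n(2) by (intro negligible_hyperplane) simp
    qed
    then have "negligible (\<Union>\<H>)" using finite_\<H> by (intro negligible_Union) auto
    then show ?thesis by (simp add: negligible_iff_null_sets)
  qed
  have "L2_inner lebesgue \<Omega> (glue T u) (glue T v) = (LINT x|lebesgue. (\<Sum>K\<in>T. ?g K x))"
    unfolding L2_inner_def set_lebesgue_integral_def
  proof (rule integral_cong_AE)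
    show "(\<lambda>x. indicat_real \<Omega> x *\<^sub>R (glue T u x * cnj (glue T v x))) \<in> borel_measurable lebesgue"
      using linear_op_integrable[OF \<Omega>_domain linear_op_glue linear_op_glue u v]
      unfolding set_integrable_def by (rule borel_measurable_integrable)
    show "(\<lambda>x. \<Sum>K\<in>T. ?g K x) \<in> borel_measurable lebesgue"
      by (intro borel_measurable_sum borel_measurable_integrable[OF i])
    show "AE x in lebesgue. indicat_real \<Omega> x *\<^sub>R (glue T u x * cnj (glue T v x)) = (\<Sum>K\<in>T. ?g K x)"
      using AE_not_in[OF null]
    proof eventually_elim
      case (elim x)
      have int: "x \<in> interior K" if "K \<in> T" "x \<in> K" for K
        using that elim frontier_T[OF that(1)] closed_T[OF that(1)] by (auto simp: frontier_def)
      show ?case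
      proof (cases "\<exists>K\<in>T. x \<in> K")
        case True
        then obtain K where K: "K \<in> T" "x \<in> K" by blast
        have "K' = K" if "K' \<in> T" "x \<in> K'" for K'
          using interiors_disjoint[OF that(1) K(1)] int[OF that] int[OF K] by blast
        then have s: "{K \<in> T. x \<in> K} = {K}" using K by blast
        have "x \<in> \<Omega>" using int[OF K] interior_subset_\<Omega>[OF K(1)] by blast
        moreover have "(\<Sum>K\<in>T. ?g K x) = (\<Sum>K\<in>{K \<in> T. x \<in> K}. u K x * cnj (v K x))"
          unfolding sum.inter_filter[OF finite_T] by (intro sum.cong) (auto split: split_indicator)
        ultimately show ?thesis unfolding glue_def s by simp
      next
        case False
        then have "x \<notin> \<Omega>" using \<Omega>_eq by blast
        moreover have "(\<Sum>K\<in>T. ?g K x) = 0" using False by (intro sum.neutral) auto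
        ultimately show ?thesis by simp
      qed
    qed
  qed
  also have "\<dots> = (\<Sum>K\<in>T. LINT x|lebesgue. ?g K x)"
    by (rule Bochner_Integration.integral_sum) (rule i)
  finally show ?thesis by (simp add: L2_inner_def set_lebesgue_integral_def)
qed

lemma Re_mass_element:
  assumes u: "u \<in> dg_space T p" and K: "K \<in> T"
  shows "Re (L2_inner lebesgue K (u K) (u K)) = (LINT x:K|lborel. (cmod (u K x))\<^sup>2)"
proof -
  note P = dg_space_poly[OF u K]
  have "Re (L2_inner lebesgue K (u K) (u K)) = (LINT x:K|lebesgue. (cmod (u K x))\<^sup>2)"
    by (rule L2_inner_self(1)[OF linear_op_integrable[OF integration_domain_lebesgue[OF borel_closed[OF closed_T[OF K]] compact_imp_bounded[OF compact_T[OF K]]]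
        linear_op_element[OF K] linear_op_element[OF K] u u]])
  also have "\<dots> = (LINT x:K|lborel. (cmod (u K x))\<^sup>2)"
    by (intro set_integral_lebesgue_lborel borel_measurable_continuous_onI continuous_intros poly_continuous[OF P] borel_closed closed_T K)
  finally show ?thesis .
qed

lemma Re_grad_element:
  assumes u: "u \<in> dg_space T p" and K: "K \<in> T"
  shows "Re (grad_inner K (u K) (u K)) = (LINT x:K|lborel. (\<Sum>j\<in>UNIV. (cmod (pdiff j (u K) x))\<^sup>2))"
proof -
  note P = poly_continuous[OF poly_pdiff[OF dg_space_poly[OF u K]]]
  have c: "continuous_on UNIV (\<lambda>x. \<Sum>i\<in>UNIV. pdiff i (u K) x * cnj (pdiff i (u K) x))"
    by (intro continuous_intros P)
  have sq: "Re (z * cnj z) = (cmod z)\<^sup>2" for z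
    by (simp add: complex_norm_square[symmetric] del: times_complex.simps of_real_power)
  have "grad_inner K (u K) (u K) = (LINT x:K|lborel. \<Sum>i\<in>UNIV. pdiff i (u K) x * cnj (pdiff i (u K) x))"
    unfolding grad_inner_def
    by (rule set_integral_lebesgue_lborel[OF borel_measurable_continuous_onI[OF c] borel_closed[OF closed_T[OF K]]])
  then show ?thesis
    using Re_set_integral[OF continuous_set_integrable[OF compact_T[OF K] c]] by (simp only: Re_sum sq)
qed

text \<open>When the kernel equation is tested with \<open>euler_op z\<close> of \<open>u\<close>, \<open>element_flux\<close> is what the Rellich identities
leave on the boundary of an element, and \<open>face_flux\<close> is twice the real part of the consistency term on
a face.\<close>

definition element_flux :: "real \<Rightarrow> real^'n \<Rightarrow> 'n broken \<Rightarrow> (real^'n) set \<Rightarrow> real^'n \<Rightarrow> real" where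
  "element_flux k z u K x = (outward_normal K x \<bullet> (x - z)) *
     ((\<Sum>j\<in>UNIV. (cmod (pdiff j (u K) x))\<^sup>2) - k\<^sup>2 * (cmod (u K x))\<^sup>2)"

definition face_flux :: "real^'n \<Rightarrow> 'n broken \<Rightarrow> (real^'n) set \<Rightarrow> real^'n \<Rightarrow> real" where
  "face_flux z u e x = 2 * Re (average T lab e (normal_deriv \<Omega> T lab e 1 u) x *
     cnj (jump T lab e (\<lambda>K\<in>T. euler_op z (u K)) x))"

lemma euler_jump: "u \<in> dg_space T p \<Longrightarrow> K \<in> T \<Longrightarrow> (\<lambda>K\<in>T. euler_op z (u K)) K x = dir_deriv (x - z) (u K) x"
  by (simp add: euler_op_dir_deriv[OF dg_space_poly])

lemma dir_deriv_norm_sq: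
  assumes "norm (n::real^'n) = 1" "\<And>i. P i = complex_of_real (n $ i) * d"
  shows "(\<Sum>i\<in>UNIV. (cmod (P i))\<^sup>2) = (cmod d)\<^sup>2"
proof -
  have "(\<Sum>i\<in>UNIV. (cmod (P i))\<^sup>2) = (\<Sum>i\<in>UNIV. (n $ i) * (n $ i)) * (cmod d)\<^sup>2"
    unfolding assms(2) norm_mult norm_of_real power_mult_distrib power2_abs sum_distrib_right
    by (simp only: power2_eq_square[of "_ $ _"])
  also have "(\<Sum>i\<in>UNIV. (n $ i) * (n $ i)) = n \<bullet> n" by (simp add: inner_vec_def)
  finally show ?thesis using inner_unit[OF assms(1)] by simp
qed

text \<open>The traces of \<open>u\<close> agree, so the jump of \<open>\<nabla>u\<close> is \<open>d n\<close> for a number \<open>d\<close>, and the jump of the test function is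
\<open>(x - z) \<bullet> n d\<close>.  By \<open>cmod_diff_sum\<close> both sides are \<open>(x - z) \<bullet> n\<close> times \<open>Re (d cnj (s + t))\<close>, where \<open>s\<close> and \<open>t\<close>
are the two normal derivatives.  \<open>K\<close> is taken as the element with the larger label, so that \<open>n\<close> is
also the normal of the face.\<close>

lemma interior_flux:
  assumes e: "element_at K n b x r" "element_at K' (- n) (- b) x r" and ne: "K' \<noteq> K" and lab: "lab K' < lab K"
    and u: "u \<in> dg_space T p"
    and jz: "\<And>e. e \<in> faces \<Longrightarrow> AE x in surface_measure. x \<in> e \<longrightarrow> jump T lab e u x = 0"
  shows "element_flux k z u K x + element_flux k z u K' x = face_flux z u (frontier K \<inter> frontier K') x"
proof -
  define e0 where "e0 = frontier K \<inter> frontier K'"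
  note f = interior_point_face[OF e ne, folded e0_def]
  note e1 = element_atD[OF e(1)] and e2 = element_atD[OF e(2)]
  note pm = plus_minus_elem_pair[OF f(5) lab]
  let ?f = "u K" and ?g = "u K'"
  have P: "?f \<in> poly_space p" "?g \<in> poly_space p" using dg_space_poly[OF u] e1 e2 by auto
  define h where "h = (\<lambda>x. ?f x + (-1) * ?g x)"
  have hP: "h \<in> poly_space p" unfolding h_def by (rule poly_space_lincomb[OF P])
  have jump: "jump T lab e0 w y = w K y - w K' y" for w y using f(1) pm by (simp add: jump_def)
  have ef: "e0 \<in> faces" using f(1) by blast
  have AEh: "AE y in surface_measure. y \<in> e0 \<longrightarrow> h y = 0"
    using jz[OF ef] by eventually_elim (simp add: jump h_def)
  have zero: "h y = 0" if "dist x y < r" "n \<bullet> y = b" for y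
    by (rule surface_AE_zero_imp_zero[OF e1(2) f(2) AEh poly_continuous[OF hP] that])
  note ng = normal_gradient[OF hP e1(2,8,7) zero]
  define d where "d = dir_deriv n h x"
  have dh: "dir_deriv \<nu> h x = dir_deriv \<nu> ?f x - dir_deriv \<nu> ?g x" for \<nu>
    unfolding h_def using fun_cong[OF poly_dir_deriv_lincomb[OF P, of \<nu> "-1"], of x] by simp
  define a where "a = n \<bullet> (x - z)"
  have "?f x = ?g x" using zero[of x] e1(7,8) by (simp add: h_def)
  have norms: "outward_normal K x = n" "outward_normal K' x = - n"
    using element_at_normal[OF e(1)] element_at_normal[OF e(2)] by auto
  have fn: "face_normal \<Omega> T lab e0 x = n" using f(1) pm norms by (simp add: face_normal_def)
  have av: "average T lab e0 (normal_deriv \<Omega> T lab e0 1 u) x = (dir_deriv n ?f x + dir_deriv n ?g x) / 2"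
    using f(1) pm by (simp add: average_def normal_deriv_def fn)
  have ju: "jump T lab e0 (\<lambda>K\<in>T. euler_op z (u K)) x = complex_of_real a * d"
    unfolding jump euler_jump[OF u e1(1)] euler_jump[OF u e2(1)] dh[symmetric] using ng(2)[of "x - z"] by (simp add: a_def d_def)
  have "element_flux k z u K x + element_flux k z u K' x =
      a * ((\<Sum>j\<in>UNIV. (cmod (pdiff j ?f x))\<^sup>2) - (\<Sum>j\<in>UNIV. (cmod (pdiff j ?g x))\<^sup>2))"
    unfolding element_flux_def norms \<open>?f x = ?g x\<close> by (simp add: a_def algebra_simps)
  also have "(\<Sum>j\<in>UNIV. (cmod (pdiff j ?f x))\<^sup>2) - (\<Sum>j\<in>UNIV. (cmod (pdiff j ?g x))\<^sup>2) =
      Re (d * cnj (dir_deriv n ?f x + dir_deriv n ?g x))"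
    using cmod_diff_sum[of "\<lambda>i. pdiff i ?f x" "\<lambda>i. pdiff i ?g x" n d]
    unfolding fun_cong[OF poly_dir_deriv[OF P(1), of n]] fun_cong[OF poly_dir_deriv[OF P(2), of n]]
    using ng(1) dh d_def by simp
  also have "a * \<dots> = face_flux z u e0 x"
    unfolding face_flux_def av ju by (simp add: algebra_simps)
  finally show ?thesis by (simp add: e0_def)
qed

text \<open>Here \<open>u = 0\<close> and \<open>\<nabla>u = d n\<close>, so with \<open>a = (x - z) \<bullet> n\<close> the element contributes \<open>a |d|\<^sup>2\<close> and the face
\<open>2 a |d|\<^sup>2\<close>.\<close>

lemma inner_flux:
  assumes e: "element_at K n b x r" and D: "half_ball (- n) (- b) x r \<subseteq> D"
    and e0: "e0 \<in> faces" "e0 \<notin> interior_faces T" "ball x r \<inter> {y. n \<bullet> y = b} \<subseteq> e0" "plus_elem T lab e0 = K"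
    and u: "u \<in> dg_space T p"
    and jz: "\<And>e. e \<in> faces \<Longrightarrow> AE x in surface_measure. x \<in> e \<longrightarrow> jump T lab e u x = 0"
  shows "element_flux k z u K x - face_flux z u e0 x = - (n \<bullet> (x - z)) * (cmod (dir_deriv n (u K) x))\<^sup>2"
proof -
  note e1 = element_atD[OF e]
  let ?f = "u K"
  have P: "?f \<in> poly_space p" using dg_space_poly[OF u] e1 by auto
  have jump: "jump T lab e0 w y = w K y" for w y using e0 by (simp add: jump_def)
  have AEh: "AE y in surface_measure. y \<in> e0 \<longrightarrow> ?f y = 0"
    using jz[OF e0(1)] by eventually_elim (simp add: jump)
  have zero: "?f y = 0" if "dist x y < r" "n \<bullet> y = b" for y
    by (rule surface_AE_zero_imp_zero[OF e1(2) e0(3) AEh poly_continuous[OF P] that])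
  note ng = normal_gradient[OF P e1(2,8,7) zero]
  define d where "d = dir_deriv n ?f x"
  define a where "a = n \<bullet> (x - z)"
  have fx: "?f x = 0" using zero[of x] e1(7,8) by simp
  have fn: "face_normal \<Omega> T lab e0 x = n" using e0(2) inner_normals(2)[OF e D] by (simp add: face_normal_def)
  have av: "average T lab e0 (normal_deriv \<Omega> T lab e0 1 u) x = d"
    using e0 by (simp add: average_def normal_deriv_def fn d_def)
  have ju: "jump T lab e0 (\<lambda>K\<in>T. euler_op z (u K)) x = complex_of_real a * d"
    unfolding jump euler_jump[OF u e1(1)] using ng(2)[of "x - z"] by (simp add: a_def d_def)
  have "(\<Sum>j\<in>UNIV. (cmod (pdiff j ?f x))\<^sup>2) = (cmod d)\<^sup>2"
    by (rule dir_deriv_norm_sq[OF e1(2)]) (use ng(1) in \<open>simp add: d_def\<close>)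
  then have "element_flux k z u K x = a * (cmod d)\<^sup>2"
    unfolding element_flux_def element_at_normal[OF e] fx by (simp add: a_def)
  moreover have "face_flux z u e0 x = 2 * a * (cmod d)\<^sup>2"
  proof -
    have "Re (d * cnj (complex_of_real a * d)) = a * (cmod d)\<^sup>2"
      unfolding cmod_power2 by (simp add: power2_eq_square algebra_simps)
    then show ?thesis unfolding face_flux_def av ju by (simp del: times_complex.simps)
  qed
  ultimately show ?thesis by (simp add: a_def d_def)
qed

lemma outer_flux:
  assumes e: "element_at K n b x r" and O: "half_ball (- n) (- b) x r \<inter> \<Omega>\<^sub>1 = {}"
    and noT: "half_ball (- n) (- b) x r \<inter> \<Union>T = {}"
    and u: "u \<in> dg_space T p"
    and gz: "AE x in surface_measure. x \<in> frontier \<Omega>\<^sub>1 \<longrightarrow> glue T u x = 0"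
  shows "element_flux k z u K x = (n \<bullet> (x - z)) * (cmod (dir_deriv n (u K) x))\<^sup>2"
proof -
  note e1 = element_atD[OF e]
  let ?f = "u K" and ?B = "ball x r \<inter> {y. n \<bullet> y = b}"
  have P: "?f \<in> poly_space p" using dg_space_poly[OF u] e1 by auto
  have AEh: "AE y in surface_measure. y \<in> ?B \<longrightarrow> ?f y = 0"
    using gz
  proof eventually_elim
    case (elim y)
    show ?case
    proof
      assume "y \<in> ?B"
      then have y: "y \<in> ball x r" "n \<bullet> y = b" by auto
      then show "?f y = 0" using elim outer_point(1)[OF e O y] glue_boundary[OF e noT y] by simp
    qed
  qed
  have zero: "?f y = 0" if "dist x y < r" "n \<bullet> y = b" for y
    by (rule surface_AE_zero_imp_zero[OF e1(2) order_refl AEh poly_continuous[OF P] that])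
  note ng = normal_gradient[OF P e1(2,8,7) zero]
  have fx: "?f x = 0" using zero[of x] e1(7,8) by simp
  have "(\<Sum>j\<in>UNIV. (cmod (pdiff j ?f x))\<^sup>2) = (cmod (dir_deriv n ?f x))\<^sup>2"
    by (rule dir_deriv_norm_sq[OF e1(2)]) (use ng(1) in simp)
  then show ?thesis unfolding element_flux_def element_at_normal[OF e] fx by simp
qed

text \<open>The surface terms cancel on interior faces.  Where \<open>K\<close> borders on \<open>D\<close>, the outward normal of \<open>D\<close> is \<open>- n\<close>, and at
the outer boundary \<open>n\<close> is the outward normal of \<open>\<Omega>\<^sub>1\<close>; star-shapedness settles the signs there.\<close>

lemma total_flux_nonneg:
  assumes u: "u \<in> dg_space T p" and x: "generic x"
    and jz: "\<And>e. e \<in> faces \<Longrightarrow> AE x in surface_measure. x \<in> e \<longrightarrow> jump T lab e u x = 0"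
    and gz: "AE x in surface_measure. x \<in> frontier \<Omega>\<^sub>1 \<longrightarrow> glue T u x = 0"
    and star1: "\<And>x \<nu>. x \<in> frontier \<Omega>\<^sub>1 \<Longrightarrow> is_outward_normal \<Omega>\<^sub>1 x \<nu> \<Longrightarrow> (x - z) \<bullet> \<nu> \<ge> 0"
    and starD: "\<And>x \<nu>. x \<in> frontier D \<Longrightarrow> is_outward_normal D x \<nu> \<Longrightarrow> (x - z) \<bullet> \<nu> \<ge> 0"
  shows "(\<Sum>K\<in>T. indicator (frontier K) x * element_flux k z u K x) - (\<Sum>e\<in>faces. indicator e x * face_flux z u e x) \<ge> 0"
proof -
  have sK: "(\<Sum>K\<in>T. indicator (frontier K) x * element_flux k z u K x) =
      (\<Sum>K\<in>{K\<in>T. x \<in> frontier K}. element_flux k z u K x)"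
    unfolding sum.inter_filter[OF finite_T] by (intro sum.cong) (auto split: split_indicator)
  have ff: "finite faces" using finite_faces by blast
  have se: "(\<Sum>e\<in>faces. indicator e x * face_flux z u e x) = (\<Sum>e\<in>{e\<in>faces. x \<in> e}. face_flux z u e x)"
    unfolding sum.inter_filter[OF ff] by (intro sum.cong) (auto split: split_indicator)
  show ?thesis
  proof (cases "\<exists>K\<in>T. x \<in> frontier K")
    case False
    then have 1: "{K\<in>T. x \<in> frontier K} = {}" by blast
    have 2: "{e\<in>faces. x \<in> e} = {}"
    proof -
      have "x \<notin> e" if "e \<in> faces" for e using face_element[OF that] False by blast
      then show ?thesis by blast
    qed
    show ?thesis unfolding sK se 1 2 by simp
  next
    case True
    then obtain K where K: "K \<in> T" "x \<in> frontier K" by blast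
    from K x show ?thesis
    proof (cases rule: frontier_point_cases)
      case (interior n b r K')
      note f = interior_point_face[OF interior]
      have e0: "{e\<in>faces. x \<in> e} = {frontier K \<inter> frontier K'}" using f(1,3) by blast
      have K': "K' \<in> T" using element_atD(1)[OF interior(2)] .
      have "lab K' \<noteq> lab K" using inj_lab K' K(1) interior(3) by (auto simp: inj_on_def)
      then consider "lab K' < lab K" | "lab K < lab K'" by linarith
      then have "element_flux k z u K x + element_flux k z u K' x = face_flux z u (frontier K \<inter> frontier K') x"
      proof cases
        case 1
        then show ?thesis using interior_flux[OF interior 1 u jz] by simp
      next
        case 2
        have "element_at K (- (- n)) (- (- b)) x r" using interior(1) by simp
        from interior_flux[OF interior(2) this interior(3)[symmetric] 2 u jz]
        show ?thesis by (simp add: add.commute Int_commute)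
      qed
      then show ?thesis unfolding sK se f(4) e0 using interior(3) by simp
    next
      case (inner n b r)
      show ?thesis
      proof (rule inner_point_face[OF inner(1,2)])
        fix e0 assume e0: "e0 \<in> boundary_faces T (frontier D)" "e0 \<notin> interior_faces T" "ball x r \<inter> {y. n \<bullet> y = b} \<subseteq> e0"
          "\<And>e. e \<in> faces \<Longrightarrow> x \<in> e \<longleftrightarrow> e = e0" "{K''\<in>T. x \<in> frontier K''} = {K}"
          "plus_elem T lab e0 = K"
        have ef: "e0 \<in> faces" using e0(1) by blast
        have es: "{e\<in>faces. x \<in> e} = {e0}" using e0(4) ef by blast
        note e1 = element_atD[OF inner(1)]
        have "(x - z) \<bullet> (- n) \<ge> 0"
          using starD[OF inner_point(2)[OF inner(1,2) _ e1(8)] inner_normals(1)[OF inner(1,2)]] e1(7) by simp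
        then have "- (n \<bullet> (x - z)) \<ge> 0" by (simp add: inner_commute)
        then have "- (n \<bullet> (x - z)) * (cmod (dir_deriv n (u K) x))\<^sup>2 \<ge> 0" by (rule mult_nonneg_nonneg) simp
        then show ?thesis unfolding sK se e0(5) es
          using inner_flux[OF inner(1,2) ef e0(2,3,6) u jz, of k z] by simp
      qed
    next
      case (outer n b r)
      note f = outer_point_no_face[OF outer]
      have es: "{e\<in>faces. x \<in> e} = {}" using f(1) by blast
      note e1 = element_atD[OF outer(1)]
      have "(x - z) \<bullet> n \<ge> 0"
        using star1[OF outer_point(1)[OF outer(1,2) _ e1(8)] outer_point(3)[OF outer(1,2)]] e1(7) by simp
      then have "n \<bullet> (x - z) \<ge> 0" by (simp add: inner_commute)
      then have "(n \<bullet> (x - z)) * (cmod (dir_deriv n (u K) x))\<^sup>2 \<ge> 0" by (rule mult_nonneg_nonneg) simp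
      then show ?thesis unfolding sK se f(2) es
        using outer_flux[OF outer u gz, of k z] by simp
    qed
  qed
qed

end

context meshed_domain
begin

text \<open>Let \<open>G = \<parallel>\<nabla>u\<parallel>\<^sup>2\<close>, \<open>M = \<parallel>u\<parallel>\<^sup>2\<close> and let \<open>B\<close> be the integral of the total flux.  Testing with \<open>u\<close> gives \<open>G = k\<^sup>2 M\<close>,
testing with the multiplier gives \<open>(2 - d) G + B = - d k\<^sup>2 M\<close>.  So \<open>B = - 2 k\<^sup>2 M\<close>, while \<open>B \<ge> 0\<close>.\<close>

theorem form_b_kernel_trivial:
  fixes k :: real
  assumes u: "u \<in> dg_space T p" and k: "k \<noteq> 0"
    and jz: "\<And>e. e \<in> faces \<Longrightarrow> AE x in surface_measure. x \<in> e \<longrightarrow> jump T lab e u x = 0"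
    and gz: "AE x in surface_measure. x \<in> frontier \<Omega>\<^sub>1 \<longrightarrow> glue T u x = 0"
    and eq: "\<And>v. v \<in> dg_space T p \<Longrightarrow>
      form_b \<Omega> (frontier D) T lab u v = complex_of_real (k\<^sup>2) * L2_inner lebesgue \<Omega> (glue T u) (glue T v)"
    and star1: "\<And>x \<nu>. x \<in> frontier \<Omega>\<^sub>1 \<Longrightarrow> is_outward_normal \<Omega>\<^sub>1 x \<nu> \<Longrightarrow> (x - z) \<bullet> \<nu> \<ge> 0"
    and starD: "\<And>x \<nu>. x \<in> frontier D \<Longrightarrow> is_outward_normal D x \<nu> \<Longrightarrow> (x - z) \<bullet> \<nu> \<ge> 0"
    and K: "K \<in> T"
  shows "u K = (\<lambda>x. 0)"
proof -
  define G where "G = (\<Sum>K\<in>T. LINT x:K|lborel. (\<Sum>j\<in>UNIV. (cmod (pdiff j (u K) x))\<^sup>2))"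
  define M where "M = (\<Sum>K\<in>T. LINT x:K|lborel. (cmod (u K x))\<^sup>2)"
  define d where "d = real CARD('n)"
  let ?avg = "\<lambda>e. average T lab e (normal_deriv \<Omega> T lab e 1 u)"
  have P: "u K \<in> poly_space p" if "K \<in> T" for K using dg_space_poly[OF u that] .
  have b: "form_b \<Omega> (frontier D) T lab u v = (\<Sum>K\<in>T. grad_inner K (u K) (v K)) -
      (\<Sum>e\<in>faces. L2_inner surface_measure e (?avg e) (jump T lab e v))" for v
  proof -
    have "L2_inner surface_measure e (jump T lab e u) (average T lab e (normal_deriv \<Omega> T lab e 1 v)) = 0" if "e \<in> faces" for e
      using jz[OF that] by (intro L2_inner_AE_zero) (auto elim: eventually_mono)
    then show ?thesis by (simp add: form_b_def)
  qed
  have GM: "G = k\<^sup>2 * M"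
  proof -
    have "L2_inner surface_measure e (?avg e) (jump T lab e u) = 0" if "e \<in> faces" for e
      using jz[OF that] by (intro L2_inner_AE_zero) (auto elim: eventually_mono)
    then have "(\<Sum>K\<in>T. grad_inner K (u K) (u K)) = complex_of_real (k\<^sup>2) * (\<Sum>K\<in>T. L2_inner lebesgue K (u K) (u K))"
      using eq[OF u] b[of u] by (simp add: mass_decomposition[OF u u])
    from arg_cong[OF this, of Re] show ?thesis
      by (simp add: G_def M_def Re_grad_element[OF u] Re_mass_element[OF u] del: of_real_power)
  qed
  \<comment> \<open>the Rellich multiplier as test function\<close>
  define v where "v = (\<lambda>K\<in>T. euler_op z (u K))"
  have v: "v \<in> dg_space T p" using P by (auto simp: v_def dg_space_def intro!: euler_op_closed)
  have vK: "v K = euler_op z (u K)" if "K \<in> T" for K using that by (simp add: v_def)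
  let ?F = "\<lambda>K \<phi>. LINT x:frontier K|surface_measure. (outward_normal K x \<bullet> (x - z)) * \<phi> x"
  have ibd: "set_integrable surface_measure (frontier K) (\<lambda>x. (outward_normal K x \<bullet> (x - z)) * \<phi> x)"
    if "K \<in> T" "continuous_on UNIV \<phi>" for K \<phi>
    by (intro normal_flux_integrable polytope_T interior_T that continuous_intros)
  have flux: "(LINT x:frontier K|surface_measure. element_flux k z u K x) =
      (\<Sum>j\<in>UNIV. ?F K (\<lambda>x. (cmod (pdiff j (u K) x))\<^sup>2)) - k\<^sup>2 * ?F K (\<lambda>x. (cmod (u K x))\<^sup>2)"
    and fluxi: "set_integrable surface_measure (frontier K) (element_flux k z u K)" if KT: "K \<in> T" for K
  proof -
    have cj: "continuous_on UNIV (\<lambda>x. (cmod (pdiff j (u K) x))\<^sup>2)" for j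
      by (intro continuous_intros poly_continuous[OF poly_pdiff[OF P[OF KT]]])
    have c0: "continuous_on UNIV (\<lambda>x. (cmod (u K x))\<^sup>2)"
      by (intro continuous_intros poly_continuous[OF P[OF KT]])
    have ee: "element_flux k z u K = (\<lambda>x. (outward_normal K x \<bullet> (x - z)) * (\<Sum>j\<in>UNIV. (cmod (pdiff j (u K) x))\<^sup>2) -
        k\<^sup>2 * ((outward_normal K x \<bullet> (x - z)) * (cmod (u K x))\<^sup>2))"
      by (auto simp: element_flux_def algebra_simps)
    have i1: "set_integrable surface_measure (frontier K) (\<lambda>x. (outward_normal K x \<bullet> (x - z)) * (\<Sum>j\<in>UNIV. (cmod (pdiff j (u K) x))\<^sup>2))"
      by (intro ibd[OF KT] continuous_on_sum cj)
    have i2: "set_integrable surface_measure (frontier K) (\<lambda>x. k\<^sup>2 * ((outward_normal K x \<bullet> (x - z)) * (cmod (u K x))\<^sup>2))"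
      using ibd[OF KT c0] by simp
    show "set_integrable surface_measure (frontier K) (element_flux k z u K)"
      unfolding ee by (rule set_integral_diff(1)[OF i1 i2])
    have "?F K (\<lambda>x. \<Sum>j\<in>UNIV. (cmod (pdiff j (u K) x))\<^sup>2) = (\<Sum>j\<in>UNIV. ?F K (\<lambda>x. (cmod (pdiff j (u K) x))\<^sup>2))"
      using ibd[OF KT cj] unfolding set_lebesgue_integral_def set_integrable_def sum_distrib_left scaleR_sum_right
      by (intro Bochner_Integration.integral_sum) blast
    then show "(LINT x:frontier K|surface_measure. element_flux k z u K x) =
      (\<Sum>j\<in>UNIV. ?F K (\<lambda>x. (cmod (pdiff j (u K) x))\<^sup>2)) - k\<^sup>2 * ?F K (\<lambda>x. (cmod (u K x))\<^sup>2)"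
      unfolding ee set_integral_diff(2)[OF i1 i2] by simp
  qed
  have ff: "finite faces" using finite_faces by blast
  have ai: "set_integrable surface_measure e (\<lambda>x. ?avg e x * cnj (jump T lab e v x))" if e: "e \<in> faces" for e
    by (intro linear_op_integrable[OF face_domain[OF e] _ _ u v] linear_op_average linear_op_jump linear_op_normal_deriv linear_op_element e)
  have fface: "(LINT x:e|surface_measure. face_flux z u e x) = 2 * Re (L2_inner surface_measure e (?avg e) (jump T lab e v))"
    and ffacei: "set_integrable surface_measure e (face_flux z u e)" if e: "e \<in> faces" for e
  proof -
    have i: "set_integrable surface_measure e (\<lambda>x. Re (?avg e x * cnj (jump T lab e v x)))"
      using integrable_Re[OF ai[OF e, unfolded set_integrable_def]] unfolding set_integrable_def by simp
    then show "set_integrable surface_measure e (face_flux z u e)"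
      unfolding face_flux_def[abs_def] v_def[symmetric] by (intro set_integrable_mult_right)
    show "(LINT x:e|surface_measure. face_flux z u e x) = 2 * Re (L2_inner surface_measure e (?avg e) (jump T lab e v))"
      unfolding face_flux_def v_def[symmetric] L2_inner_def Re_set_integral[OF ai[OF e]]
      by (rule set_integral_mult_right)
  qed
  define B where "B = (\<Sum>K\<in>T. LINT x:frontier K|surface_measure. element_flux k z u K x) -
      (\<Sum>e\<in>faces. LINT x:e|surface_measure. face_flux z u e x)"
  have "B \<ge> 0"
  proof -
    have "B = (LINT x|surface_measure. (\<Sum>K\<in>T. indicator (frontier K) x *\<^sub>R element_flux k z u K x) -
        (\<Sum>e\<in>faces. indicator e x *\<^sub>R face_flux z u e x))"
    proof -
      have s1: "integrable surface_measure (\<lambda>x. \<Sum>K\<in>T. indicator (frontier K) x *\<^sub>R element_flux k z u K x)"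
        using fluxi unfolding set_integrable_def by (intro Bochner_Integration.integrable_sum)
      have s2: "integrable surface_measure (\<lambda>x. \<Sum>e\<in>faces. indicator e x *\<^sub>R face_flux z u e x)"
        using ffacei unfolding set_integrable_def by (intro Bochner_Integration.integrable_sum)
      have t1: "(LINT x|surface_measure. (\<Sum>K\<in>T. indicator (frontier K) x *\<^sub>R element_flux k z u K x)) =
          (\<Sum>K\<in>T. (LINT x|surface_measure. indicator (frontier K) x *\<^sub>R element_flux k z u K x))"
        using fluxi unfolding set_integrable_def by (intro Bochner_Integration.integral_sum)
      have t2: "(LINT x|surface_measure. (\<Sum>e\<in>faces. indicator e x *\<^sub>R face_flux z u e x)) =
          (\<Sum>e\<in>faces. (LINT x|surface_measure. indicator e x *\<^sub>R face_flux z u e x))"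
        using ffacei unfolding set_integrable_def by (intro Bochner_Integration.integral_sum)
      show ?thesis
        unfolding B_def set_lebesgue_integral_def t1[symmetric] t2[symmetric]
        by (rule Bochner_Integration.integral_diff[OF s1 s2, symmetric])
    qed
    moreover have "\<dots> \<ge> 0"
    proof (rule integral_nonneg_AE)
      show "AE x in surface_measure. 0 \<le> (\<Sum>K\<in>T. indicator (frontier K) x *\<^sub>R element_flux k z u K x) -
        (\<Sum>e\<in>faces. indicator e x *\<^sub>R face_flux z u e x)"
        using AE_generic
      proof eventually_elim
        case (elim x)
        show ?case using total_flux_nonneg[OF u elim jz gz star1 starD] by simp
      qed
    qed
    ultimately show ?thesis by simp
  qed
  moreover have "B = - 2 * k\<^sup>2 * M"
  proof -
    have "2 * Re (form_b \<Omega> (frontier D) T lab u v) = (\<Sum>K\<in>T. 2 * Re (grad_inner K (u K) (v K))) -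
        (\<Sum>e\<in>faces. LINT x:e|surface_measure. face_flux z u e x)"
      unfolding b by (simp add: sum_distrib_left fface)
    also have "(\<Sum>K\<in>T. 2 * Re (grad_inner K (u K) (v K))) =
        (\<Sum>K\<in>T. (2 - d) * (LINT x:K|lborel. (\<Sum>j\<in>UNIV. (cmod (pdiff j (u K) x))\<^sup>2)) +
          (\<Sum>j\<in>UNIV. ?F K (\<lambda>x. (cmod (pdiff j (u K) x))\<^sup>2)))"
      unfolding d_def using rellich_stiffness[OF polytope_T interior_T P] by (intro sum.cong refl) (simp add: vK)
    also have "\<dots> = (2 - d) * G + (\<Sum>K\<in>T. \<Sum>j\<in>UNIV. ?F K (\<lambda>x. (cmod (pdiff j (u K) x))\<^sup>2))"
      unfolding G_def by (simp add: sum.distrib sum_distrib_left)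
    finally have 1: "2 * Re (form_b \<Omega> (frontier D) T lab u v) = (2 - d) * G +
        (\<Sum>K\<in>T. \<Sum>j\<in>UNIV. ?F K (\<lambda>x. (cmod (pdiff j (u K) x))\<^sup>2)) -
        (\<Sum>e\<in>faces. LINT x:e|surface_measure. face_flux z u e x)" .
    have "2 * Re (form_b \<Omega> (frontier D) T lab u v) = k\<^sup>2 * (\<Sum>K\<in>T. 2 * Re (L2_inner lebesgue K (u K) (v K)))"
      unfolding eq[OF v] mass_decomposition[OF u v] by (simp add: sum_distrib_left mult.left_commute del: of_real_power)
    also have "(\<Sum>K\<in>T. 2 * Re (L2_inner lebesgue K (u K) (v K))) =
        (\<Sum>K\<in>T. - d * (LINT x:K|lborel. (cmod (u K x))\<^sup>2) + ?F K (\<lambda>x. (cmod (u K x))\<^sup>2))"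
      unfolding d_def using rellich_mass[OF polytope_T interior_T P] by (intro sum.cong refl) (simp add: vK)
    also have "\<dots> = - d * M + (\<Sum>K\<in>T. ?F K (\<lambda>x. (cmod (u K x))\<^sup>2))"
      unfolding M_def by (simp only: sum.distrib sum_distrib_left)
    finally have 2: "2 * Re (form_b \<Omega> (frontier D) T lab u v) =
        k\<^sup>2 * (- d * M + (\<Sum>K\<in>T. ?F K (\<lambda>x. (cmod (u K x))\<^sup>2)))" .
    have 3: "(\<Sum>K\<in>T. LINT x:frontier K|surface_measure. element_flux k z u K x) =
        (\<Sum>K\<in>T. \<Sum>j\<in>UNIV. ?F K (\<lambda>x. (cmod (pdiff j (u K) x))\<^sup>2)) - k\<^sup>2 * (\<Sum>K\<in>T. ?F K (\<lambda>x. (cmod (u K x))\<^sup>2))"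
      by (simp add: flux sum_subtractf sum_distrib_left)
    show ?thesis using 1 2 3 unfolding B_def GM by (simp add: algebra_simps)
  qed
  ultimately have "k\<^sup>2 * M \<le> 0" by (simp add: mult.commute)
  then have "M \<le> 0" using k by (simp add: mult_le_0_iff)
  have nn: "(LINT x:K|lborel. (cmod (u K x))\<^sup>2) \<ge> 0" for K
    unfolding set_lebesgue_integral_def by (intro Bochner_Integration.integral_nonneg) auto
  have "M \<ge> 0" unfolding M_def by (rule sum_nonneg) (rule nn)
  then have "M = 0" using \<open>M \<le> 0\<close> by simp
  then have "\<forall>K\<in>T. (LINT x:K|lborel. (cmod (u K x))\<^sup>2) = 0"
    unfolding M_def by (subst (asm) sum_nonneg_eq_0_iff[OF finite_T nn])
  then have "(LINT x:K|lborel. (cmod (u K x))\<^sup>2) = 0" using K by blast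
  then have "Re (L2_inner lebesgue K (u K) (u K)) = 0" using Re_mass_element[OF u K] by simp
  then have AE: "AE x in lebesgue. x \<in> K \<longrightarrow> u K x = 0"
    by (rule L2_inner_self(3)[OF linear_op_integrable[OF integration_domain_lebesgue[OF borel_closed[OF closed_T[OF K]] compact_imp_bounded[OF compact_T[OF K]]]
        linear_op_element[OF K] linear_op_element[OF K] u u]])
  have zero: "u K x = 0" if "x \<in> interior K" for x
  proof (rule ccontr)
    assume ne: "u K x \<noteq> 0"
    have "open (u K -` (- {0}))" using poly_continuous[OF P[OF K], of UNIV] by (intro open_vimage) auto
    then have o: "open (u K -` (- {0}) \<inter> interior K)" by auto
    have "AE x in lebesgue. x \<notin> u K -` (- {0}) \<inter> interior K"
      using AE by eventually_elim (use interior_subset in auto)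
    moreover have "u K -` (- {0}) \<inter> interior K \<in> sets lebesgue" using o by (simp add: borel_open)
    ultimately have "negligible (u K -` (- {0}) \<inter> interior K)"
      by (simp add: negligible_iff_null_sets AE_iff_null_sets)
    then show False using o open_not_negligible[OF o] ne that by blast
  qed
  show "u K = (\<lambda>x. 0)"
    by (rule poly_zero_on_open[OF P[OF K] open_interior interior_T[OF K] zero])
qed

end

section \<open>Existence by duality\<close>

text \<open>Used in place of a dimension count: it works with any finite family that spans the trial space.\<close>

lemma functional_in_span:
  fixes L :: "('i \<Rightarrow> complex) \<Rightarrow> complex" and l :: "'j \<Rightarrow> ('i \<Rightarrow> complex) \<Rightarrow> complex"
  assumes "finite J"
    and "\<And>y z c. L (\<lambda>i. y i + c * z i) = L y + c * L z"
    and "\<And>j y z c. j \<in> J \<Longrightarrow> l j (\<lambda>i. y i + c * z i) = l j y + c * l j z"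
    and "\<And>y. (\<And>j. j \<in> J \<Longrightarrow> l j y = 0) \<Longrightarrow> L y = 0"
  shows "\<exists>c. \<forall>y. L y = (\<Sum>j\<in>J. c j * l j y)"
  using assms
proof (induction J arbitrary: L rule: finite_induct)
  case empty
  then show ?case by auto
next
  case (insert j J)
  show ?case
  proof (cases "\<exists>z. (\<forall>i\<in>J. l i z = 0) \<and> l j z \<noteq> 0")
    case False
    have "\<exists>c. \<forall>y. L y = (\<Sum>i\<in>J. c i * l i y)"
    proof (rule insert.IH)
      fix y assume "\<And>i. i \<in> J \<Longrightarrow> l i y = 0"
      then show "L y = 0" using False insert.prems(3)[of y] by blast
    qed (use insert.prems in auto)
    then obtain c where c: "\<forall>y. L y = (\<Sum>i\<in>J. c i * l i y)" by blast
    have "\<forall>y. L y = (\<Sum>i\<in>insert j J. (c(j := 0)) i * l i y)"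
      using c insert.hyps by (auto intro!: sum.cong)
    then show ?thesis by (rule exI[of _ "c(j := 0)"])
  next
    case True
    then obtain z where z: "\<And>i. i \<in> J \<Longrightarrow> l i z = 0" and zj: "l j z \<noteq> 0" by blast
    define a where "a = L z / l j z"
    \<comment> \<open>subtracting a multiple of \<open>l j\<close> makes the functional vanish wherever the others do\<close>
    have "\<exists>c. \<forall>y. L y - a * l j y = (\<Sum>i\<in>J. c i * l i y)"
    proof (rule insert.IH)
      fix y z' c
      show "L (\<lambda>i. y i + c * z' i) - a * l j (\<lambda>i. y i + c * z' i) =
        L y - a * l j y + c * (L z' - a * l j z')"
        using insert.prems(1,2) by (simp add: algebra_simps)
    next
      fix y assume y: "\<And>i. i \<in> J \<Longrightarrow> l i y = 0"
      define t where "t = - (l j y / l j z)"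
      have "L (\<lambda>i. y i + t * z i) = 0"
      proof (rule insert.prems(3))
        fix i assume i: "i \<in> insert j J"
        then have "l i (\<lambda>i. y i + t * z i) = l i y + t * l i z" by (rule insert.prems(2))
        then show "l i (\<lambda>i. y i + t * z i) = 0"
          using i y z zj by (auto simp: t_def)
      qed
      then show "L y - a * l j y = 0"
        using insert.prems(1)[of y t z] by (simp add: t_def a_def)
    qed (use insert.prems in auto)
    then obtain c where c: "\<forall>y. L y - a * l j y = (\<Sum>i\<in>J. c i * l i y)" by blast
    have "\<forall>y. L y = (\<Sum>i\<in>insert j J. (c(j := a)) i * l i y)"
    proof
      fix y
      have "(\<Sum>i\<in>J. (c(j := a)) i * l i y) = (\<Sum>i\<in>J. c i * l i y)"
        using insert.hyps by (intro sum.cong) auto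
      moreover have "L y = a * l j y + (\<Sum>i\<in>J. c i * l i y)"
        using c by (metis add.commute diff_add_cancel)
      ultimately show "L y = (\<Sum>i\<in>insert j J. (c(j := a)) i * l i y)"
        using insert.hyps by simp
    qed
    then show ?thesis by (rule exI[of _ "c(j := a)"])
  qed
qed

definition basis_fun :: "(real^'n) set set \<Rightarrow> (real^'n) set \<times> ('n \<Rightarrow> nat) \<Rightarrow> 'n broken" where
  "basis_fun T j = (\<lambda>K\<in>T. if K = fst j then monomial (snd j) else (\<lambda>x. 0))"

text \<open>The index set \<open>J\<close> is a parameter so that sums over it can be built up by induction.\<close>

definition basis_comb :: "(real^'n) set set \<Rightarrow> ((real^'n) set \<times> ('n \<Rightarrow> nat)) set \<Rightarrow>
    ((real^'n) set \<times> ('n \<Rightarrow> nat) \<Rightarrow> complex) \<Rightarrow> 'n broken" where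
  "basis_comb T J c = (\<lambda>K\<in>T. \<lambda>x. \<Sum>j\<in>J. c j * basis_fun T j K x)"

lemma basis_fun_closed: "j \<in> T \<times> multi_indices p \<Longrightarrow> basis_fun T j \<in> dg_space T p"
  by (auto simp: basis_fun_def dg_space_def monomial_in_poly_space poly_space_zero)

lemma basis_comb_closed:
  assumes "J \<subseteq> T \<times> multi_indices p" shows "basis_comb T J c \<in> dg_space T p"
  unfolding dg_space_def basis_comb_def
proof (rule restrict_PiE_iff[THEN iffD2], rule ballI)
  fix K assume K: "K \<in> T"
  show "(\<lambda>x. \<Sum>j\<in>J. c j * basis_fun T j K x) \<in> poly_space p"
    by (rule poly_space_sum) (use assms K dg_space_poly[OF basis_fun_closed] in blast)
qed

lemma basis_comb_insert:
  assumes "finite J" "j \<notin> J"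
  shows "basis_comb T (insert j J) c = lincomb T (c j) (basis_comb T J c) (basis_fun T j)"
  using assms by (auto simp: basis_comb_def lincomb_def fun_eq_iff restrict_def add.commute)

lemma basis_comb_lincomb:
  "basis_comb T J (\<lambda>j. y j + c * z j) = lincomb T c (basis_comb T J y) (basis_comb T J z)"
  by (auto simp: basis_comb_def lincomb_def fun_eq_iff restrict_def sum.distrib sum_distrib_left algebra_simps)

lemma basis_comb_surj:
  assumes T: "finite T" and u: "u \<in> dg_space T p"
  shows "\<exists>c. u = basis_comb T (T \<times> multi_indices p) c"
proof -
  have "\<forall>K\<in>T. \<exists>a. u K = (\<lambda>x. \<Sum>\<alpha>\<in>multi_indices p. a \<alpha> * monomial \<alpha> x)"
    using dg_space_poly[OF u] by (simp add: poly_space_iff)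
  from bchoice[OF this] obtain a where a: "\<forall>K\<in>T. u K = (\<lambda>x. \<Sum>\<alpha>\<in>multi_indices p. a K \<alpha> * monomial \<alpha> x)" by blast
  have "u = basis_comb T (T \<times> multi_indices p) (\<lambda>j. a (fst j) (snd j))"
  proof (rule ext)
    fix K
    show "u K = basis_comb T (T \<times> multi_indices p) (\<lambda>j. a (fst j) (snd j)) K"
    proof (cases "K \<in> T")
      case False
      then have "u K = undefined" using PiE_arb[OF u[unfolded dg_space_def]] by blast
      then show ?thesis using False by (simp add: basis_comb_def)
    next
      case K: True
      show ?thesis
      proof (rule ext)
        fix x
        have "basis_comb T (T \<times> multi_indices p) (\<lambda>j. a (fst j) (snd j)) K x =
            (\<Sum>j\<in>T \<times> multi_indices p. a (fst j) (snd j) * basis_fun T j K x)"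
          using K by (simp add: basis_comb_def)
        also have "\<dots> = (\<Sum>L\<in>T. \<Sum>\<alpha>\<in>multi_indices p. a L \<alpha> * basis_fun T (L, \<alpha>) K x)"
          by (simp add: sum.cartesian_product split_def)
        also have "\<dots> = (\<Sum>L\<in>T. if L = K then (\<Sum>\<alpha>\<in>multi_indices p. a K \<alpha> * monomial \<alpha> x) else 0)"
          using K by (intro sum.cong refl) (auto simp: basis_fun_def)
        also have "\<dots> = u K x" using K a T by (simp add: sum.delta)
        finally show "u K x = basis_comb T (T \<times> multi_indices p) (\<lambda>j. a (fst j) (snd j)) K x" ..
      qed
    qed
  qed
  then show ?thesis by blast
qed

text \<open>In coordinates, \<open>F\<close> vanishes wherever all functionals \<open>A(e\<^sub>j, \<cdot>)\<close> of a spanning family \<open>e\<^sub>j\<close> vanish.  Hence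
\<open>F\<close> is a combination of them, and the coefficients are those of a solution.\<close>

lemma solvable_if_adjoint_injective:
  fixes A :: "'n::finite broken \<Rightarrow> 'n broken \<Rightarrow> complex"
  assumes T: "finite T"
    and left: "\<And>u w v c. u \<in> dg_space T p \<Longrightarrow> w \<in> dg_space T p \<Longrightarrow> v \<in> dg_space T p \<Longrightarrow>
        A (lincomb T c u w) v = A u v + c * A w v"
    and right: "\<And>u w v c. u \<in> dg_space T p \<Longrightarrow> w \<in> dg_space T p \<Longrightarrow> v \<in> dg_space T p \<Longrightarrow>
        A v (lincomb T c u w) = A v u + cnj c * A v w"
    and F: "\<And>u w c. u \<in> dg_space T p \<Longrightarrow> w \<in> dg_space T p \<Longrightarrow> F (lincomb T c u w) = F u + cnj c * F w"
    and ker: "\<And>v. v \<in> dg_space T p \<Longrightarrow> (\<And>u. u \<in> dg_space T p \<Longrightarrow> A u v = 0) \<Longrightarrow> F v = 0"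
  shows "\<exists>u\<in>dg_space T p. \<forall>v\<in>dg_space T p. A u v = F v"
proof -
  let ?I = "T \<times> multi_indices p"
  have I: "finite ?I" using T finite_multi_indices by blast
  have comb: "A (basis_comb T J c) v = (\<Sum>j\<in>J. c j * A (basis_fun T j) v)"
    if "J \<subseteq> ?I" and v: "v \<in> dg_space T p" for J c v
  proof -
    have "finite J" using that(1) I finite_subset by blast
    then show ?thesis using that(1)
    proof (induction J rule: finite_induct)
      case empty
      have e: "basis_comb T {} c \<in> dg_space T p" by (rule basis_comb_closed) simp
      have "lincomb T (-1) (basis_comb T {} c) (basis_comb T {} c) = basis_comb T {} c"
        by (auto simp: lincomb_def basis_comb_def fun_eq_iff restrict_def)
      then show ?case using left[OF e e v, of "-1"] by simp
    next
      case (insert j J)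
      then have "basis_comb T J c \<in> dg_space T p" "basis_fun T j \<in> dg_space T p"
        by (auto intro!: basis_comb_closed basis_fun_closed)
      from left[OF this v, of "c j"] show ?case
        unfolding basis_comb_insert[OF insert.hyps] using insert by (simp add: add.commute)
    qed
  qed
  \<comment> \<open>conjugated coordinates make the antilinear \<open>F\<close> linear\<close>
  let ?e = "\<lambda>y. basis_comb T ?I (\<lambda>j. cnj (y j))"
  have e: "?e y \<in> dg_space T p" for y by (rule basis_comb_closed) simp
  have elin: "?e (\<lambda>j. y j + c * z j) = lincomb T (cnj c) (?e y) (?e z)" for y z c
    using basis_comb_lincomb[of T ?I "\<lambda>j. cnj (y j)" "cnj c" "\<lambda>j. cnj (z j)"] by simp
  have "\<exists>c. \<forall>y. F (?e y) = (\<Sum>j\<in>?I. c j * A (basis_fun T j) (?e y))"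
  proof (rule functional_in_span[OF I])
    show "F (?e (\<lambda>i. y i + c * z i)) = F (?e y) + c * F (?e z)" for y z c
      unfolding elin using F[OF e e] by simp
    show "A (basis_fun T j) (?e (\<lambda>i. y i + c * z i)) = A (basis_fun T j) (?e y) + c * A (basis_fun T j) (?e z)"
      if "j \<in> ?I" for j y z c
      unfolding elin using right[OF e e basis_fun_closed[OF that]] by simp
    fix y assume z: "\<And>j. j \<in> ?I \<Longrightarrow> A (basis_fun T j) (?e y) = 0"
    show "F (?e y) = 0"
    proof (rule ker[OF e])
      fix u assume "u \<in> dg_space T p"
      then obtain c where u: "u = basis_comb T ?I c" using basis_comb_surj[OF T] by blast
      show "A u (?e y) = 0" unfolding u comb[OF order_refl e] using z by (intro sum.neutral) auto
    qed
  qed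
  then obtain c where c: "\<And>y. F (?e y) = (\<Sum>j\<in>?I. c j * A (basis_fun T j) (?e y))" by blast
  show ?thesis
  proof (intro bexI ballI)
    show "basis_comb T ?I c \<in> dg_space T p" by (rule basis_comb_closed) simp
    fix v assume v: "v \<in> dg_space T p"
    then obtain y where "v = basis_comb T ?I y" using basis_comb_surj[OF T] by blast
    then have vy: "v = ?e (\<lambda>j. cnj (y j))" by simp
    show "A (basis_comb T ?I c) v = F v" unfolding comb[OF order_refl v] unfolding vy c ..
  qed
qed

text \<open>\<open>|f| \<le> 1 + |f|\<^sup>2\<close> and \<open>S\<close> has finite measure.\<close>

lemma L2_space_integrable:
  assumes d: "integration_domain M S" and f: "f \<in> L2_space M S" and L: "linear_op T p L" and v: "v \<in> dg_space T p"
  shows "set_integrable M S (\<lambda>x. f x * cnj (L v x))"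
proof -
  have Lm: "L v \<in> borel_measurable borel" using L v by (auto simp: linear_op_def)
  have [measurable]: "cnj \<in> borel_measurable borel"
    by (rule borel_measurable_continuous_onI[OF continuous_on_cnj[OF continuous_on_id]])
  have [measurable]: "L v \<in> borel_measurable M" by (rule integration_domain_measurable[OF d Lm])
  have fm [measurable]: "(\<lambda>x. indicator S x *\<^sub>R f x) \<in> borel_measurable M" and fi: "set_integrable M S (\<lambda>x. (cmod (f x))\<^sup>2)"
    using f by (auto simp: L2_space_def set_borel_measurable_def)
  have "compact (closure S)" using d by (simp add: integration_domain_def)
  then obtain C where C: "\<forall>x\<in>closure S. cmod (L v x) \<le> C" using L v unfolding linear_op_def by blast
  have one: "set_integrable M S (\<lambda>x. 1::real)"
  proof -
    have "integrable M (indicator S :: _ \<Rightarrow> real)"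
      using d unfolding integration_domain_def by (intro integrable_real_indicator) auto
    then show ?thesis by (simp add: set_integrable_def)
  qed
  have "set_integrable M S (\<lambda>x. \<bar>C\<bar> * (1 + (cmod (f x))\<^sup>2))"
    by (intro set_integrable_mult_right set_integral_add(1) one fi)
  then show ?thesis unfolding set_integrable_def
  proof (rule Bochner_Integration.integrable_bound)
    have "(\<lambda>x. (indicator S x *\<^sub>R f x) * cnj (L v x)) \<in> borel_measurable M" by measurable
    then show "(\<lambda>x. indicator S x *\<^sub>R (f x * cnj (L v x))) \<in> borel_measurable M" by simp
    show "AE x in M. norm (indicator S x *\<^sub>R (f x * cnj (L v x))) \<le> norm (indicator S x *\<^sub>R (\<bar>C\<bar> * (1 + (cmod (f x))\<^sup>2)))"
    proof (rule AE_I2)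
      fix x
      have "cmod (f x) * cmod (L v x) \<le> \<bar>C\<bar> * (1 + (cmod (f x))\<^sup>2)" if "x \<in> S"
      proof -
        have "x \<in> closure S" using that closure_subset[of S] by blast
        then have "cmod (L v x) \<le> \<bar>C\<bar>" using C by force
        moreover have "cmod (f x) \<le> 1 + (cmod (f x))\<^sup>2"
        proof -
          have "0 \<le> (cmod (f x) - 1/2)\<^sup>2" by simp
          then show ?thesis by (simp add: power2_eq_square algebra_simps)
        qed
        ultimately have "cmod (f x) * cmod (L v x) \<le> (1 + (cmod (f x))\<^sup>2) * \<bar>C\<bar>" by (intro mult_mono) auto
        then show ?thesis by (simp add: mult.commute)
      qed
      then show "norm (indicator S x *\<^sub>R (f x * cnj (L v x))) \<le> norm (indicator S x *\<^sub>R (\<bar>C\<bar> * (1 + (cmod (f x))\<^sup>2)))"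
        by (auto simp: indicator_def norm_mult abs_mult)
    qed
  qed
qed

lemma L2_inner_functional:
  assumes d: "integration_domain M S" and f: "f \<in> L2_space M S" and L: "linear_op T p L"
    and u: "u \<in> dg_space T p" "w \<in> dg_space T p"
  shows "L2_inner M S f (L (lincomb T c u w)) = L2_inner M S f (L u) + cnj c * L2_inner M S f (L w)"
proof -
  note i = L2_space_integrable[OF d f L u(1)] L2_space_integrable[OF d f L u(2)]
  have "L2_inner M S f (L (lincomb T c u w)) =
      (LINT x:S|M. f x * cnj (L u x) + cnj c * (f x * cnj (L w x)))"
    using L u unfolding L2_inner_def linear_op_def by (simp add: algebra_simps)
  also have "\<dots> = L2_inner M S f (L u) + (LINT x:S|M. cnj c * (f x * cnj (L w x)))"
    unfolding L2_inner_def using i by (intro set_integral_add(2)) auto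
  finally show ?thesis unfolding L2_inner_def by simp
qed

context meshed_domain
begin

text \<open>\<open>s = 1\<close> is the scheme and \<open>s = - 1\<close> its adjoint.  All other forms being real on the diagonal, the
imaginary part of the equation for \<open>v = u\<close> is \<open>s\<close> times the sum of the positive forms, each of which
therefore vanishes at \<open>u\<close>.  \<open>N\<close> stands for the penalty terms on derivatives.\<close>

lemma scheme_kernel_trivial:
  fixes k s :: real
  assumes u: "u \<in> dg_space T p" and k: "k > 0" and s: "s \<noteq> 0"
    and N: "positive_form T p N" and \<gamma>: "\<And>e. e \<in> faces \<Longrightarrow> \<gamma> e > 0" and p': "p' > 0"
    and eq: "\<And>v. v \<in> dg_space T p \<Longrightarrow> form_b \<Omega> (frontier D) T lab u v
        - complex_of_real (k\<^sup>2) * L2_inner lebesgue \<Omega> (glue T u) (glue T v)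
        + complex_of_real s * (\<i> * (N u v + form_J0 (frontier D) T lab p' \<gamma> u v +
            complex_of_real k * L2_inner surface_measure (frontier \<Omega>\<^sub>1) (glue T u) (glue T v))) = 0"
    and star1: "\<And>x \<nu>. x \<in> frontier \<Omega>\<^sub>1 \<Longrightarrow> is_outward_normal \<Omega>\<^sub>1 x \<nu> \<Longrightarrow> (x - z) \<bullet> \<nu> \<ge> 0"
    and starD: "\<And>x \<nu>. x \<in> frontier D \<Longrightarrow> is_outward_normal D x \<nu> \<Longrightarrow> (x - z) \<bullet> \<nu> \<ge> 0"
    and K: "K \<in> T"
  shows "u K = (\<lambda>x. 0)"
proof -
  let ?b = "form_b \<Omega> (frontier D) T lab" and ?J = "form_J0 (frontier D) T lab p' \<gamma>"
  let ?m = "\<lambda>u v. L2_inner lebesgue \<Omega> (glue T u) (glue T v)"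
  let ?g = "\<lambda>u v. L2_inner surface_measure (frontier \<Omega>\<^sub>1) (glue T u) (glue T v)"
  have J: "positive_form T p ?J" using \<gamma> by (intro positive_form_J0) (simp add: less_imp_le)
  have g: "positive_form T p ?g" by (rule positive_form_L2[OF \<Gamma>\<^sub>R_domain linear_op_glue])
  have m: "positive_form T p ?m" by (rule positive_form_L2[OF \<Omega>_domain linear_op_glue])
  have kg: "positive_form T p (\<lambda>u v. complex_of_real k * ?g u v)" using g k by (intro positive_form_scale) auto
  have P: "positive_form T p (\<lambda>u v. N u v + ?J u v + complex_of_real k * ?g u v)"
    by (intro positive_form_add N J kg)
  have "Im (?b u u) = 0" by (rule hermitian_form_real[OF hermitian_form_b u])
  moreover have "Im (?m u u) = 0" using m u hermitian_form_real unfolding positive_form_def by blast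
  ultimately have Re0: "Re (N u u + ?J u u + complex_of_real k * ?g u u) = 0"
    using arg_cong[OF eq[OF u], of Im] s by simp
  have nn: "Re (N u u) \<ge> 0" "Re (?J u u) \<ge> 0" "Re (?g u u) \<ge> 0"
    using N J g u unfolding positive_form_def by blast+
  then have "k * Re (?g u u) \<ge> 0" using k by simp
  moreover have "Re (N u u) + Re (?J u u) + k * Re (?g u u) = 0" using Re0 by simp
  ultimately have J0: "Re (?J u u) = 0" and "k * Re (?g u u) = 0" using nn(1,2) by linarith+
  then have g0: "Re (?g u u) = 0" using k by simp
  have Pz: "N u v + ?J u v + complex_of_real k * ?g u v = 0" if "v \<in> dg_space T p" for v
    using P u Re0 that unfolding positive_form_def by blast
  show ?thesis
  proof (rule form_b_kernel_trivial[OF u _ _ _ _ star1 starD K])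
    show "k \<noteq> 0" using k by simp
    show "?b u v = complex_of_real (k\<^sup>2) * ?m u v" if "v \<in> dg_space T p" for v
      using eq[OF that] Pz[OF that] by simp
    show "AE x in surface_measure. x \<in> frontier \<Omega>\<^sub>1 \<longrightarrow> glue T u x = 0"
      by (rule L2_inner_self(3)[OF linear_op_integrable[OF \<Gamma>\<^sub>R_domain linear_op_glue linear_op_glue u u] g0])
    fix e assume e: "e \<in> faces"
    let ?c = "\<lambda>e. \<gamma> e * real p' / diameter e"
    let ?L = "\<lambda>e. L2_inner surface_measure e (jump T lab e u) (jump T lab e u)"
    have li: "set_integrable surface_measure e (\<lambda>x. jump T lab e u x * cnj (jump T lab e u x))" if "e \<in> faces" for e
      by (intro linear_op_integrable[OF face_domain[OF that] _ _ u u] linear_op_jump linear_op_element that)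
    have c: "?c e > 0" if "e \<in> faces" for e using \<gamma>[OF that] p' face_diameter_pos[OF that] by simp
    have "(\<Sum>e\<in>faces. ?c e * Re (?L e)) = 0"
      using J0 unfolding form_J0_def by simp
    moreover have "?c e * Re (?L e) \<ge> 0" if "e \<in> faces" for e
      using c[OF that] L2_inner_self(2)[OF li[OF that]] by (intro mult_nonneg_nonneg) auto
    moreover have "finite faces" using finite_faces by blast
    ultimately have "\<forall>e\<in>faces. ?c e * Re (?L e) = 0" using sum_nonneg_eq_0_iff[of faces "\<lambda>e. ?c e * Re (?L e)"] by blast
    then have "?c e * Re (?L e) = 0" using e by blast
    then have "Re (?L e) = 0" using \<gamma>[OF e] p' face_diameter_pos[OF e] by simp
    then show "AE x in surface_measure. x \<in> e \<longrightarrow> jump T lab e u x = 0" by (rule L2_inner_self(3)[OF li[OF e]])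
  qed
qed

end

section \<open>Well-posedness of the scheme\<close>

lemma meshed_domain_exists:
  fixes \<Omega>\<^sub>1 D :: "(real^'n) set"
  assumes "CARD('n) \<ge> 2" and poly: "bounded_polyhedral_domain \<Omega>\<^sub>1"
    and D: "open D" "D \<subseteq> \<Omega>\<^sub>1" and mesh: "simplicial_mesh (\<Omega>\<^sub>1 - D) T" and lab: "inj_on lab T"
  shows "\<exists>\<H>. meshed_domain \<Omega>\<^sub>1 D T \<H> lab"
proof -
  obtain \<P> where P: "finite \<P>" "\<And>P. P \<in> \<P> \<Longrightarrow> polytope P" "\<Omega>\<^sub>1 = interior (\<Union>\<P>)"
    and dom: "open \<Omega>\<^sub>1" "bounded \<Omega>\<^sub>1"
    using poly unfolding bounded_polyhedral_domain_def is_domain_def by blast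
  have "\<forall>P\<in>\<P>. \<exists>\<H>. finite \<H> \<and> \<H> \<subseteq> hyperplanes \<and> frontier P \<subseteq> \<Union>\<H>"
    using polytope_arrangement P(2) by blast
  from bchoice[OF this] obtain h where h': "\<forall>P\<in>\<P>. finite (h P) \<and> h P \<subseteq> hyperplanes \<and> frontier P \<subseteq> \<Union>(h P)" ..
  have h: "finite (h P)" "h P \<subseteq> hyperplanes" "frontier P \<subseteq> \<Union>(h P)" if "P \<in> \<P>" for P
    using bspec[OF h' that] by simp_all
  have T: "finite T" and simplices: "\<forall>K\<in>T. int CARD('n) simplex K"
    using mesh by (simp_all add: simplicial_mesh_def)
  have TK: "polytope K" "interior K \<noteq> {}" if "K \<in> T" for K
    using simplex_interior_nonempty[OF bspec[OF simplices that]] by simp_all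
  define \<H> where "\<H> = (\<Union>K\<in>T. facet_hulls K) \<union> (\<Union>P\<in>\<P>. h P)"
  have closed: "closed (\<Union>\<P>)" by (intro closed_Union P(1) ballI polytope_imp_closed P(2))
  have "meshed_domain \<Omega>\<^sub>1 D T \<H> lab"
  proof
    show "interior (closure \<Omega>\<^sub>1) = \<Omega>\<^sub>1"
    proof
      have "\<Omega>\<^sub>1 \<subseteq> \<Union>\<P>" unfolding P(3) by (rule interior_subset)
      then have "closure \<Omega>\<^sub>1 \<subseteq> \<Union>\<P>" using closed by (rule closure_minimal)
      then show "interior (closure \<Omega>\<^sub>1) \<subseteq> \<Omega>\<^sub>1" unfolding P(3) by (rule interior_mono)
      show "\<Omega>\<^sub>1 \<subseteq> interior (closure \<Omega>\<^sub>1)" by (rule interior_maximal[OF closure_subset dom(1)])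
    qed
    show "locally_conic \<Omega>\<^sub>1" unfolding P(3)
      by (intro locally_conic_interior locally_conic_Union P(1) locally_conic_polytope P(2))
    show "finite \<H>" unfolding \<H>_def using h(1)
      by (intro finite_UnI finite_UN_I T P(1) finite_facet_hulls TK)
    show "\<H> \<subseteq> hyperplanes"
    proof
      fix H assume "H \<in> \<H>"
      then consider K where "K \<in> T" "H \<in> facet_hulls K" | P where "P \<in> \<P>" "H \<in> h P" unfolding \<H>_def by blast
      then show "H \<in> hyperplanes"
      proof cases
        case 1
        then show ?thesis using facet_hulls_hyperplanes[OF TK[OF 1(1)]] by blast
      next
        case 2
        then show ?thesis using h(2)[of P] by blast
      qed
    qed
    show "facet_hulls K \<subseteq> \<H>" if "K \<in> T" for K using that unfolding \<H>_def by blast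
    show "frontier \<Omega>\<^sub>1 \<subseteq> \<Union>\<H>"
    proof -
      have "frontier \<Omega>\<^sub>1 \<subseteq> frontier (\<Union>\<P>)"
        unfolding P(3) frontier_def interior_interior using closure_mono[OF interior_subset[of "\<Union>\<P>"]] by blast
      also have "\<dots> \<subseteq> (\<Union>P\<in>\<P>. frontier P)" using P(1) by (rule frontier_Union_subset)
      also have "\<dots> \<subseteq> \<Union>\<H>"
      proof (rule UN_least)
        fix P assume PP: "P \<in> \<P>"
        have "h P \<subseteq> \<H>" using PP by (auto simp: \<H>_def)
        then show "frontier P \<subseteq> \<Union>\<H>" by (rule order_trans[OF h(3)[OF PP] Union_mono])
      qed
      finally show ?thesis .
    qed
  qed (use assms dom in auto)
  then show ?thesis by blast
qed

theorem theorem3p2: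
  fixes \<Omega>\<^sub>1 D :: "(real^'n) set" and x\<^sub>0 :: "real^'n"
    and \<T> :: "(real^'n) set set set" and T :: "(real^'n) set set"
    and lab :: "(real^'n) set \<Rightarrow> nat" and \<tau> :: "(real^'n) set \<Rightarrow> nat \<Rightarrow> real^'n"
    and p q :: nat and k :: real and f g :: "real^'n \<Rightarrow> complex"
    and \<beta>\<^sub>1 :: "(real^'n) set \<Rightarrow> real" and \<gamma> :: "nat \<Rightarrow> (real^'n) set \<Rightarrow> real"
  defines "\<Omega> \<equiv> \<Omega>\<^sub>1 - D" and "\<Gamma>\<^sub>R \<equiv> frontier \<Omega>\<^sub>1" and "\<Gamma>\<^sub>D \<equiv> frontier D"
  assumes "CARD('n) = 2 \<or> CARD('n) = 3"
    and "bounded_polyhedral_domain \<Omega>\<^sub>1"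
    and "D = {} \<or> bounded_lipschitz_domain D"
    and "D \<subseteq> \<Omega>\<^sub>1"
    and "strictly_star_shaped \<Omega>\<^sub>1 x\<^sub>0"
    and "D \<noteq> {} \<Longrightarrow> star_shaped D x\<^sub>0"
    and "admissible_mesh_family \<Omega> \<T>" and "T \<in> \<T>"
    and "inj_on lab T"
    and "\<And>e. e \<in> interior_faces T \<union> boundary_faces T \<Gamma>\<^sub>D \<Longrightarrow> tangent_frame e (\<tau> e)"
    and "p \<ge> 1" and "q \<le> p" and "k > 0"
    and "f \<in> L2_space lebesgue \<Omega>" and "g \<in> L2_space surface_measure \<Gamma>\<^sub>R"
    and "\<And>e. e \<in> interior_faces T \<union> boundary_faces T \<Gamma>\<^sub>D \<Longrightarrow> \<beta>\<^sub>1 e \<ge> 0"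
    and "\<And>e. e \<in> interior_faces T \<union> boundary_faces T \<Gamma>\<^sub>D \<Longrightarrow> \<gamma> 0 e > 0"
    and "\<And>j e. j \<in> {1..q} \<Longrightarrow> e \<in> interior_faces T \<Longrightarrow> \<gamma> j e > 0"
  shows "\<exists>!u. u \<in> dg_space T p \<and> (\<forall>v\<in>dg_space T p.
      form_a \<Omega> \<Gamma>\<^sub>D T lab \<tau> p q \<beta>\<^sub>1 \<gamma> u v
        - (complex_of_real k)\<^sup>2 * L2_inner lebesgue \<Omega> (glue T u) (glue T v)
        + \<i> * complex_of_real k * L2_inner surface_measure \<Gamma>\<^sub>R (glue T u) (glue T v)
      = L2_inner lebesgue \<Omega> f (glue T v) + L2_inner surface_measure \<Gamma>\<^sub>R g (glue T v))"
proof -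
  have D: "open D" "D \<subseteq> \<Omega>\<^sub>1"
    using assms(6,7) unfolding bounded_lipschitz_domain_def is_domain_def by auto
  have mesh: "simplicial_mesh (\<Omega>\<^sub>1 - D) T"
    using assms(10,11) unfolding admissible_mesh_family_def \<Omega>_def by blast
  have "CARD('n) \<ge> 2" using assms(4) by auto
  then obtain \<H> where "meshed_domain \<Omega>\<^sub>1 D T \<H> lab"
    using meshed_domain_exists[OF _ assms(5) D mesh assms(12)] by blast
  then interpret meshed_domain \<Omega>\<^sub>1 D T \<H> lab .
  have star1: "(x - x\<^sub>0) \<bullet> \<nu> \<ge> 0" if "x \<in> frontier \<Omega>\<^sub>1" "is_outward_normal \<Omega>\<^sub>1 x \<nu>" for x \<nu>
    using assms(8) that unfolding strictly_star_shaped_def star_shaped_const_def by force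
  have starD: "(x - x\<^sub>0) \<bullet> \<nu> \<ge> 0" if "x \<in> frontier D" "is_outward_normal D x \<nu>" for x \<nu>
  proof -
    have "D \<noteq> {}" using that(1) by auto
    then show ?thesis using assms(9) that unfolding star_shaped_def star_shaped_const_def by force
  qed
  let ?N = "\<lambda>u v. form_L1 \<Gamma>\<^sub>D T lab \<tau> p \<beta>\<^sub>1 u v + (\<Sum>j=1..q. form_J \<Omega> T lab p j (\<gamma> j) u v)"
  let ?b = "form_b \<Omega> \<Gamma>\<^sub>D T lab" and ?J = "form_J0 \<Gamma>\<^sub>D T lab p (\<gamma> 0)"
  let ?m = "\<lambda>u v. L2_inner lebesgue \<Omega> (glue T u) (glue T v)"
  let ?g = "\<lambda>u v. L2_inner surface_measure \<Gamma>\<^sub>R (glue T u) (glue T v)"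
  define P where "P u v = ?N u v + ?J u v + complex_of_real k * ?g u v" for u v
  define A where "A u v = ?b u v - complex_of_real (k\<^sup>2) * ?m u v + \<i> * P u v" for u v
  define F where "F v = L2_inner lebesgue \<Omega> f (glue T v) + L2_inner surface_measure \<Gamma>\<^sub>R g (glue T v)" for v
  have N: "positive_form T p ?N"
  proof (intro positive_form_add positive_form_sum)
    show "positive_form T p (form_L1 \<Gamma>\<^sub>D T lab \<tau> p \<beta>\<^sub>1)"
      unfolding \<Gamma>\<^sub>D_def using assms(19) unfolding \<Gamma>\<^sub>D_def by (rule positive_form_L1)
    show "positive_form T p (form_J \<Omega> T lab p j (\<gamma> j))" if "j \<in> {1..q}" for j
      unfolding \<Omega>_def using assms(21)[OF that] by (intro positive_form_J) (simp add: less_imp_le)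
  qed
  have \<gamma>0: "\<And>e. e \<in> faces \<Longrightarrow> \<gamma> 0 e > 0" using assms(20) unfolding \<Gamma>\<^sub>D_def by blast
  have J: "positive_form T p ?J"
    unfolding \<Gamma>\<^sub>D_def using \<gamma>0 by (intro positive_form_J0) (simp add: less_imp_le)
  have g: "positive_form T p ?g" unfolding \<Gamma>\<^sub>R_def by (rule positive_form_L2[OF \<Gamma>\<^sub>R_domain linear_op_glue])
  have m: "positive_form T p ?m" unfolding \<Omega>_def by (rule positive_form_L2[OF \<Omega>_domain linear_op_glue])
  have hb: "hermitian_form T p ?b" unfolding \<Omega>_def \<Gamma>\<^sub>D_def by (rule hermitian_form_b)
  have P: "positive_form T p P"
    unfolding P_def[abs_def] using assms(16) by (intro positive_form_add N J positive_form_scale g) simp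
  have hP: "hermitian_form T p P" and hm: "hermitian_form T p ?m" using P m unfolding positive_form_def by blast+
  have A_eq: "form_a \<Omega> \<Gamma>\<^sub>D T lab \<tau> p q \<beta>\<^sub>1 \<gamma> u v - (complex_of_real k)\<^sup>2 * ?m u v + \<i> * complex_of_real k * ?g u v = A u v" for u v
    unfolding A_def P_def form_a_def by (simp add: algebra_simps)
  have left: "A (lincomb T c u w) v = A u v + c * A w v"
    if "u \<in> dg_space T p" "w \<in> dg_space T p" "v \<in> dg_space T p" for c u w v
    unfolding A_def hermitian_form_lincomb_left[OF hb that] hermitian_form_lincomb_left[OF hm that]
      hermitian_form_lincomb_left[OF hP that] by (simp add: algebra_simps)
  have right: "A v (lincomb T c u w) = A v u + cnj c * A v w"
    if "u \<in> dg_space T p" "w \<in> dg_space T p" "v \<in> dg_space T p" for c u w v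
    unfolding A_def hermitian_form_lincomb_right[OF hb that] hermitian_form_lincomb_right[OF hm that]
      hermitian_form_lincomb_right[OF hP that] by (simp add: algebra_simps)
  have F: "F (lincomb T c u w) = F u + cnj c * F w" if "u \<in> dg_space T p" "w \<in> dg_space T p" for c u w
    using L2_inner_functional[OF \<Omega>_domain assms(17)[unfolded \<Omega>_def] linear_op_glue that]
      L2_inner_functional[OF \<Gamma>\<^sub>R_domain assms(18)[unfolded \<Gamma>\<^sub>R_def] linear_op_glue that]
    unfolding F_def \<Omega>_def \<Gamma>\<^sub>R_def by (simp add: algebra_simps)
  have kernel: "u K = (\<lambda>x. 0)"
    if u: "u \<in> dg_space T p" and s: "s \<noteq> 0" and K: "K \<in> T"
      and 0: "\<And>v. v \<in> dg_space T p \<Longrightarrow> ?b u v - complex_of_real (k\<^sup>2) * ?m u v + complex_of_real s * (\<i> * P u v) = 0" for u s K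
  proof (rule scheme_kernel_trivial[OF u assms(16) s N \<gamma>0 _ _ star1 starD K])
    show "p > 0" using assms(14) by simp
    show "form_b (\<Omega>\<^sub>1 - D) (frontier D) T lab u v
        - complex_of_real (k\<^sup>2) * L2_inner lebesgue (\<Omega>\<^sub>1 - D) (glue T u) (glue T v)
        + complex_of_real s * (\<i> * (?N u v + form_J0 (frontier D) T lab p (\<gamma> 0) u v +
            complex_of_real k * L2_inner surface_measure (frontier \<Omega>\<^sub>1) (glue T u) (glue T v))) = 0"
      if "v \<in> dg_space T p" for v
      using 0[OF that] unfolding P_def \<Omega>_def \<Gamma>\<^sub>D_def \<Gamma>\<^sub>R_def .
  qed
  have "\<exists>u\<in>dg_space T p. \<forall>v\<in>dg_space T p. A u v = F v"
  proof (rule solvable_if_adjoint_injective[OF finite_T left right F])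
    fix v assume v: "v \<in> dg_space T p" and 0: "\<And>u. u \<in> dg_space T p \<Longrightarrow> A u v = 0"
    have "v K = (\<lambda>x. 0)" if "K \<in> T" for K
    proof (rule kernel[OF v _ that])
      show "(- 1 :: real) \<noteq> 0" by simp
      fix u assume u: "u \<in> dg_space T p"
      \<comment> \<open>the conjugate of the adjoint equation is the kernel equation with \<open>s = - 1\<close>\<close>
      have "?b v u - complex_of_real (k\<^sup>2) * ?m v u + complex_of_real (- 1) * (\<i> * P v u) = cnj (A u v)"
        unfolding A_def hermitian_form_cnj[OF hb u v] hermitian_form_cnj[OF hm u v] hermitian_form_cnj[OF hP u v] by simp
      then show "?b v u - complex_of_real (k\<^sup>2) * ?m v u + complex_of_real (- 1) * (\<i> * P v u) = 0"
        using 0[OF u] by simp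
    qed
    then have "glue T v x = 0" for x by (simp add: glue_def)
    then show "F v = 0" by (simp add: F_def L2_inner_def)
  qed
  then obtain u where u: "u \<in> dg_space T p" "\<And>v. v \<in> dg_space T p \<Longrightarrow> A u v = F v" by blast
  show ?thesis unfolding A_eq F_def[symmetric]
  proof (rule ex1I[of _ u])
    show "u \<in> dg_space T p \<and> (\<forall>v\<in>dg_space T p. A u v = F v)" using u by blast
    fix w assume w: "w \<in> dg_space T p \<and> (\<forall>v\<in>dg_space T p. A w v = F v)"
    then have w': "w \<in> dg_space T p" by blast
    let ?d = "lincomb T (- 1) w u"
    have d: "?d \<in> dg_space T p" by (rule lincomb_closed[OF w' u(1)])
    have "?d K = (\<lambda>x. 0)" if "K \<in> T" for K
    proof (rule kernel[OF d _ that])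
      show "(1 :: real) \<noteq> 0" by simp
      fix v assume v: "v \<in> dg_space T p"
      have "A ?d v = 0" using left[OF w' u(1) v, of "- 1"] u(2)[OF v] w v by simp
      then show "?b ?d v - complex_of_real (k\<^sup>2) * ?m ?d v + complex_of_real 1 * (\<i> * P ?d v) = 0"
        by (simp add: A_def)
    qed
    then have eq: "w K = u K" if "K \<in> T" for K
      using that by (simp add: lincomb_apply fun_eq_iff)
    show "w = u"
      by (rule PiE_ext[OF w'[unfolded dg_space_def] u(1)[unfolded dg_space_def]]) (rule eq)
  qed
qed

end
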